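(* Let $U$ be a nonempty open submanifold of a compact manifold $M$ without boundary, of dimension $n\ge3$. Then the set of Riemannian metrics on $M$ for which no limiting Carleman weight exists on $U$ contains an open and dense subset of the set of all Riemannian metrics on $M$, where the latter is endowed with the $C^3$ topology if $n=3$ and with the $C^2$ topology if $n\ge4$.
   Context: Manifolds and Riemannian metrics are smooth. Limiting Carleman weight (LCW) on an open Riemannian manifold $(U,g)$: a function $\varphi\in C^\infty(U;\mathbb R)$ with $d\varphi\neq0$ everywhere such that the Poisson bracket $\{\overline{p_\varphi},p_\varphi\}$ vanishes at all points of $T^*U$ where $p_\varphi=0$, with $p_\varphi(x,\xi)=|\xi|_g^2-|d\varphi|_g^2+2i\langle\xi,d\varphi\rangle_g$. Known characterization (Dos Santos Ferreira–Kenig–Salo–Uhlmann): if an open manifold $(U,g)$ has an LCW, then some metric conformal to $g$ admits a parallel unit vector field; the converse holds when $U$ is simply connected. *)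

theory Defs
  imports "HOL-Analysis.Analysis"
begin

section \<open>Smooth functions of several variables\<close>

definition partial_deriv :: "'n \<Rightarrow> (real^'n \<Rightarrow> 'b) \<Rightarrow> real^'n \<Rightarrow> 'b::real_normed_vector"
  where "partial_deriv j f x = frechet_derivative f (at x) (axis j 1)"

definition iter_partial :: "'n list \<Rightarrow> (real^'n \<Rightarrow> 'b) \<Rightarrow> real^'n \<Rightarrow> 'b::real_normed_vector"
  where "iter_partial js f = foldr partial_deriv js f"

text \<open>To be used for open \<open>S\<close> only: there, \<open>f\<close> is smooth iff all its iterated partial
  derivatives (including \<open>f\<close> itself) are differentiable.\<close>

definition smooth_on :: "(real^'n) set \<Rightarrow> (real^'n \<Rightarrow> 'b::real_normed_vector) \<Rightarrow> bool"
  where "smooth_on S f \<longleftrightarrow> (\<forall>js. iter_partial js f differentiable_on S)"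


section \<open>Smooth manifolds\<close>

text \<open>A chart is a pair of its domain and its coordinate map; values of the coordinate map
  outside the domain are irrelevant.\<close>

type_synonym ('a, 'n) chart = "'a set \<times> ('a \<Rightarrow> real^'n)"

definition chart_inv :: "('a, 'n::finite) chart \<Rightarrow> real^'n \<Rightarrow> 'a"
  where "chart_inv c = inv_into (fst c) (snd c)"

definition transition :: "('a, 'n::finite) chart \<Rightarrow> ('a, 'n) chart \<Rightarrow> real^'n \<Rightarrow> real^'n"
  where "transition c d = snd d \<circ> chart_inv c"

definition is_chart :: "'a topology \<Rightarrow> ('a, 'n::finite) chart \<Rightarrow> bool"
  where "is_chart X c \<longleftrightarrow>
    openin X (fst c) \<and> open (snd c ` fst c) \<and>
    homeomorphic_map (subtopology X (fst c)) (top_of_set (snd c ` fst c)) (snd c)"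

definition smooth_atlas :: "'a topology \<Rightarrow> ('a, 'n::finite) chart set \<Rightarrow> bool"
  where "smooth_atlas X A \<longleftrightarrow>
    (\<forall>c\<in>A. is_chart X c) \<and> (\<Union>c\<in>A. fst c) = topspace X \<and>
    (\<forall>c\<in>A. \<forall>d\<in>A. smooth_on (snd c ` (fst c \<inter> fst d)) (transition c d))"

text \<open>Smooth manifold without boundary of dimension \<open>CARD('n)\<close>.  Its smooth structure is the
  one determined by the (not necessarily maximal) atlas \<open>A\<close>.\<close>

definition smooth_manifold :: "'a topology \<Rightarrow> ('a, 'n::finite) chart set \<Rightarrow> bool"
  where "smooth_manifold X A \<longleftrightarrow>
    Hausdorff_space X \<and>
    (\<exists>\<B>. countable \<B> \<and> (\<forall>V\<in>\<B>. openin X V) \<and>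
         (\<forall>V x. openin X V \<and> x \<in> V \<longrightarrow> (\<exists>W\<in>\<B>. x \<in> W \<and> W \<subseteq> V))) \<and>
    smooth_atlas X A"


section \<open>Riemannian metrics\<close>

text \<open>A metric is given by its coordinate matrices: \<open>g c x\<close> is the matrix \<open>(g\<^sub>i\<^sub>j)\<close> in the chart \<open>c\<close>
  at the coordinate point \<open>x\<close>.  The matrices in different charts are related by the
  transformation law of covariant 2-tensors.\<close>

type_synonym ('a, 'n) metric = "('a, 'n) chart \<Rightarrow> real^'n \<Rightarrow> real^'n^'n"

text \<open>The last condition fixes the irrelevant values, so that equal metrics are represented by
  equal functions.\<close>

definition riemannian_metrics :: "('a, 'n::finite) chart set \<Rightarrow> ('a, 'n) metric set"
  where "riemannian_metrics A = {g.
    (\<forall>c\<in>A. smooth_on (snd c ` fst c) (g c)) \<and>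
    (\<forall>c\<in>A. \<forall>x\<in>snd c ` fst c.
        transpose (g c x) = g c x \<and> (\<forall>v. v \<noteq> 0 \<longrightarrow> v \<bullet> (g c x *v v) > 0)) \<and>
    (\<forall>c\<in>A. \<forall>d\<in>A. \<forall>x\<in>snd c ` (fst c \<inter> fst d).
        let J = jacobian (transition c d) (at x)
        in g c x = transpose J ** g d (transition c d x) ** J) \<and>
    (\<forall>c x. c \<notin> A \<or> x \<notin> snd c ` fst c \<longrightarrow> g c x = 0)}"

text \<open>The \<open>C\<^sup>k\<close> topology: uniform convergence of the components and their partial derivatives up to
  order \<open>k\<close> on compact subsets of the chart domains.\<close>

definition metric_nbhd ::
  "'a topology \<Rightarrow> ('a, 'n::finite) chart set \<Rightarrow> nat \<Rightarrow> ('a, 'n) metric \<Rightarrow> ('a, 'n) chart \<Rightarrow> 'a set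
    \<Rightarrow> real \<Rightarrow> ('a, 'n) metric set"
  where "metric_nbhd X A k g c K e = {h \<in> riemannian_metrics A.
    \<forall>js. length js \<le> k \<longrightarrow>
      (\<forall>x\<in>snd c ` K. norm (iter_partial js (h c) x - iter_partial js (g c) x) < e)}"

definition Ck_metric_topology ::
  "'a topology \<Rightarrow> ('a, 'n::finite) chart set \<Rightarrow> nat \<Rightarrow> ('a, 'n) metric topology"
  where "Ck_metric_topology X A k = topology_generated_by
    (insert (riemannian_metrics A)
      {metric_nbhd X A k g c K e | g c K e.
         g \<in> riemannian_metrics A \<and> c \<in> A \<and> compactin X K \<and> K \<subseteq> fst c \<and> e > 0})"

lemma topspace_Ck_metric_topology:
  "topspace (Ck_metric_topology X A k) = riemannian_metrics A"
  by (auto simp: Ck_metric_topology_def metric_nbhd_def)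


section \<open>Limiting Carleman weights\<close>

text \<open>Poisson bracket of two functions of \<open>(x, \<xi>)\<close> in canonical coordinates of the cotangent
  bundle.\<close>

definition poisson_bracket ::
  "((real^'n) \<times> (real^'n) \<Rightarrow> complex) \<Rightarrow> ((real^'n) \<times> (real^'n) \<Rightarrow> complex)
    \<Rightarrow> (real^'n) \<times> (real^'n) \<Rightarrow> complex"
  where "poisson_bracket p q z =
    (let Dp = frechet_derivative p (at z); Dq = frechet_derivative q (at z)
     in \<Sum>j\<in>UNIV. Dp (0, axis j 1) * Dq (axis j 1, 0) - Dp (axis j 1, 0) * Dq (0, axis j 1))"

text \<open>Inner product of covectors with respect to the metric with matrix \<open>G\<close>.\<close>

definition coinner :: "real^'n^'n \<Rightarrow> real^'n \<Rightarrow> real^'n \<Rightarrow> real"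
  where "coinner G \<xi> \<eta> = \<xi> \<bullet> (matrix_inv G *v \<eta>)"

text \<open>The components of the differential of \<open>\<phi>\<close> in the chart \<open>c\<close>.\<close>

definition differential ::
  "('a, 'n::finite) chart \<Rightarrow> ('a \<Rightarrow> real) \<Rightarrow> real^'n \<Rightarrow> real^'n"
  where "differential c \<phi> x = (\<chi> j. partial_deriv j (\<phi> \<circ> chart_inv c) x)"

definition carleman_symbol ::
  "('a, 'n::finite) metric \<Rightarrow> ('a \<Rightarrow> real) \<Rightarrow> ('a, 'n) chart
    \<Rightarrow> (real^'n) \<times> (real^'n) \<Rightarrow> complex"
  where "carleman_symbol g \<phi> c = (\<lambda>(x, \<xi>).
    let G = g c x; d\<phi> = differential c \<phi> x
    in of_real (coinner G \<xi> \<xi> - coinner G d\<phi> d\<phi>) + 2 * \<i> * of_real (coinner G \<xi> d\<phi>))"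

text \<open>\<open>\<phi>\<close> is a limiting Carleman weight on the open subset \<open>U\<close> with the restriction of the metric
  \<open>g\<close>; values of \<open>\<phi>\<close> outside \<open>U\<close> are irrelevant.\<close>

definition limiting_carleman_weight ::
  "('a, 'n::finite) chart set \<Rightarrow> ('a, 'n) metric \<Rightarrow> 'a set \<Rightarrow> ('a \<Rightarrow> real) \<Rightarrow> bool"
  where "limiting_carleman_weight A g U \<phi> \<longleftrightarrow>
    (\<forall>c\<in>A.
      smooth_on (snd c ` (fst c \<inter> U)) (\<phi> \<circ> chart_inv c) \<and>
      (\<forall>x\<in>snd c ` (fst c \<inter> U).
        differential c \<phi> x \<noteq> 0 \<and>
        (\<forall>\<xi>. carleman_symbol g \<phi> c (x, \<xi>) = 0 \<longrightarrow>
          poisson_bracket (cnj \<circ> carleman_symbol g \<phi> c) (carleman_symbol g \<phi> c) (x, \<xi>) = 0)))"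

end

theory Submission
  imports Defs
begin

text \<open>If \<open>\<phi>\<close> is a limiting Carleman weight and \<open>f = ln |grad \<phi>|\<close>, then \<open>\<phi>\<close> has vanishing Hessian
  with respect to \<open>e\<^sup>2\<^sup>f g\<close>, so that \<open>v = grad \<phi>\<close> annihilates the curvature of that metric. Expressing it
  through the curvature \<open>R\<close> of \<open>g\<close> gives \<open>R(X, Y, Z, v) = 0\<close> for mutually orthogonal \<open>X, Y, Z\<close> with
  \<open>X, Y\<close> orthogonal to \<open>v\<close>; in dimension 3, where this is void, one more differentiation yields a condition
  on \<open>\<nabla>R\<close> alone. At a single point \<open>x\<close> these are closed conditions on the 2-jet (3-jet) of \<open>g\<close> and
  a unit vector \<open>v\<close>, and compactness of the unit sphere shows that the metrics for which they have no
  solution \<open>v\<close> form an open set.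

  For density, perturb \<open>g\<close> by \<open>s\<^sub>1 h\<^sub>1 + \<dots> + s\<^sub>n h\<^sub>n\<close>, where the tensors \<open>h\<^sub>b\<close> have compact support and
  only change the leading jet at \<open>x\<close>. Then \<open>n\<close> of the conditions become a linear system \<open>M(v) s = b(v)\<close>,
  and the \<open>h\<^sub>b\<close> can be chosen with \<open>M(v)\<close> invertible near a given unit vector. The bad parameters
  \<open>s = M(v)\<inverse> b(v)\<close> are the differentiable image of a piece of the unit sphere in an \<open>n\<close>-dimensional
  space, a null set. Finitely many such pieces cover the sphere.\<close>

section \<open>Calculus of smooth functions\<close>

text \<open>The C^3 topology in dimension 3 has a conformal reason: the Weyl tensor vanishes there,
  and the first local conformal invariant is the Cotton tensor, which contains third derivatives of
  the metric. The number n of parameters is dictated by the unknown direction: v runs over a sphere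
  of dimension n - 1, so n independent equations exceed the freedom in v by one. These equations
  must be fixed functions of v, although their arguments have to be orthogonal to v; this is why
  Gram-Schmidt is applied to constant vectors, without denominators that could vanish. Treating the
  sphere piece by piece creates two dangers. A later perturbation could spoil an earlier piece; but
  nondegeneracy on a closed set of directions is an open condition, so later perturbations can be
  chosen small enough. The size of a piece could also shrink with the changing metric; but M(v)
  depends on the metric only through its matrix G at x, and the tensors h vanish at x, so that G and
  with it all sizes are fixed from the start.\<close>

definition ddir :: "'a::real_normed_vector \<Rightarrow> ('a \<Rightarrow> 'b::real_normed_vector) \<Rightarrow> 'a \<Rightarrow> 'b"
  where "ddir v f x = frechet_derivative f (at x) v"

lemma partial_deriv_ddir: "partial_deriv j f = ddir (axis j 1) f"
  by (simp add: fun_eq_iff partial_deriv_def ddir_def)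

lemma frechet_derivative_cong_open:
  assumes "open S" "x \<in> S" "\<And>y. y \<in> S \<Longrightarrow> f y = g y"
  shows "frechet_derivative f (at x) = frechet_derivative g (at x)"
proof -
  have "(f has_derivative f') (at x) \<longleftrightarrow> (g has_derivative f') (at x)" for f'
    using has_derivative_transform_within_open[OF _ assms(1,2)] assms(3) by metis
  then show ?thesis by (simp add: frechet_derivative_def)
qed

lemma ddir_cong_open:
  assumes "open S" "x \<in> S" "\<And>y. y \<in> S \<Longrightarrow> f y = g y"
  shows "ddir v f x = ddir v g x"
  unfolding ddir_def using frechet_derivative_cong_open[OF assms] by simp

lemma ddir_has_derivative: "(f has_derivative f') (at x) \<Longrightarrow> ddir v f x = f' v"
  by (simp add: ddir_def frechet_derivative_at[symmetric])

lemma differentiable_has_ddir: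
  "f differentiable (at x) \<Longrightarrow> (f has_derivative (\<lambda>v. ddir v f x)) (at x)"
  unfolding ddir_def by (metis frechet_derivative_works)

lemma ddir_linear: "f differentiable (at x) \<Longrightarrow> linear (\<lambda>v. ddir v f x)"
  using differentiable_has_ddir has_derivative_linear by blast

lemma ddir_add_dir: "f differentiable (at x) \<Longrightarrow> ddir (v + w) f x = ddir v f x + ddir w f x"
  using ddir_linear linear_add by blast

lemma ddir_scale_dir: "f differentiable (at x) \<Longrightarrow> ddir (r *\<^sub>R v) f x = r *\<^sub>R ddir v f x"
  using ddir_linear linear_scale by blast

lemma ddir_expand:
  fixes x :: "real^'n"
  assumes "f differentiable (at x)"
  shows "ddir v f x = (\<Sum>j\<in>UNIV. (v $ j) *\<^sub>R partial_deriv j f x)"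
proof -
  have l: "linear (\<lambda>v. ddir v f x)" using ddir_linear assms by blast
  have "v = (\<Sum>j\<in>UNIV. (v $ j) *\<^sub>R axis j 1)"
    by (simp add: basis_expansion flip: scalar_mult_eq_scaleR)
  then have "ddir v f x = ddir (\<Sum>j\<in>UNIV. (v $ j) *\<^sub>R axis j 1) f x" by simp
  also have "\<dots> = (\<Sum>j\<in>UNIV. (v $ j) *\<^sub>R ddir (axis j 1) f x)"
    by (simp add: linear_sum[OF l] linear_scale[OF l])
  finally show ?thesis by (simp add: partial_deriv_ddir)
qed

lemma ddir_const [simp]: "ddir v (\<lambda>x. c) x = 0"
  by (rule ddir_has_derivative[where f' = "\<lambda>_. 0", THEN trans]) auto

lemma ddir_add:
  assumes "f differentiable (at x)" "g differentiable (at x)"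
  shows "ddir v (\<lambda>x. f x + g x) x = ddir v f x + ddir v g x"
  by (rule ddir_has_derivative[OF has_derivative_add[OF differentiable_has_ddir differentiable_has_ddir], OF assms])

lemma ddir_diff:
  assumes "f differentiable (at x)" "g differentiable (at x)"
  shows "ddir v (\<lambda>x. f x - g x) x = ddir v f x - ddir v g x"
  by (rule ddir_has_derivative[OF has_derivative_diff[OF differentiable_has_ddir differentiable_has_ddir], OF assms])

lemma ddir_sum:
  assumes "\<And>i. i \<in> I \<Longrightarrow> f i differentiable (at x)"
  shows "ddir v (\<lambda>x. \<Sum>i\<in>I. f i x) x = (\<Sum>i\<in>I. ddir v (f i) x)"
  by (rule ddir_has_derivative[OF has_derivative_sum]) (simp add: assms differentiable_has_ddir)

lemma ddir_bilinear:
  assumes "bounded_bilinear pr" "f differentiable (at x)" "g differentiable (at x)"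
  shows "ddir v (\<lambda>x. pr (f x) (g x)) x = pr (f x) (ddir v g x) + pr (ddir v f x) (g x)"
  by (rule ddir_has_derivative[OF bounded_bilinear.FDERIV[OF assms(1) differentiable_has_ddir differentiable_has_ddir], OF assms(2,3)])

lemma ddir_bounded_linear:
  assumes "bounded_linear L" "f differentiable (at x)"
  shows "ddir v (\<lambda>x. L (f x)) x = L (ddir v f x)"
  by (rule ddir_has_derivative[OF bounded_linear.has_derivative[OF assms(1) differentiable_has_ddir], OF assms(2)])

lemma ddir_mult:
  fixes f g :: "'a::real_normed_vector \<Rightarrow> real"
  assumes "f differentiable (at x)" "g differentiable (at x)"
  shows "ddir v (\<lambda>x. f x * g x) x = f x * ddir v g x + ddir v f x * g x"
  by (rule ddir_bilinear[OF bounded_bilinear_mult assms])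

lemma differentiable_bilinear:
  assumes "bounded_bilinear pr" "f differentiable (at x)" "g differentiable (at x)"
  shows "(\<lambda>x. pr (f x) (g x)) differentiable (at x)"
  by (rule differentiableI[OF bounded_bilinear.FDERIV[OF assms(1) differentiable_has_ddir differentiable_has_ddir]]) fact+

lemma differentiable_on_bilinear:
  assumes "open S" "bounded_bilinear pr" "f differentiable_on S" "g differentiable_on S"
  shows "(\<lambda>x. pr (f x) (g x)) differentiable_on S"
  unfolding differentiable_on_eq_differentiable_at[OF assms(1)]
proof
  fix x assume "x \<in> S"
  then have "f differentiable (at x)" "g differentiable (at x)"
    using assms(3,4) by (auto simp: differentiable_on_eq_differentiable_at[OF assms(1)])
  then show "(\<lambda>x. pr (f x) (g x)) differentiable (at x)"
    by (rule differentiable_bilinear[OF assms(2)])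
qed

lemma differentiable_bounded_linear:
  assumes "bounded_linear L" "f differentiable (at x)"
  shows "(\<lambda>x. L (f x)) differentiable (at x)"
  by (rule differentiableI[OF bounded_linear.has_derivative[OF assms(1) differentiable_has_ddir]]) fact

lemma differentiable_on_bounded_linear:
  assumes "open S" "bounded_linear L" "f differentiable_on S"
  shows "(\<lambda>x. L (f x)) differentiable_on S"
  unfolding differentiable_on_eq_differentiable_at[OF assms(1)]
proof
  fix x assume "x \<in> S"
  then have "f differentiable (at x)"
    using assms(3) by (auto simp: differentiable_on_eq_differentiable_at[OF assms(1)])
  then show "(\<lambda>x. L (f x)) differentiable (at x)"
    by (rule differentiable_bounded_linear[OF assms(2)])
qed

lemma ddir_comp:
  assumes "f differentiable (at x)" "g differentiable (at (f x))"
  shows "ddir v (\<lambda>x. g (f x)) x = ddir (ddir v f x) g (f x)"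
proof -
  have "(g \<circ> f has_derivative (\<lambda>w. ddir w g (f x)) \<circ> (\<lambda>v. ddir v f x)) (at x)"
    by (intro diff_chain_at differentiable_has_ddir assms)
  from ddir_has_derivative[OF this] show ?thesis by (simp add: o_def)
qed

text \<open>The order k supplies the induction that \<open>smooth_on\<close> lacks: closure
  properties are proved for each order and then transferred. A list of partial derivatives is
  applied starting with its last entry, so the recursion here peels lists off from the
  right.\<close>

fun diffk :: "nat \<Rightarrow> (real^'n) set \<Rightarrow> (real^'n \<Rightarrow> 'b::real_normed_vector) \<Rightarrow> bool" where
  "diffk 0 S f \<longleftrightarrow> f differentiable_on S"
| "diffk (Suc k) S f \<longleftrightarrow> f differentiable_on S \<and> (\<forall>j. diffk k S (partial_deriv j f))"

lemma diffk_iff: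
  fixes f :: "real^'n::finite \<Rightarrow> 'b::real_normed_vector"
  shows "diffk k S f \<longleftrightarrow> (\<forall>js. length js \<le> k \<longrightarrow> iter_partial js f differentiable_on S)"
proof (induction k arbitrary: f)
  case 0
  then show ?case by (simp add: iter_partial_def)
next
  case (Suc k)
  have "(\<forall>js. length js \<le> Suc k \<longrightarrow> iter_partial js f differentiable_on S) \<longleftrightarrow>
    f differentiable_on S \<and> (\<forall>j js. length js \<le> k \<longrightarrow> iter_partial (js @ [j]) f differentiable_on S)"
  proof (intro iffI conjI allI impI; (elim conjE)?)
    assume *: "\<forall>js. length js \<le> Suc k \<longrightarrow> iter_partial js f differentiable_on S"
    show "f differentiable_on S" using *[rule_format, of "[]"] by (simp add: iter_partial_def)
    show "iter_partial (js @ [j]) f differentiable_on S" if "length js \<le> k" for js j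
      using * that by simp
  next
    fix js :: "'n list"
    assume *: "f differentiable_on S" "length js \<le> Suc k"
      "\<forall>j js. length js \<le> k \<longrightarrow> iter_partial (js @ [j]) f differentiable_on S"
    show "iter_partial js f differentiable_on S"
      using * by (cases js rule: rev_cases) (auto simp: iter_partial_def)
  qed
  then show ?case using Suc.IH by (simp add: iter_partial_def)
qed

lemma smooth_on_diffk: "smooth_on S f \<longleftrightarrow> (\<forall>k. diffk k S f)"
  by (auto simp: smooth_on_def diffk_iff)

lemma diffk_mono: "diffk k S f \<Longrightarrow> l \<le> k \<Longrightarrow> diffk l S f"
  by (auto simp: diffk_iff)

lemma diffk_SucD: "diffk (Suc k) S f \<Longrightarrow> diffk k S f"
  using diffk_mono by (metis le_add2 plus_1_eq_Suc)

lemma smooth_on_partial: "smooth_on S f \<Longrightarrow> smooth_on S (partial_deriv j f)"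
  unfolding smooth_on_diffk using diffk.simps(2)[of _ S f] by blast

lemma smooth_on_iter_partial: "smooth_on S f \<Longrightarrow> smooth_on S (iter_partial js f)"
  by (induction js) (auto simp: iter_partial_def smooth_on_partial)

lemma smooth_on_differentiable_on: "smooth_on S f \<Longrightarrow> f differentiable_on S"
  unfolding smooth_on_diffk using diffk.simps(1)[of S f] by blast

lemma smooth_on_differentiable: "smooth_on S f \<Longrightarrow> open S \<Longrightarrow> x \<in> S \<Longrightarrow> f differentiable (at x)"
  using smooth_on_differentiable_on differentiable_on_eq_differentiable_at by blast

lemma smooth_on_continuous_on: "smooth_on S f \<Longrightarrow> continuous_on S f"
  by (simp add: differentiable_imp_continuous_on smooth_on_differentiable_on)

lemma differentiable_on_cong: "(\<And>y. y \<in> S \<Longrightarrow> f y = g y) \<Longrightarrow> f differentiable_on S \<longleftrightarrow> g differentiable_on S"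
  unfolding differentiable_on_def differentiable_def
  using has_derivative_transform[of _ S g f] has_derivative_transform[of _ S f g] by fastforce

lemma iter_partial_cong:
  assumes "open S" "\<And>y. y \<in> S \<Longrightarrow> f y = g y" "x \<in> S"
  shows "iter_partial js f x = iter_partial js g x"
  using assms(3)
proof (induction js arbitrary: x)
  case (Cons j js)
  then show ?case
    using ddir_cong_open[OF assms(1), of x "iter_partial js f" "iter_partial js g"]
    by (simp add: iter_partial_def partial_deriv_ddir)
qed (simp add: iter_partial_def assms(2))

lemma smooth_on_cong:
  assumes "open S" "\<And>y. y \<in> S \<Longrightarrow> f y = g y"
  shows "smooth_on S f \<longleftrightarrow> smooth_on S g"
  unfolding smooth_on_def by (intro all_cong1 differentiable_on_cong iter_partial_cong[OF assms])

lemma diffk_cong: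
  assumes "open S" "\<And>y. y \<in> S \<Longrightarrow> f y = g y"
  shows "diffk k S f \<longleftrightarrow> diffk k S g"
  unfolding diffk_iff by (intro all_cong1 imp_cong refl differentiable_on_cong iter_partial_cong[OF assms])

lemma diffk_eqI:
  assumes "open S" "diffk k S g" "\<And>y. y \<in> S \<Longrightarrow> f y = g y"
  shows "diffk k S f"
  using diffk_cong[of S f g k] assms by blast

lemma smooth_on_eqI:
  assumes "open S" "smooth_on S g" "\<And>y. y \<in> S \<Longrightarrow> f y = g y"
  shows "smooth_on S f"
  using smooth_on_cong[of S f g] assms by blast

lemma smooth_on_subset: "smooth_on T f \<Longrightarrow> S \<subseteq> T \<Longrightarrow> smooth_on S f"
  unfolding smooth_on_def using differentiable_on_subset by blast

lemma smooth_on_local: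
  assumes "open S" "\<And>x. x \<in> S \<Longrightarrow> \<exists>T. open T \<and> x \<in> T \<and> smooth_on T f"
  shows "smooth_on S f"
  unfolding smooth_on_def differentiable_on_def
proof (intro allI ballI)
  fix js x assume "x \<in> S"
  then obtain T where T: "open T" "x \<in> T" "smooth_on T f" using assms(2) by blast
  then have "iter_partial js f differentiable (at x)"
    using smooth_on_differentiable smooth_on_iter_partial by blast
  then show "iter_partial js f differentiable at x within S"
    using differentiable_at_withinI by blast
qed

section \<open>Closure properties of smooth maps\<close>

lemma partial_deriv_const: "partial_deriv j (\<lambda>x. c) = (\<lambda>x. 0)"
  by (rule ext) (simp only: partial_deriv_ddir ddir_const)

lemma diffk_const:
  fixes c :: "'c::real_normed_vector" and S :: "(real^'n::finite) set"
  shows "diffk k S (\<lambda>x. c)"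
proof -
  have z: "diffk k S (\<lambda>x. 0 :: 'c)" for k by (induction k) (auto simp: partial_deriv_const)
  show ?thesis by (cases k) (auto simp: z partial_deriv_const)
qed

lemma smooth_on_const [simp, intro]: "smooth_on S (\<lambda>x. c)"
  by (simp add: smooth_on_diffk diffk_const)

lemma diffk_add:
  assumes "open S" "diffk k S f" "diffk k S g"
  shows "diffk k S (\<lambda>x. f x + g x)"
  using assms(2,3)
proof (induction k arbitrary: f g)
  case 0
  then show ?case by (simp add: differentiable_on_def)
next
  case (Suc k)
  have "diffk k S (partial_deriv j (\<lambda>x. f x + g x))" for j
  proof -
    have "diffk k S (\<lambda>x. partial_deriv j f x + partial_deriv j g x)" using Suc by simp
    moreover have "partial_deriv j (\<lambda>x. f x + g x) x = partial_deriv j f x + partial_deriv j g x" if "x \<in> S" for x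
      unfolding partial_deriv_ddir using Suc.prems that assms(1)
      by (intro ddir_add) (auto simp: differentiable_on_eq_differentiable_at)
    ultimately show ?thesis by (rule diffk_eqI[OF assms(1)])
  qed
  then show ?case using Suc.prems by (simp add: differentiable_on_def)
qed

lemma diffk_sum:
  assumes "open S" "\<And>i. i \<in> I \<Longrightarrow> diffk k S (f i)"
  shows "diffk k S (\<lambda>x. \<Sum>i\<in>I. f i x)"
  using assms(2)
proof (induction I rule: infinite_finite_induct)
  case (insert i I)
  then show ?case using diffk_add[OF assms(1), of k "f i"] by simp
qed (simp_all add: diffk_const)

lemma diffk_bounded_linear:
  assumes "open S" "bounded_linear L" "diffk k S f"
  shows "diffk k S (\<lambda>x. L (f x))"
  using assms(3)
proof (induction k arbitrary: f)
  case 0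
  then show ?case by (simp add: differentiable_on_bounded_linear[OF assms(1,2)])
next
  case (Suc k)
  have d: "f differentiable (at x)" if "x \<in> S" for x
    using Suc.prems that assms(1) by (auto simp: differentiable_on_eq_differentiable_at)
  have "diffk k S (partial_deriv j (\<lambda>x. L (f x)))" for j
  proof -
    have "diffk k S (\<lambda>x. L (partial_deriv j f x))" using Suc by simp
    moreover have "partial_deriv j (\<lambda>x. L (f x)) x = L (partial_deriv j f x)" if "x \<in> S" for x
      unfolding partial_deriv_ddir by (rule ddir_bounded_linear[OF assms(2) d[OF that]])
    ultimately show ?thesis by (rule diffk_eqI[OF assms(1)])
  qed
  then show ?case using differentiable_on_bounded_linear[OF assms(1,2), of f] Suc.prems by simp
qed

text \<open>In each summand of the product rule only one factor loses an order. This one statement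
  later serves scalar, inner and matrix products.\<close>

lemma diffk_bilinear:
  assumes "open S" "bounded_bilinear pr" "diffk k S f" "diffk k S g"
  shows "diffk k S (\<lambda>x. pr (f x) (g x))"
  using assms(3,4)
proof (induction k arbitrary: f g)
  case 0
  then show ?case using differentiable_on_bilinear[OF assms(1,2), of f g] by simp
next
  case (Suc k)
  have d: "f differentiable (at x)" "g differentiable (at x)" if "x \<in> S" for x
    using Suc.prems that assms(1) by (auto simp: differentiable_on_eq_differentiable_at)
  have "diffk k S (partial_deriv j (\<lambda>x. pr (f x) (g x)))" for j
  proof -
    have "diffk k S (\<lambda>x. pr (f x) (partial_deriv j g x) + pr (partial_deriv j f x) (g x))"
    proof (intro diffk_add assms(1))
      show "diffk k S (\<lambda>x. pr (f x) (partial_deriv j g x))"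
        by (rule Suc.IH[OF diffk_SucD[OF Suc.prems(1)]]) (use Suc.prems in simp)
      show "diffk k S (\<lambda>x. pr (partial_deriv j f x) (g x))"
        by (rule Suc.IH[OF _ diffk_SucD[OF Suc.prems(2)]]) (use Suc.prems in simp)
    qed
    moreover have "partial_deriv j (\<lambda>x. pr (f x) (g x)) x
       = pr (f x) (partial_deriv j g x) + pr (partial_deriv j f x) (g x)" if "x \<in> S" for x
      unfolding partial_deriv_ddir by (rule ddir_bilinear[OF assms(2) d[OF that]])
    ultimately show ?thesis by (rule diffk_eqI[OF assms(1)])
  qed
  then show ?case using differentiable_on_bilinear[OF assms(1,2), of f g] Suc.prems by simp
qed

lemma smooth_on_add: "open S \<Longrightarrow> smooth_on S f \<Longrightarrow> smooth_on S g \<Longrightarrow> smooth_on S (\<lambda>x. f x + g x)"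
  by (simp add: smooth_on_diffk diffk_add)

lemma smooth_on_bounded_linear:
  "open S \<Longrightarrow> bounded_linear L \<Longrightarrow> smooth_on S f \<Longrightarrow> smooth_on S (\<lambda>x. L (f x))"
  by (simp add: smooth_on_diffk diffk_bounded_linear)

lemma smooth_on_bilinear:
  "open S \<Longrightarrow> bounded_bilinear pr \<Longrightarrow> smooth_on S f \<Longrightarrow> smooth_on S g \<Longrightarrow> smooth_on S (\<lambda>x. pr (f x) (g x))"
  by (simp add: smooth_on_diffk diffk_bilinear)

lemma smooth_on_minus: "open S \<Longrightarrow> smooth_on S f \<Longrightarrow> smooth_on S (\<lambda>x. - f x)"
  by (rule smooth_on_bounded_linear[where L = uminus]) (auto intro: bounded_linear_minus bounded_linear_ident)

lemma smooth_on_diff: "open S \<Longrightarrow> smooth_on S f \<Longrightarrow> smooth_on S g \<Longrightarrow> smooth_on S (\<lambda>x. f x - g x)"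
  using smooth_on_add[of S f "\<lambda>x. - g x"] smooth_on_minus by fastforce

lemma smooth_on_sum:
  assumes "open S" "\<And>i. i \<in> I \<Longrightarrow> smooth_on S (f i)"
  shows "smooth_on S (\<lambda>x. \<Sum>i\<in>I. f i x)"
  using assms by (simp add: smooth_on_diffk diffk_sum)

lemma smooth_on_mult:
  fixes f g :: "real^'n \<Rightarrow> 'b::real_normed_algebra"
  shows "open S \<Longrightarrow> smooth_on S f \<Longrightarrow> smooth_on S g \<Longrightarrow> smooth_on S (\<lambda>x. f x * g x)"
  by (rule smooth_on_bilinear[OF _ bounded_bilinear_mult])

lemma smooth_on_scaleR:
  "open S \<Longrightarrow> smooth_on S f \<Longrightarrow> smooth_on S g \<Longrightarrow> smooth_on S (\<lambda>x. f x *\<^sub>R g x)"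
  by (rule smooth_on_bilinear[OF _ bounded_bilinear_scaleR])

lemma smooth_on_inner:
  "open S \<Longrightarrow> smooth_on S f \<Longrightarrow> smooth_on S g \<Longrightarrow> smooth_on S (\<lambda>x. f x \<bullet> g x)"
  by (rule smooth_on_bilinear[OF _ bounded_bilinear_inner])

lemma diffk_ident:
  fixes S :: "(real^'n::finite) set"
  shows "diffk k S (\<lambda>x. x)"
proof (cases k)
  case (Suc l)
  have "partial_deriv j (\<lambda>x::real^'n. x) = (\<lambda>x. axis j 1)" for j :: 'n
    unfolding partial_deriv_ddir by (rule ext, rule ddir_has_derivative[THEN trans], rule has_derivative_ident) simp
  then show ?thesis using Suc by (simp add: diffk_const)
qed simp

lemma smooth_on_ident [simp, intro]: "smooth_on S (\<lambda>x. x)"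
  by (simp add: smooth_on_diffk diffk_ident)

lemma smooth_on_prod:
  fixes f :: "'i \<Rightarrow> real^'n \<Rightarrow> real"
  assumes "open S" "\<And>i. i \<in> I \<Longrightarrow> smooth_on S (f i)"
  shows "smooth_on S (\<lambda>x. \<Prod>i\<in>I. f i x)"
  using assms(2)
proof (induction I rule: infinite_finite_induct)
  case (insert i I)
  then show ?case using smooth_on_mult[OF assms(1), of "f i"] by simp
qed auto

text \<open>Bootstrapping: if derivatives of members are built from members of the same family,
  order k for the whole family gives order k + 1. It is applied to reciprocals, as a family with one
  member, and to \<open>flat_exp\<close>.\<close>

lemma smooth_on_family:
  fixes F :: "'i \<Rightarrow> real^'n \<Rightarrow> 'b::real_normed_vector"
  assumes "open S" "\<And>i. F i differentiable_on S"
    and "\<And>i j k. (\<And>i. diffk k S (F i)) \<Longrightarrow> diffk k S (partial_deriv j (F i))"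
  shows "smooth_on S (F i)"
proof -
  have "\<forall>i. diffk k S (F i)" for k
  proof (induction k)
    case 0
    then show ?case using assms(2) by simp
  next
    case (Suc k)
    then show ?case using assms(2,3) by simp
  qed
  then show ?thesis by (simp add: smooth_on_diffk)
qed

lemma smooth_on_inverse:
  fixes f :: "real^'n \<Rightarrow> real"
  assumes "open S" "smooth_on S f" "\<And>x. x \<in> S \<Longrightarrow> f x \<noteq> 0"
  shows "smooth_on S (\<lambda>x. inverse (f x))"
proof -
  have d: "f differentiable (at x)" if "x \<in> S" for x using assms that smooth_on_differentiable by blast
  have "smooth_on S ((\<lambda>u::unit. (\<lambda>x. inverse (f x))) ())"
  proof (rule smooth_on_family[OF assms(1)])
    show "(\<lambda>x. inverse (f x)) differentiable_on S"
      using d assms by (auto simp: differentiable_on_eq_differentiable_at)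
    fix j k assume k: "\<And>i::unit. diffk k S (\<lambda>x. inverse (f x))"
    have "partial_deriv j (\<lambda>x. inverse (f x)) x = - (inverse (f x) * partial_deriv j f x * inverse (f x))" if "x \<in> S" for x
      unfolding partial_deriv_ddir
      by (rule ddir_has_derivative[OF Deriv.has_derivative_inverse[OF _ differentiable_has_ddir]]) (use d assms that in auto)
    moreover have "diffk k S (\<lambda>x. - (inverse (f x) * partial_deriv j f x * inverse (f x)))"
      using k assms(2) smooth_on_partial[of S f j]
      by (intro diffk_bounded_linear[OF assms(1) bounded_linear_minus[OF bounded_linear_ident]]
          diffk_bilinear[OF assms(1) bounded_bilinear_mult]) (auto simp: smooth_on_diffk)
    ultimately show "diffk k S (partial_deriv j (\<lambda>x. inverse (f x)))"
      by (rule diffk_eqI[OF assms(1), rotated])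
  qed
  then show ?thesis by simp
qed

lemma smooth_on_divide:
  fixes f g :: "real^'n \<Rightarrow> real"
  assumes "open S" "smooth_on S f" "smooth_on S g" "\<And>x. x \<in> S \<Longrightarrow> g x \<noteq> 0"
  shows "smooth_on S (\<lambda>x. f x / g x)"
  unfolding divide_inverse by (intro smooth_on_mult smooth_on_inverse assms)

lemma smooth_on_of_partials:
  assumes "f differentiable_on S" "\<And>j. smooth_on S (partial_deriv j f)"
  shows "smooth_on S f"
proof -
  have "diffk k S f" for k
    using assms diffk_SucD[of k S f] by (simp add: smooth_on_diffk)
  then show ?thesis by (simp add: smooth_on_diffk)
qed

lemma smooth_on_ln:
  fixes f :: "real^'n \<Rightarrow> real"
  assumes "open S" "smooth_on S f" "\<And>x. x \<in> S \<Longrightarrow> f x > 0"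
  shows "smooth_on S (\<lambda>x. ln (f x))"
    and "x \<in> S \<Longrightarrow> ddir v (\<lambda>x. ln (f x)) x = ddir v f x / f x"
proof -
  have hd: "((\<lambda>x. ln (f x)) has_derivative (\<lambda>v. ddir v f x / f x)) (at x)" if "x \<in> S" for x
    using has_derivative_ln[OF _ differentiable_has_ddir[OF smooth_on_differentiable[OF assms(2,1) that]]]
      assms(3)[OF that] by (simp add: divide_inverse)
  then show "x \<in> S \<Longrightarrow> ddir v (\<lambda>x. ln (f x)) x = ddir v f x / f x"
    using ddir_has_derivative by blast
  show "smooth_on S (\<lambda>x. ln (f x))"
  proof (rule smooth_on_of_partials)
    show "(\<lambda>x. ln (f x)) differentiable_on S"
      using hd by (auto simp: differentiable_on_def differentiable_def intro: has_derivative_at_withinI)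
    fix j
    have "smooth_on S (\<lambda>x. partial_deriv j f x / f x)"
      using assms by (intro smooth_on_divide smooth_on_partial) (auto simp: less_imp_neq[THEN not_sym])
    moreover have "partial_deriv j (\<lambda>x. ln (f x)) x = partial_deriv j f x / f x" if "x \<in> S" for x
      using ddir_has_derivative[OF hd[OF that]] by (simp add: partial_deriv_ddir)
    ultimately show "smooth_on S (partial_deriv j (\<lambda>x. ln (f x)))"
      by (rule smooth_on_eqI[OF assms(1)])
  qed
qed

lemma smooth_on_ddir:
  assumes "open S" "smooth_on S f"
  shows "smooth_on S (ddir v f)"
proof -
  have "smooth_on S (\<lambda>x. \<Sum>j\<in>UNIV. (v $ j) *\<^sub>R partial_deriv j f x)"
    by (intro smooth_on_sum smooth_on_scaleR smooth_on_partial assms smooth_on_const)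
  then show ?thesis
    by (rule smooth_on_eqI[OF assms(1)]) (rule ddir_expand[OF smooth_on_differentiable[OF assms(2,1)]])
qed

text \<open>The chain rule writes a partial derivative as a sum of smooth functions times partial
  derivatives of f composed with \<psi>; only f loses an order, so the induction runs over
  f.\<close>

lemma diffk_comp:
  fixes f :: "real^'m \<Rightarrow> 'b::real_normed_vector" and \<psi> :: "real^'n \<Rightarrow> real^'m"
  assumes "open S" "open T" "smooth_on S \<psi>" "\<psi> ` S \<subseteq> T" "diffk k T f"
  shows "diffk k S (\<lambda>x. f (\<psi> x))"
  using assms(5)
proof (induction k arbitrary: f)
  case 0
  have "(\<lambda>x. f (\<psi> x)) differentiable (at x)" if "x \<in> S" for x
    using differentiable_chain_at[OF smooth_on_differentiable[OF assms(3,1) that], of f] 0 that assms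
    by (auto simp: o_def differentiable_on_eq_differentiable_at image_subset_iff)
  then show ?case using assms by (auto simp: differentiable_on_eq_differentiable_at)
next
  case (Suc k)
  have df: "f differentiable (at (\<psi> x))" "\<psi> differentiable (at x)" if "x \<in> S" for x
    using Suc.prems that assms smooth_on_differentiable by (auto simp: differentiable_on_eq_differentiable_at image_subset_iff)
  have d: "(\<lambda>x. f (\<psi> x)) differentiable (at x)" if "x \<in> S" for x
    using differentiable_chain_at[OF df(2)[OF that] df(1)[OF that]] by (simp add: o_def)
  have "diffk k S (partial_deriv j (\<lambda>x. f (\<psi> x)))" for j
  proof -
    have "diffk k S (\<lambda>x. \<Sum>i\<in>UNIV. (partial_deriv j \<psi> x $ i) *\<^sub>R partial_deriv i f (\<psi> x))"
    proof -
      have *: "diffk k S (\<lambda>x. (partial_deriv j \<psi> x $ i) *\<^sub>R partial_deriv i f (\<psi> x))" for i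
      proof (rule diffk_bilinear[OF assms(1) bounded_bilinear_scaleR])
        show "diffk k S (\<lambda>x. partial_deriv j \<psi> x $ i)"
          using smooth_on_bounded_linear[OF assms(1) bounded_linear_vec_nth[of i] smooth_on_partial[OF assms(3), of j]]
          by (simp add: smooth_on_diffk)
        show "diffk k S (\<lambda>x. partial_deriv i f (\<psi> x))"
          by (rule Suc.IH) (use Suc.prems in simp)
      qed
      show ?thesis by (rule diffk_sum[OF assms(1)]) (rule *)
    qed
    moreover have "partial_deriv j (\<lambda>x. f (\<psi> x)) x
       = (\<Sum>i\<in>UNIV. (partial_deriv j \<psi> x $ i) *\<^sub>R partial_deriv i f (\<psi> x))" if "x \<in> S" for x
    proof -
      have "partial_deriv j (\<lambda>x. f (\<psi> x)) x = ddir (partial_deriv j \<psi> x) f (\<psi> x)"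
        unfolding partial_deriv_ddir by (rule ddir_comp[OF df(2)[OF that] df(1)[OF that]])
      also have "\<dots> = (\<Sum>i\<in>UNIV. (partial_deriv j \<psi> x $ i) *\<^sub>R partial_deriv i f (\<psi> x))"
        by (rule ddir_expand[OF df(1)[OF that]])
      finally show ?thesis .
    qed
    ultimately show ?thesis by (rule diffk_eqI[OF assms(1)])
  qed
  then show ?case using d assms(1) by (auto simp: differentiable_on_eq_differentiable_at)
qed

lemma smooth_on_comp:
  fixes \<psi> :: "real^'n \<Rightarrow> real^'m"
  assumes "open S" "open T" "smooth_on S \<psi>" "\<psi> ` S \<subseteq> T" "smooth_on T f"
  shows "smooth_on S (\<lambda>x. f (\<psi> x))"
  using diffk_comp[OF assms(1-4)] assms(5) unfolding smooth_on_diffk by blast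

lemma smooth_on_vec_nth: "open S \<Longrightarrow> smooth_on S f \<Longrightarrow> smooth_on S (\<lambda>x. f x $ i)"
  by (rule smooth_on_bounded_linear[OF _ bounded_linear_vec_nth])

lemma bounded_linear_axis: "bounded_linear (axis i :: 'a::euclidean_space \<Rightarrow> 'a^'n)"
  by (intro linear_conv_bounded_linear[THEN iffD1] linearI) (auto simp: axis_def vec_eq_iff)

lemma smooth_on_vec_lambda:
  fixes f :: "'m::finite \<Rightarrow> real^'n \<Rightarrow> 'b::euclidean_space"
  assumes "open S" "\<And>i. smooth_on S (f i)"
  shows "smooth_on S (\<lambda>x. \<chi> i. f i x)"
proof -
  have "(\<chi> i. f i x) = (\<Sum>i\<in>UNIV. axis i (f i x))" for x
    by (simp add: vec_eq_iff axis_def if_distrib[of "\<lambda>v. v $ _"] cong: if_cong)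
  moreover have "smooth_on S (\<lambda>x. \<Sum>i\<in>UNIV. axis i (f i x))"
    by (intro smooth_on_sum smooth_on_bounded_linear[OF _ bounded_linear_axis] assms)
  ultimately show ?thesis by simp
qed

section \<open>Symmetry of second derivatives\<close>

text \<open>One use of the mean value theorem in direction X, then differentiability of the first
  derivative at x. The second difference is symmetric in X and Y while its limit is the mixed
  derivative in one order; uniqueness of limits then gives the symmetry of second
  derivatives.\<close>

lemma second_difference_limit:
  fixes f :: "'a::real_normed_vector \<Rightarrow> real"
  assumes S: "open S" "x \<in> S" and f: "\<And>y. y \<in> S \<Longrightarrow> f differentiable (at y)"
    and p: "ddir X f differentiable (at x)"
  shows "((\<lambda>h. (f (x + h *\<^sub>R X + h *\<^sub>R Y) - f (x + h *\<^sub>R X) - f (x + h *\<^sub>R Y) + f x) / h\<^sup>2)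
    \<longlongrightarrow> ddir Y (ddir X f) x) (at_right 0)"
proof (rule tendstoI)
  fix e :: real assume e: "e > 0"
  \<comment> \<open>The increments \<theta>X + hY and \<theta>X, with 0 < \<theta> < h, have norms
    adding up to at most hc; the summand 1 keeps c positive when X and Y vanish.\<close>
  define c where "c = 2 * norm X + norm Y + 1"
  have c: "c > 0" by (simp add: c_def add_nonneg_pos)
  define e' where "e' = e / (2 * c)"
  have e': "e' > 0" using e c by (simp add: e'_def)
  define D where "D = (\<lambda>v. ddir v (ddir X f) x)"
  have hd: "(ddir X f has_derivative D) (at x)"
    unfolding D_def by (rule differentiable_has_ddir[OF p])
  obtain d1 where d1: "d1 > 0" "\<And>z. norm (z - x) < d1 \<Longrightarrow> norm (ddir X f z - ddir X f x - D (z - x)) \<le> e' * norm (z - x)"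
    using hd e' unfolding has_derivative_at_alt by blast
  obtain d2 where d2: "d2 > 0" "ball x d2 \<subseteq> S" using S open_contains_ball by blast
  define d where "d = min d1 d2"
  have d: "d > 0" using d1 d2 by (simp add: d_def)
  have DX: "linear D" using hd has_derivative_linear by blast
  have main: "\<bar>(f (x + h *\<^sub>R X + h *\<^sub>R Y) - f (x + h *\<^sub>R X) - f (x + h *\<^sub>R Y) + f x) / h\<^sup>2 - D Y\<bar> < e"
    if h: "h > 0" "h < d / c" for h
  proof -
    have hc: "h * c < d" using h c by (simp add: pos_less_divide_eq)
    have small: "norm (s *\<^sub>R X + t *\<^sub>R Y) < d" if "0 \<le> s" "s \<le> h" "0 \<le> t" "t \<le> h" for s t
    proof -
      have "norm (s *\<^sub>R X + t *\<^sub>R Y) \<le> s * norm X + t * norm Y"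
        using norm_triangle_ineq[of "s *\<^sub>R X" "t *\<^sub>R Y"] that by simp
      also have "\<dots> \<le> h * norm X + h * norm Y" by (intro add_mono mult_right_mono that) auto
      also have "\<dots> \<le> h * c" using h by (simp add: c_def algebra_simps)
      finally show ?thesis using hc by simp
    qed
    have inS: "x + s *\<^sub>R X + t *\<^sub>R Y \<in> S" if "0 \<le> s" "s \<le> h" "0 \<le> t" "t \<le> h" for s t
    proof -
      have "dist x (x + s *\<^sub>R X + t *\<^sub>R Y) < d2"
      proof -
        have "x + s *\<^sub>R X + t *\<^sub>R Y - x = s *\<^sub>R X + t *\<^sub>R Y" by simp
        then have "dist x (x + s *\<^sub>R X + t *\<^sub>R Y) = norm (s *\<^sub>R X + t *\<^sub>R Y)"
          by (metis dist_commute dist_norm)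
        then show ?thesis using small[OF that] by (simp add: d_def)
      qed
      then show ?thesis using d2 by auto
    qed
    \<comment> \<open>Its increment over the interval from 0 to h is the second difference.\<close>
    define \<phi> where "\<phi> = (\<lambda>s. f (x + s *\<^sub>R X + h *\<^sub>R Y) - f (x + s *\<^sub>R X))"
    have df: "((\<lambda>s. f (x + s *\<^sub>R X + t *\<^sub>R Y)) has_real_derivative ddir X f (x + s *\<^sub>R X + t *\<^sub>R Y)) (at s)"
      if "0 \<le> s" "s \<le> h" "0 \<le> t" "t \<le> h" for s t
    proof -
      have 1: "(f has_derivative (\<lambda>v. ddir v f (x + s *\<^sub>R X + t *\<^sub>R Y))) (at (x + s *\<^sub>R X + t *\<^sub>R Y))"
        by (rule differentiable_has_ddir[OF f[OF inS[OF that]]])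
      have 2: "((\<lambda>s. x + s *\<^sub>R X + t *\<^sub>R Y) has_derivative (\<lambda>r. r *\<^sub>R X)) (at s)"
        by (auto intro!: derivative_eq_intros)
      have "((\<lambda>s. f (x + s *\<^sub>R X + t *\<^sub>R Y)) has_derivative (\<lambda>r. ddir (r *\<^sub>R X) f (x + s *\<^sub>R X + t *\<^sub>R Y))) (at s)"
        using diff_chain_at[OF 2 1] by (simp add: o_def)
      then show ?thesis
        unfolding has_field_derivative_def
        by (simp add: ddir_scale_dir[OF f[OF inS[OF that]]] mult_commute_abs)
    qed
    have dphi: "(\<phi> has_real_derivative (ddir X f (x + s *\<^sub>R X + h *\<^sub>R Y) - ddir X f (x + s *\<^sub>R X))) (at s)"
      if "0 \<le> s" "s \<le> h" for s
      using DERIV_diff[OF df[of s h] df[of s 0]] that h unfolding \<phi>_def by simp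
    obtain \<theta> where \<theta>: "0 < \<theta>" "\<theta> < h"
      and mvt: "\<phi> h - \<phi> 0 = (h - 0) * (ddir X f (x + \<theta> *\<^sub>R X + h *\<^sub>R Y) - ddir X f (x + \<theta> *\<^sub>R X))"
      using MVT2[of 0 h \<phi> "\<lambda>s. ddir X f (x + s *\<^sub>R X + h *\<^sub>R Y) - ddir X f (x + s *\<^sub>R X)"] h dphi by blast
    have b1: "\<bar>ddir X f (x + \<theta> *\<^sub>R X + h *\<^sub>R Y) - ddir X f x - D (\<theta> *\<^sub>R X + h *\<^sub>R Y)\<bar> \<le> e' * norm (\<theta> *\<^sub>R X + h *\<^sub>R Y)"
      using d1(2)[of "x + \<theta> *\<^sub>R X + h *\<^sub>R Y"] small[of \<theta> h] \<theta> h by (simp add: d_def add.assoc)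
    have b2: "\<bar>ddir X f (x + \<theta> *\<^sub>R X) - ddir X f x - D (\<theta> *\<^sub>R X)\<bar> \<le> e' * norm (\<theta> *\<^sub>R X)"
      using d1(2)[of "x + \<theta> *\<^sub>R X"] small[of \<theta> 0] \<theta> h by (simp add: d_def)
    have Dl: "D (\<theta> *\<^sub>R X + h *\<^sub>R Y) = D (\<theta> *\<^sub>R X) + h * D Y"
      by (simp add: linear_add[OF DX] linear_scale[OF DX])
    have n: "norm (\<theta> *\<^sub>R X + h *\<^sub>R Y) + norm (\<theta> *\<^sub>R X) \<le> h * c"
    proof -
      have "norm (\<theta> *\<^sub>R X + h *\<^sub>R Y) \<le> \<theta> * norm X + h * norm Y"
        using norm_triangle_ineq[of "\<theta> *\<^sub>R X" "h *\<^sub>R Y"] \<theta> h by simp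
      moreover have "\<theta> * norm X \<le> h * norm X" using \<theta> by (intro mult_right_mono) auto
      ultimately show ?thesis using \<theta> h by (simp add: c_def algebra_simps)
    qed
    have "\<bar>(ddir X f (x + \<theta> *\<^sub>R X + h *\<^sub>R Y) - ddir X f (x + \<theta> *\<^sub>R X)) - h * D Y\<bar>
      \<le> e' * (norm (\<theta> *\<^sub>R X + h *\<^sub>R Y) + norm (\<theta> *\<^sub>R X))"
      using b1 b2 Dl by (simp add: algebra_simps abs_le_iff)
    also have "\<dots> \<le> e' * (h * c)" using n e' by (intro mult_left_mono) auto
    finally have b3: "\<bar>(ddir X f (x + \<theta> *\<^sub>R X + h *\<^sub>R Y) - ddir X f (x + \<theta> *\<^sub>R X)) - h * D Y\<bar> \<le> h * (e / 2)"
      using c by (simp add: e'_def field_simps)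
    have "(f (x + h *\<^sub>R X + h *\<^sub>R Y) - f (x + h *\<^sub>R X) - f (x + h *\<^sub>R Y) + f x) = \<phi> h - \<phi> 0"
      by (simp add: \<phi>_def)
    also have "\<dots> / h\<^sup>2 - D Y = ((ddir X f (x + \<theta> *\<^sub>R X + h *\<^sub>R Y) - ddir X f (x + \<theta> *\<^sub>R X)) - h * D Y) / h"
      unfolding mvt using h by (simp add: field_simps power2_eq_square)
    also have "\<bar>\<dots>\<bar> \<le> e / 2" using b3 h by (simp add: abs_divide pos_divide_le_eq mult.commute)
    finally show ?thesis using e by simp
  qed
  show "\<forall>\<^sub>F h in at_right 0. dist ((f (x + h *\<^sub>R X + h *\<^sub>R Y) - f (x + h *\<^sub>R X) - f (x + h *\<^sub>R Y) + f x) / h\<^sup>2)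
      (ddir Y (ddir X f) x) < e"
    unfolding eventually_at_right_field using main d c
    by (intro exI[of _ "d / c"]) (auto simp: dist_real_def D_def)
qed

lemma ddir_commute_real:
  fixes f :: "'a::real_normed_vector \<Rightarrow> real"
  assumes "open S" "x \<in> S" "\<And>y. y \<in> S \<Longrightarrow> f differentiable (at y)"
    and "ddir X f differentiable (at x)" "ddir Y f differentiable (at x)"
  shows "ddir Y (ddir X f) x = ddir X (ddir Y f) x"
proof (rule tendsto_unique)
  show "((\<lambda>h. (f (x + h *\<^sub>R X + h *\<^sub>R Y) - f (x + h *\<^sub>R X) - f (x + h *\<^sub>R Y) + f x) / h\<^sup>2)
    \<longlongrightarrow> ddir Y (ddir X f) x) (at_right 0)" by (rule second_difference_limit[OF assms(1-4)])
  show "((\<lambda>h. (f (x + h *\<^sub>R X + h *\<^sub>R Y) - f (x + h *\<^sub>R X) - f (x + h *\<^sub>R Y) + f x) / h\<^sup>2)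
    \<longlongrightarrow> ddir X (ddir Y f) x) (at_right 0)"
    using second_difference_limit[OF assms(1-3,5), of X] by (simp add: add.commute add.left_commute algebra_simps)
qed simp

lemma ddir_commute:
  fixes f :: "real^'n \<Rightarrow> 'b::euclidean_space"
  assumes "open S" "x \<in> S" "smooth_on S f"
  shows "ddir Y (ddir X f) x = ddir X (ddir Y f) x"
proof (rule euclidean_eqI)
  fix b :: 'b
  have sm: "smooth_on S (\<lambda>x. f x \<bullet> b)"
    by (rule smooth_on_bounded_linear[OF assms(1) bounded_linear_inner_left assms(3)])
  have d: "ddir Z f differentiable (at y)" "f differentiable (at y)" if "y \<in> S" for y Z
    using smooth_on_differentiable[OF smooth_on_ddir[OF assms(1,3)] assms(1) that]
      smooth_on_differentiable[OF assms(3,1) that] by auto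
  have 1: "ddir Z (\<lambda>x. f x \<bullet> b) y = ddir Z f y \<bullet> b" if "y \<in> S" for y Z
    by (rule ddir_bounded_linear[OF bounded_linear_inner_left d(2)[OF that]])
  have 2: "ddir W (ddir Z (\<lambda>x. f x \<bullet> b)) x = ddir W (ddir Z f) x \<bullet> b" for W Z
  proof -
    have "ddir W (ddir Z (\<lambda>x. f x \<bullet> b)) x = ddir W (\<lambda>y. ddir Z f y \<bullet> b) x"
      by (rule ddir_cong_open[OF assms(1,2) 1])
    also have "\<dots> = ddir W (ddir Z f) x \<bullet> b"
      by (rule ddir_bounded_linear[OF bounded_linear_inner_left d(1)[OF assms(2)]])
    finally show ?thesis .
  qed
  have "ddir Y (ddir X (\<lambda>x. f x \<bullet> b)) x = ddir X (ddir Y (\<lambda>x. f x \<bullet> b)) x"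
    by (rule ddir_commute_real[OF assms(1,2) smooth_on_differentiable[OF sm assms(1)]])
      (auto intro: smooth_on_differentiable[OF smooth_on_ddir[OF assms(1) sm] assms(1,2)])
  then show "ddir Y (ddir X f) x \<bullet> b = ddir X (ddir Y f) x \<bullet> b" by (simp add: 2)
qed

section \<open>Smoothness of the inverse matrix\<close>

lemma smooth_on_det:
  fixes f :: "real^'n \<Rightarrow> real^'m^'m"
  assumes "open S" "\<And>i j. smooth_on S (\<lambda>x. f x $ i $ j)"
  shows "smooth_on S (\<lambda>x. det (f x))"
  unfolding det_def
  by (rule smooth_on_sum[OF assms(1)], rule smooth_on_mult[OF assms(1) smooth_on_const], rule smooth_on_prod[OF assms(1)], rule assms(2))

lemma matrix_inv_mult:
  fixes A :: "real^'n^'n"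
  assumes "invertible A"
  shows "A ** matrix_inv A = mat 1" "matrix_inv A ** A = mat 1"
  using someI_ex[OF assms[unfolded invertible_def]] by (simp_all add: matrix_inv_def)

text \<open>Cramer's rule for the columns of the identity. It turns inversion into quotients of
  determinants, from which both smoothness and continuity of the inverse are read off.\<close>

lemma matrix_inv_entry:
  fixes A :: "real^'n^'n"
  assumes "invertible A"
  shows "matrix_inv A $ i $ j = det (\<chi> r c. if c = i then axis j 1 $ r else A $ r $ c) / det A"
proof -
  have "A *v (matrix_inv A *v axis j 1) = axis j 1"
    using matrix_inv_mult(1)[OF assms] by (simp add: matrix_vector_mul_assoc)
  then have "matrix_inv A *v axis j 1 = (\<chi> k. det (\<chi> r c. if c = k then axis j 1 $ r else A $ r $ c) / det A)"
    using cramer[of A "matrix_inv A *v axis j 1" "axis j 1"] assms by (simp add: invertible_det_nz)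
  moreover have "(matrix_inv A *v axis j 1) $ i = matrix_inv A $ i $ j"
    by (simp add: matrix_vector_mult_basis column_def)
  ultimately show ?thesis by simp
qed

lemma smooth_on_matrix_inv:
  fixes f :: "real^'n \<Rightarrow> real^'m^'m"
  assumes "open S" "smooth_on S f" "\<And>x. x \<in> S \<Longrightarrow> invertible (f x)"
  shows "smooth_on S (\<lambda>x. matrix_inv (f x))"
proof (rule smooth_on_eqI[OF assms(1)])
  have e: "smooth_on S (\<lambda>x. f x $ i $ j)" for i j
    by (rule smooth_on_vec_nth[OF assms(1) smooth_on_vec_nth[OF assms(1,2)]])
  have e2: "smooth_on S (\<lambda>x. (\<chi> r c. if c = i then axis j 1 $ r else f x $ r $ c) $ r $ c)" for i j r c
    using e[of r c] by (cases "c = i") simp_all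
  have dnz: "det (f x) \<noteq> 0" if "x \<in> S" for x using assms(3)[OF that] by (simp add: invertible_det_nz)
  show "smooth_on S (\<lambda>x. \<chi> i j. det (\<chi> r c. if c = i then axis j 1 $ r else f x $ r $ c) / det (f x))"
    by (rule smooth_on_vec_lambda[OF assms(1)], rule smooth_on_vec_lambda[OF assms(1)],
        rule smooth_on_divide[OF assms(1) smooth_on_det[OF assms(1) e2] smooth_on_det[OF assms(1) e] dnz])
  show "matrix_inv (f x) = (\<chi> i j. det (\<chi> r c. if c = i then axis j 1 $ r else f x $ r $ c) / det (f x))" if "x \<in> S" for x
    by (simp add: vec_eq_iff matrix_inv_entry[OF assms(3)[OF that]])
qed

section \<open>Local Riemannian geometry\<close>

definition ip :: "real^'n^'n \<Rightarrow> real^'n \<Rightarrow> real^'n \<Rightarrow> real"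
  where "ip G X Y = X \<bullet> (G *v Y)"

lemma ip_sum: "ip G X Y = (\<Sum>i\<in>UNIV. \<Sum>j\<in>UNIV. G $ i $ j * (X $ i * Y $ j))"
  by (simp add: ip_def inner_vec_def matrix_vector_mult_def sum_distrib_left mult_ac)

lemma ip_simps:
  "ip G (X + X') Y = ip G X Y + ip G X' Y" "ip G (X - X') Y = ip G X Y - ip G X' Y"
  "ip G (- X) Y = - ip G X Y" "ip G 0 Y = 0" "ip G (r *\<^sub>R X) Y = r * ip G X Y"
  "ip G X (Y + Y') = ip G X Y + ip G X Y'" "ip G X (Y - Y') = ip G X Y - ip G X Y'"
  "ip G X (- Y) = - ip G X Y" "ip G X 0 = 0" "ip G X (r *\<^sub>R Y) = r * ip G X Y"
  "ip (G + H) X Y = ip G X Y + ip H X Y" "ip (G - H) X Y = ip G X Y - ip H X Y"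
  "ip 0 X Y = 0" "ip (r *\<^sub>R G) X Y = r * ip G X Y"
  by (simp_all add: ip_sum algebra_simps sum.distrib sum_subtractf sum_negf sum_distrib_left)

lemma linear_ip: "linear (\<lambda>X. ip G X Y)" "linear (ip G X)" "linear (\<lambda>G. ip G X Y)"
  by (rule linearI; simp add: ip_simps)+

lemma bounded_bilinear_ip: "bounded_bilinear (ip G)"
  unfolding bilinear_conv_bounded_bilinear[symmetric] bilinear_def using linear_ip by auto

lemma bounded_bilinear_matrix_vector_mult: "bounded_bilinear (\<lambda>(A::real^'n^'m) (v::real^'n). A *v v)"
  unfolding bilinear_conv_bounded_bilinear[symmetric] bilinear_def
  by (auto intro!: linearI simp: matrix_vector_mult_add_rdistrib matrix_vector_right_distrib
      scaleR_matrix_vector_assoc[symmetric] vec.scale matrix_vector_mult_scaleR)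

lemma bounded_linear_ip: "bounded_linear (\<lambda>G. ip G X Y)"
  using linear_ip(3) linear_conv_bounded_linear by blast

lemma ip_transpose: "ip (transpose G) X Y = ip G Y X"
  by (metis dot_lmul_matrix inner_commute ip_def transpose_matrix_vector)

lemma linear_eq_sum_axis:
  fixes L :: "real^'n \<Rightarrow> 'b::real_vector"
  assumes "linear L"
  shows "L v = (\<Sum>i\<in>UNIV. (v $ i) *\<^sub>R L (axis i 1))"
proof -
  have "v = (\<Sum>j\<in>UNIV. (v $ j) *\<^sub>R axis j 1)"
    by (simp add: basis_expansion flip: scalar_mult_eq_scaleR)
  then have "L v = L (\<Sum>j\<in>UNIV. (v $ j) *\<^sub>R axis j 1)" by simp
  then show ?thesis by (simp add: linear_sum[OF assms] linear_scale[OF assms])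
qed

text \<open>Leibniz rule for a covector field contracted with a vector field, proved by expanding
  the vector in coordinates. It allows tensors to be treated as functions linear in each argument,
  without index calculus.\<close>

lemma ddir_linear_field:
  fixes T :: "real^'n \<Rightarrow> real^'m \<Rightarrow> real"
  assumes S: "open S" "x \<in> S" and lin: "\<And>y. y \<in> S \<Longrightarrow> linear (T y)"
    and T: "\<And>Z. (\<lambda>y. T y Z) differentiable (at x)" and w: "w differentiable (at x)"
  shows "ddir M (\<lambda>y. T y (w y)) x = ddir M (\<lambda>y. T y (w x)) x + T x (ddir M w x)"
proof -
  have wi: "(\<lambda>y. w y $ i) differentiable (at x)" for i
    by (rule differentiable_bounded_linear[OF bounded_linear_vec_nth w])
  have dwi: "ddir M (\<lambda>y. w y $ i) x = ddir M w x $ i" for i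
    by (rule ddir_bounded_linear[OF bounded_linear_vec_nth w])
  have ci: "(\<lambda>y. w x $ i) differentiable (at x)" for i by simp
  have pr: "(\<lambda>y. w y $ i * T y (axis i 1)) differentiable (at x)" for i
    by (rule differentiable_mult[OF wi T])
  have prc: "(\<lambda>y. w x $ i * T y (axis i 1)) differentiable (at x)" for i
    by (rule differentiable_mult[OF ci T])
  have "ddir M (\<lambda>y. T y (w y)) x = ddir M (\<lambda>y. \<Sum>i\<in>UNIV. w y $ i * T y (axis i 1)) x"
    by (rule ddir_cong_open[OF S]) (subst linear_eq_sum_axis[OF lin], auto)
  also have "\<dots> = (\<Sum>i\<in>UNIV. ddir M (\<lambda>y. w y $ i * T y (axis i 1)) x)"
    by (rule ddir_sum) (rule pr)
  also have "\<dots> = (\<Sum>i\<in>UNIV. w x $ i * ddir M (\<lambda>y. T y (axis i 1)) x + ddir M w x $ i * T x (axis i 1))"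
    by (simp only: ddir_mult[OF wi T] dwi)
  also have "\<dots> = (\<Sum>i\<in>UNIV. w x $ i * ddir M (\<lambda>y. T y (axis i 1)) x) + T x (ddir M w x)"
    by (simp add: sum.distrib linear_eq_sum_axis[OF lin[OF S(2)], of "ddir M w x"])
  also have "(\<Sum>i\<in>UNIV. w x $ i * ddir M (\<lambda>y. T y (axis i 1)) x) = (\<Sum>i\<in>UNIV. ddir M (\<lambda>y. w x $ i * T y (axis i 1)) x)"
    by (simp only: ddir_mult[OF ci T] ddir_const mult_zero_left add_0_right)
  also have "\<dots> = ddir M (\<lambda>y. \<Sum>i\<in>UNIV. w x $ i * T y (axis i 1)) x"
    by (rule ddir_sum[symmetric]) (rule prc)
  also have "\<dots> = ddir M (\<lambda>y. T y (w x)) x"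
    by (rule ddir_cong_open[OF S, symmetric]) (subst linear_eq_sum_axis[OF lin], auto)
  finally show ?thesis .
qed

locale metric_domain =
  fixes S :: "(real^'n) set" and g :: "real^'n \<Rightarrow> real^'n^'n"
  assumes open_S: "open S" and smooth_g: "smooth_on S g"
    and transpose_g: "\<And>x. x \<in> S \<Longrightarrow> transpose (g x) = g x"
    and pos_g: "\<And>x v. x \<in> S \<Longrightarrow> v \<noteq> 0 \<Longrightarrow> v \<bullet> (g x *v v) > 0"
begin

text \<open>Vector arguments stand for constant vector fields. \<open>c1\<close> and \<open>ch\<close> are the Christoffel symbols of the first
  and second kind, \<open>rm\<close> is the covariant curvature tensor, and \<open>nab1\<close>, \<open>nab2\<close>, \<open>nab4\<close> are the covariant
  derivatives in direction \<open>M\<close> of tensors of rank 1, 2, 4.\<close>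

definition "dg M x X Y = ip (ddir M g x) X Y"
definition "ddg M N x X Y = ip (ddir M (ddir N g) x) X Y"
definition "c1 x X Y Z = (dg X x Y Z + dg Y x X Z - dg Z x X Y) / 2"
definition "dc1 M x X Y Z = (ddg M X x Y Z + ddg M Y x X Z - ddg M Z x X Y) / 2"
definition raise :: "real^'n \<Rightarrow> (real^'n \<Rightarrow> real) \<Rightarrow> real^'n"
  where "raise x L = matrix_inv (g x) *v (\<chi> i. L (axis i 1))"
definition "ch x X Y = raise x (c1 x X Y)"
definition "rm x X Y Z W =
  (ddg X Z x Y W - ddg X W x Y Z - ddg Y Z x X W + ddg Y W x X Z) / 2
  - ip (g x) (ch x Y Z) (ch x X W) + ip (g x) (ch x X Z) (ch x Y W)"
definition grad :: "(real^'n \<Rightarrow> real) \<Rightarrow> real^'n \<Rightarrow> real^'n"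
  where "grad f x = raise x (\<lambda>Z. ddir Z f x)"
definition hess :: "(real^'n \<Rightarrow> real) \<Rightarrow> real^'n \<Rightarrow> real^'n \<Rightarrow> real^'n \<Rightarrow> real"
  where "hess f x X Y = ddir X (ddir Y f) x - ddir (ch x X Y) f x"
definition "nab1 L M x X = ddir M (\<lambda>y. L y X) x - L x (ch x M X)"
definition "nab2 T M x X Y = ddir M (\<lambda>y. T y X Y) x - T x (ch x M X) Y - T x X (ch x M Y)"
definition "nab4 T M x X Y Z W = ddir M (\<lambda>y. T y X Y Z W) x
  - T x (ch x M X) Y Z W - T x X (ch x M Y) Z W - T x X Y (ch x M Z) W - T x X Y Z (ch x M W)"

section \<open>Christoffel symbols, gradient and Hessian in coordinates\<close>

lemma sm: "smooth_on S f \<Longrightarrow> x \<in> S \<Longrightarrow> f differentiable (at x)"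
  using smooth_on_differentiable open_S by blast

lemma ip_sym: "x \<in> S \<Longrightarrow> ip (g x) X Y = ip (g x) Y X"
  using transpose_g ip_transpose by metis

lemma ip_pos: "x \<in> S \<Longrightarrow> X \<noteq> 0 \<Longrightarrow> ip (g x) X X > 0"
  using pos_g by (simp add: ip_def)

lemma ip_eqI:
  assumes "x \<in> S" "\<And>Z. ip (g x) X Z = ip (g x) Y Z"
  shows "X = Y"
proof (rule ccontr)
  assume "X \<noteq> Y"
  then have "ip (g x) (X - Y) (X - Y) > 0" using ip_pos assms(1) by simp
  then show False by (simp add: ip_simps assms(2))
qed

lemma invertible_g: "x \<in> S \<Longrightarrow> invertible (g x)"
  unfolding invertible_left_inverse matrix_left_invertible_ker
  using pos_g by (metis inner_zero_right less_irrefl)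

lemma smooth_ip: "smooth_on S (\<lambda>x. ip (g x) X Y)"
  by (rule smooth_on_bounded_linear[OF open_S bounded_linear_ip smooth_g])

lemma smooth_dg: "smooth_on S (\<lambda>x. dg M x X Y)"
  unfolding dg_def by (rule smooth_on_bounded_linear[OF open_S bounded_linear_ip smooth_on_ddir[OF open_S smooth_g]])

lemma smooth_ddg: "smooth_on S (\<lambda>x. ddg M N x X Y)"
  unfolding ddg_def by (rule smooth_on_bounded_linear[OF open_S bounded_linear_ip smooth_on_ddir[OF open_S smooth_on_ddir[OF open_S smooth_g]]])

lemma ddir_ip: "x \<in> S \<Longrightarrow> ddir M (\<lambda>x. ip (g x) X Y) x = dg M x X Y"
  unfolding dg_def by (rule ddir_bounded_linear[OF bounded_linear_ip sm[OF smooth_g]])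

lemma ddir_dg: "x \<in> S \<Longrightarrow> ddir M (\<lambda>x. dg N x X Y) x = ddg M N x X Y"
  unfolding dg_def ddg_def by (rule ddir_bounded_linear[OF bounded_linear_ip sm[OF smooth_on_ddir[OF open_S smooth_g]]])

lemma dg_sym: "x \<in> S \<Longrightarrow> dg M x X Y = dg M x Y X"
  unfolding ddir_ip[symmetric] by (rule ddir_cong_open[OF open_S]) (auto intro: ip_sym)

lemma ddg_sym: "x \<in> S \<Longrightarrow> ddg M N x X Y = ddg M N x Y X"
  unfolding ddir_dg[symmetric] by (rule ddir_cong_open[OF open_S]) (auto intro: dg_sym)

lemma ddg_commute: "x \<in> S \<Longrightarrow> ddg M N x X Y = ddg N M x X Y"
  unfolding ddg_def using ddir_commute[OF open_S _ smooth_g] by metis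

lemma dg_simps:
  "dg M x (X + X') Y = dg M x X Y + dg M x X' Y" "dg M x (X - X') Y = dg M x X Y - dg M x X' Y"
  "dg M x (r *\<^sub>R X) Y = r * dg M x X Y"
  "dg M x X (Y + Y') = dg M x X Y + dg M x X Y'" "dg M x X (Y - Y') = dg M x X Y - dg M x X Y'"
  "dg M x X (r *\<^sub>R Y) = r * dg M x X Y"
  by (simp_all add: dg_def ip_simps)

lemma dg_simps_dir:
  assumes "x \<in> S"
  shows "dg (M + M') x X Y = dg M x X Y + dg M' x X Y" "dg (r *\<^sub>R M) x X Y = r * dg M x X Y"
  using sm[OF smooth_g assms] by (simp_all add: dg_def ddir_add_dir ddir_scale_dir ip_simps)

lemma ddg_simps:
  "ddg M N x (X + X') Y = ddg M N x X Y + ddg M N x X' Y" "ddg M N x (r *\<^sub>R X) Y = r * ddg M N x X Y"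
  "ddg M N x X (Y + Y') = ddg M N x X Y + ddg M N x X Y'" "ddg M N x X (r *\<^sub>R Y) = r * ddg M N x X Y"
  by (simp_all add: ddg_def ip_simps)

lemma ddg_simps_dir:
  assumes "x \<in> S"
  shows "ddg (M + M') N x X Y = ddg M N x X Y + ddg M' N x X Y" "ddg (r *\<^sub>R M) N x X Y = r * ddg M N x X Y"
    "ddg N (M + M') x X Y = ddg N M x X Y + ddg N M' x X Y" "ddg N (r *\<^sub>R M) x X Y = r * ddg N M x X Y"
proof -
  show *: "ddg (M + M') N x X Y = ddg M N x X Y + ddg M' N x X Y" "ddg (r *\<^sub>R M) N x X Y = r * ddg M N x X Y" for M M' N
    using sm[OF smooth_on_ddir[OF open_S smooth_g] assms] by (simp_all add: ddg_def ddir_add_dir ddir_scale_dir ip_simps)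
  show "ddg N (M + M') x X Y = ddg N M x X Y + ddg N M' x X Y" "ddg N (r *\<^sub>R M) x X Y = r * ddg N M x X Y"
    using * by (simp_all add: ddg_commute[OF assms, of N])
qed

lemma linear_c1: "x \<in> S \<Longrightarrow> linear (c1 x X Y)"
  by (rule linearI) (simp_all add: c1_def dg_simps dg_simps_dir field_simps)

lemma linear_c1': "x \<in> S \<Longrightarrow> linear (\<lambda>X. c1 x X Y Z)" "x \<in> S \<Longrightarrow> linear (\<lambda>Y. c1 x X Y Z)"
  by (rule linearI; simp add: c1_def dg_simps dg_simps_dir field_simps)+

lemma linear_dc1: "x \<in> S \<Longrightarrow> linear (dc1 M x X Y)"
  by (rule linearI) (simp_all add: dc1_def ddg_simps ddg_simps_dir field_simps)

lemma c1_sym: "x \<in> S \<Longrightarrow> c1 x X Y Z = c1 x Y X Z"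
  by (simp add: c1_def dg_sym[of x Z X Y])

lemma dg_c1: "x \<in> S \<Longrightarrow> dg M x X Y = c1 x M X Y + c1 x M Y X"
  by (simp add: c1_def dg_sym[of x M X Y] dg_sym[of x X Y M] dg_sym[of x Y X M] field_simps)

text \<open>\<open>raise\<close> is the inverse of the isomorphism between vectors and covectors
  given by the metric. Identities for \<open>ch\<close> and \<open>grad\<close> are checked by
  pairing with a vector through this rule and \<open>ip_eqI\<close>.\<close>

lemma ip_raise:
  assumes "x \<in> S" "linear L"
  shows "ip (g x) (raise x L) Z = L Z" "ip (g x) Z (raise x L) = L Z"
proof -
  have "g x *v raise x L = (\<chi> i. L (axis i 1))"
    by (simp add: raise_def matrix_vector_mul_assoc matrix_inv_mult[OF invertible_g[OF assms(1)]])
  then have "ip (g x) Z (raise x L) = Z \<bullet> (\<chi> i. L (axis i 1))" by (simp add: ip_def)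
  also have "\<dots> = L Z" by (simp add: inner_vec_def linear_eq_sum_axis[OF assms(2), of Z])
  finally show "ip (g x) Z (raise x L) = L Z" .
  then show "ip (g x) (raise x L) Z = L Z" by (simp add: ip_sym[OF assms(1)])
qed

lemma ip_ch: "x \<in> S \<Longrightarrow> ip (g x) (ch x X Y) Z = c1 x X Y Z" "x \<in> S \<Longrightarrow> ip (g x) Z (ch x X Y) = c1 x X Y Z"
  unfolding ch_def by (rule ip_raise; simp add: linear_c1)+

lemma ch_sym: "x \<in> S \<Longrightarrow> ch x X Y = ch x Y X"
  by (rule ip_eqI) (auto simp: ip_ch c1_sym[of x X Y])

lemma linear_ch: "x \<in> S \<Longrightarrow> linear (ch x X)"
  by (rule linearI) (auto intro!: ip_eqI simp: ip_ch ip_simps linear_add[OF linear_c1'(2)] linear_scale[OF linear_c1'(2)])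

lemma smooth_raise:
  assumes "\<And>Z. smooth_on S (\<lambda>x. L x Z)"
  shows "smooth_on S (\<lambda>x. raise x (L x))"
  unfolding raise_def
  by (rule smooth_on_bilinear[OF open_S bounded_bilinear_matrix_vector_mult smooth_on_matrix_inv[OF open_S smooth_g invertible_g]
          smooth_on_vec_lambda[OF open_S assms]])

lemma smooth_c1: "smooth_on S (\<lambda>x. c1 x X Y Z)"
  unfolding c1_def
  by (rule smooth_on_divide[OF open_S smooth_on_diff[OF open_S smooth_on_add[OF open_S smooth_dg smooth_dg] smooth_dg]]) auto

lemma smooth_ch: "smooth_on S (\<lambda>x. ch x X Y)"
  unfolding ch_def by (rule smooth_raise) (rule smooth_c1)

lemma ddir_c1: "x \<in> S \<Longrightarrow> ddir M (\<lambda>x. c1 x X Y Z) x = dc1 M x X Y Z"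
proof -
  assume x: "x \<in> S"
  have d: "(\<lambda>x. dg N x A B) differentiable (at x)" for N A B by (rule sm[OF smooth_dg x])
  have d2: "(\<lambda>x. dg X x Y Z + dg Y x X Z) differentiable (at x)"
    by (rule sm[OF smooth_on_add[OF open_S smooth_dg smooth_dg] x])
  have "ddir M (\<lambda>x. c1 x X Y Z) x = ddir M (\<lambda>x. dg X x Y Z + dg Y x X Z - dg Z x X Y) x / 2"
    unfolding c1_def
    by (rule ddir_bounded_linear[OF bounded_linear_divide differentiable_diff[OF d2 d]])
  then show ?thesis
    by (simp only: ddir_diff[OF d2 d] ddir_add[OF d d] ddir_dg[OF x] dc1_def)
qed

lemma ddir_linear_ddir: "smooth_on S f \<Longrightarrow> x \<in> S \<Longrightarrow> linear (\<lambda>Z. ddir Z f x)"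
  by (rule ddir_linear[OF sm])

lemma ip_grad:
  assumes "smooth_on S f" "x \<in> S"
  shows "ip (g x) (grad f x) Z = ddir Z f x" "ip (g x) Z (grad f x) = ddir Z f x"
  unfolding grad_def by (rule ip_raise[OF assms(2) ddir_linear_ddir[OF assms]])+

lemma smooth_grad: "smooth_on S f \<Longrightarrow> smooth_on S (grad f)"
  unfolding grad_def by (rule smooth_raise) (rule smooth_on_ddir[OF open_S])

text \<open>Trading the symbol of the second kind for one of the first kind, evaluated at the
  gradient, leaves a covector contracted with a vector: the form that
  \<open>ddir_linear_field\<close> differentiates.\<close>

lemma hess_c1: "smooth_on S f \<Longrightarrow> x \<in> S \<Longrightarrow> hess f x X Y = ddir X (ddir Y f) x - c1 x X Y (grad f x)"
  by (simp add: hess_def ip_grad(2)[symmetric] ip_ch)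

lemma hess_sym: "smooth_on S f \<Longrightarrow> x \<in> S \<Longrightarrow> hess f x X Y = hess f x Y X"
  unfolding hess_def using ddir_commute[OF open_S, of x f X Y] ch_sym[of x X Y] by simp

lemma hess_linear: "smooth_on S f \<Longrightarrow> x \<in> S \<Longrightarrow> linear (\<lambda>X. hess f x X Y)"
    "smooth_on S f \<Longrightarrow> x \<in> S \<Longrightarrow> linear (hess f x X)"
proof -
  assume a: "smooth_on S f" "x \<in> S"
  have d: "ddir Y f differentiable (at x)" for Y by (rule sm[OF smooth_on_ddir[OF open_S a(1)] a(2)])
  show *: "linear (\<lambda>X. hess f x X Y)" for Y
    by (rule linearI) (simp_all add: hess_c1[OF a] ddir_add_dir[OF d] ddir_scale_dir[OF d]
        linear_add[OF linear_c1'(1)[OF a(2)]] linear_scale[OF linear_c1'(1)[OF a(2)]] algebra_simps)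
  show "linear (hess f x X)" using *[of X] by (simp add: hess_sym[OF a, of _ X])
qed

lemma smooth_ip_fields:
  assumes "smooth_on S V" "smooth_on S W"
  shows "smooth_on S (\<lambda>x. ip (g x) (V x) (W x))"
  unfolding ip_def
  by (rule smooth_on_inner[OF open_S assms(1) smooth_on_bilinear[OF open_S bounded_bilinear_matrix_vector_mult smooth_g assms(2)]])

lemma smooth_c1_grad: "smooth_on S f \<Longrightarrow> smooth_on S (\<lambda>x. c1 x X Y (grad f x))"
  by (rule smooth_on_eqI[OF open_S smooth_ip_fields[OF smooth_ch smooth_grad]]) (simp_all add: ip_ch)

lemma smooth_hess: "smooth_on S f \<Longrightarrow> smooth_on S (\<lambda>x. hess f x X Y)"
  by (rule smooth_on_eqI[OF open_S smooth_on_diff[OF open_S smooth_on_ddir[OF open_S smooth_on_ddir[OF open_S]] smooth_c1_grad]])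
    (simp_all add: hess_c1)

lemma ddir_ip_fields:
  assumes "x \<in> S" "V differentiable (at x)" "W differentiable (at x)"
  shows "ddir M (\<lambda>y. ip (g y) (V y) (W y)) x
    = dg M x (V x) (W x) + ip (g x) (ddir M V x) (W x) + ip (g x) (V x) (ddir M W x)"
proof -
  have d1: "(\<lambda>y. ip (g y) (V y) Z) differentiable (at x)" for Z
  proof -
    have "(\<lambda>y. \<Sum>i\<in>UNIV. \<Sum>j\<in>UNIV. g y $ i $ j * (V y $ i * Z $ j)) differentiable (at x)"
      by (intro differentiable_sum ballI differentiable_mult differentiable_const finite)
        (auto intro!: differentiable_bounded_linear[OF bounded_linear_vec_nth] assms(2)
          differentiable_bounded_linear[OF bounded_linear_compose[OF bounded_linear_vec_nth bounded_linear_vec_nth] sm[OF smooth_g assms(1)]])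
    then show ?thesis by (simp add: ip_sum)
  qed
  have "ddir M (\<lambda>y. ip (g y) (V y) (W y)) x = ddir M (\<lambda>y. ip (g y) (V y) (W x)) x + ip (g x) (V x) (ddir M W x)"
    by (rule ddir_linear_field[OF open_S assms(1) linear_ip(2) d1 assms(3)])
  also have "ddir M (\<lambda>y. ip (g y) (V y) (W x)) x = ddir M (\<lambda>y. ip (g y) (V x) (W x)) x + ip (g x) (ddir M V x) (W x)"
    by (rule ddir_linear_field[OF open_S assms(1) linear_ip(1) sm[OF smooth_ip assms(1)] assms(2)])
  finally show ?thesis by (simp add: ddir_ip[OF assms(1)])
qed

text \<open>Differentiate the pairing of the gradient with the constant field Z. The Christoffel
  term on the right is the difference between the ordinary and the covariant derivative of the
  gradient, and the latter is dual to the Hessian.\<close>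

lemma ip_ddir_grad:
  assumes f: "smooth_on S f" and x: "x \<in> S"
  shows "ip (g x) (ddir M (grad f) x) Z = hess f x M Z - c1 x M (grad f x) Z"
proof -
  have d: "grad f differentiable (at x)" by (rule sm[OF smooth_grad[OF f] x])
  have "ddir M (ddir Z f) x = ddir M (\<lambda>y. ip (g y) (grad f y) Z) x"
    by (rule ddir_cong_open[OF open_S x]) (simp add: ip_grad[OF f])
  also have "\<dots> = dg M x (grad f x) Z + ip (g x) (ddir M (grad f) x) Z"
    using ddir_ip_fields[OF x d, of "\<lambda>_. Z" M] by (simp add: ip_simps)
  finally show ?thesis using dg_c1[OF x, of M "grad f x" Z] by (simp add: hess_c1[OF f x])
qed

lemma ddir_ip_grad:
  assumes a: "smooth_on S a" and b: "smooth_on S b" and x: "x \<in> S"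
  shows "ddir M (\<lambda>y. ip (g y) (grad a y) (grad b y)) x = hess a x M (grad b x) + hess b x M (grad a x)"
proof -
  have d: "grad a differentiable (at x)" "grad b differentiable (at x)"
    by (rule sm[OF smooth_grad[OF a] x], rule sm[OF smooth_grad[OF b] x])
  show ?thesis
    unfolding ddir_ip_fields[OF x d] ip_ddir_grad[OF a x] ip_sym[OF x, of "grad a x" "ddir M (grad b) x"] ip_ddir_grad[OF b x]
    using dg_c1[OF x, of M "grad a x" "grad b x"] by simp
qed

text \<open>Ricci identity for the 1-form df: third derivatives cancel because they commute, and the
  Christoffel terms assemble to the curvature. The sign convention is the one in which R(X, Y, Y, X)
  is positive on round spheres.\<close>

lemma nab2_hess:
  assumes f: "smooth_on S f" and x: "x \<in> S"
  shows "nab2 (hess f) M x X Y - nab2 (hess f) X x M Y = - rm x M X Y (grad f x)"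
proof -
  let ?w = "grad f x"
  have d: "(\<lambda>y. c1 y A B C) differentiable (at x)" for A B C by (rule sm[OF smooth_c1 x])
  have dd: "ddir A (ddir B f) differentiable (at x)" for A B
    by (rule sm[OF smooth_on_ddir[OF open_S smooth_on_ddir[OF open_S f]] x])
  have dw: "grad f differentiable (at x)" by (rule sm[OF smooth_grad[OF f] x])
  have dcw: "(\<lambda>y. c1 y A B (grad f y)) differentiable (at x)" for A B
    by (rule sm[OF smooth_c1_grad[OF f] x])
  have D: "ddir M (\<lambda>y. hess f y X Y) x
    = ddir M (ddir X (ddir Y f)) x - dc1 M x X Y ?w - c1 x X Y (ddir M (grad f) x)" for M X Y
  proof -
    have "ddir M (\<lambda>y. hess f y X Y) x = ddir M (\<lambda>y. ddir X (ddir Y f) y - c1 y X Y (grad f y)) x"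
      by (rule ddir_cong_open[OF open_S x]) (simp add: hess_c1[OF f])
    also have "\<dots> = ddir M (ddir X (ddir Y f)) x - ddir M (\<lambda>y. c1 y X Y (grad f y)) x"
      by (rule ddir_diff[OF dd dcw])
    also have "ddir M (\<lambda>y. c1 y X Y (grad f y)) x = dc1 M x X Y ?w + c1 x X Y (ddir M (grad f) x)"
      using ddir_linear_field[OF open_S x linear_c1 d dw] ddir_c1[OF x] by simp
    finally show ?thesis by simp
  qed
  \<comment> \<open>In this form the Hessian values at Christoffel vectors cancel the derivatives of
    the gradient that come from \<open>D\<close>.\<close>
  have H: "hess f x M U = ip (g x) (ddir M (grad f) x) U + c1 x M ?w U" for M U
    by (simp add: ip_ddir_grad[OF f x])
  have c: "ddir M (ddir X (ddir Y f)) x = ddir X (ddir M (ddir Y f)) x"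
    by (rule ddir_commute[OF open_S x smooth_on_ddir[OF open_S f]])
  have e: "c1 x A B U = ip (g x) U (ch x A B)" for A B U by (simp add: ip_ch[OF x])
  have "nab2 (hess f) M x X Y - nab2 (hess f) X x M Y
    = dc1 X x M Y ?w - dc1 M x X Y ?w - c1 x X ?w (ch x M Y) + c1 x M ?w (ch x X Y)"
    unfolding nab2_def D c H[of X "ch x M Y"] H[of M "ch x X Y"] ch_sym[OF x, of M X]
      e[of _ _ "ddir _ _ _"] by simp
  also have "\<dots> = - rm x M X Y ?w"
    unfolding rm_def dc1_def
    by (simp add: ip_ch[OF x] c1_sym[OF x] ddg_commute[OF x, of M X] ip_sym[OF x, of "ch x X Y"] field_simps)
  finally show ?thesis .
qed

section \<open>Product rules for covariant derivatives, symmetries of the curvature\<close>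

lemma metric_compat: "x \<in> S \<Longrightarrow> dg M x X Y = ip (g x) (ch x M X) Y + ip (g x) X (ch x M Y)"
  by (simp add: ip_ch dg_c1)

lemma nab1_ddir: "nab1 (\<lambda>y X. ddir X f y) M x X = hess f x M X"
  by (simp add: nab1_def hess_def)

lemma nab2_mult:
  fixes a b :: "real^'n \<Rightarrow> real^'n \<Rightarrow> real"
  assumes "(\<lambda>y. a y X) differentiable (at x)" "(\<lambda>y. b y Y) differentiable (at x)"
  shows "nab2 (\<lambda>y X Y. a y X * b y Y) M x X Y = nab1 a M x X * b x Y + a x X * nab1 b M x Y"
  by (simp add: nab1_def nab2_def ddir_mult[OF assms] algebra_simps)

lemma nab2_mult':
  fixes a b :: "real^'n \<Rightarrow> real^'n \<Rightarrow> real"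
  assumes "(\<lambda>y. a y Y) differentiable (at x)" "(\<lambda>y. b y X) differentiable (at x)"
  shows "nab2 (\<lambda>y X Y. a y Y * b y X) M x X Y = nab1 a M x Y * b x X + a x Y * nab1 b M x X"
  by (simp add: nab1_def nab2_def ddir_mult[OF assms] algebra_simps)

lemma nab2_ip:
  assumes "x \<in> S" "m differentiable (at x)"
  shows "nab2 (\<lambda>y X Y. ip (g y) X Y * m y) M x X Y = ip (g x) X Y * ddir M m x"
  unfolding nab2_def ddir_mult[OF sm[OF smooth_ip assms(1)] assms(2)] ddir_ip[OF assms(1)] metric_compat[OF assms(1)]
  by (simp add: algebra_simps)

lemma nab2_add:
  assumes "(\<lambda>y. T y X Y) differentiable (at x)" "(\<lambda>y. U y X Y) differentiable (at x)"
  shows "nab2 (\<lambda>y X Y. T y X Y + U y X Y) M x X Y = nab2 T M x X Y + nab2 U M x X Y"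
  by (simp add: nab2_def ddir_add[OF assms])

lemma nab2_diff:
  assumes "(\<lambda>y. T y X Y) differentiable (at x)" "(\<lambda>y. U y X Y) differentiable (at x)"
  shows "nab2 (\<lambda>y X Y. T y X Y - U y X Y) M x X Y = nab2 T M x X Y - nab2 U M x X Y"
  by (simp add: nab2_def ddir_diff[OF assms])

lemma nab2_cong:
  assumes "x \<in> S" "\<And>y X Y. y \<in> S \<Longrightarrow> T y X Y = U y X Y"
  shows "nab2 T M x X Y = nab2 U M x X Y"
  unfolding nab2_def using ddir_cong_open[OF open_S assms(1), of "\<lambda>y. T y X Y" "\<lambda>y. U y X Y"] assms by simp

text \<open>The metric is parallel, so only the other factor is differentiated. The four index
  patterns are those of the terms that the conformal change adds to the curvature in
  \<open>K\<close>.\<close>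

lemma nab4_mult:
  assumes "x \<in> S" "\<And>X Y. (\<lambda>y. a y X Y) differentiable (at x)"
  shows "nab4 (\<lambda>y X Y Z W. a y X Z * ip (g y) Y W) M x X Y Z W = nab2 a M x X Z * ip (g x) Y W"
    and "nab4 (\<lambda>y X Y Z W. a y Y Z * ip (g y) X W) M x X Y Z W = nab2 a M x Y Z * ip (g x) X W"
    and "nab4 (\<lambda>y X Y Z W. a y X W * ip (g y) Y Z) M x X Y Z W = nab2 a M x X W * ip (g x) Y Z"
    and "nab4 (\<lambda>y X Y Z W. a y Y W * ip (g y) X Z) M x X Y Z W = nab2 a M x Y W * ip (g x) X Z"
  unfolding nab4_def nab2_def ddir_mult[OF assms(2) sm[OF smooth_ip assms(1)]] ddir_ip[OF assms(1)] metric_compat[OF assms(1)]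
  by (simp_all add: algebra_simps)

lemma nab4_add:
  assumes "(\<lambda>y. T y X Y Z W) differentiable (at x)" "(\<lambda>y. U y X Y Z W) differentiable (at x)"
  shows "nab4 (\<lambda>y X Y Z W. T y X Y Z W + U y X Y Z W) M x X Y Z W = nab4 T M x X Y Z W + nab4 U M x X Y Z W"
  by (simp add: nab4_def ddir_add[OF assms])

lemma nab4_diff:
  assumes "(\<lambda>y. T y X Y Z W) differentiable (at x)" "(\<lambda>y. U y X Y Z W) differentiable (at x)"
  shows "nab4 (\<lambda>y X Y Z W. T y X Y Z W - U y X Y Z W) M x X Y Z W = nab4 T M x X Y Z W - nab4 U M x X Y Z W"
  by (simp add: nab4_def ddir_diff[OF assms])

lemma rm_anti12: "x \<in> S \<Longrightarrow> rm x Y X Z W = - rm x X Y Z W"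
  by (simp add: rm_def field_simps)

lemma rm_pair: "x \<in> S \<Longrightarrow> rm x Z W X Y = rm x X Y Z W"
  by (simp add: rm_def ch_sym[of x W X] ch_sym[of x Z Y] ch_sym[of x Z X] ch_sym[of x W Y] ip_sym[of x "ch x X W"]
     ip_sym[of x "ch x Y W" "ch x X Z"] ddg_commute[of x Z X] ddg_commute[of x Z Y] ddg_commute[of x W X] ddg_commute[of x W Y]
     ddg_sym[of x _ _ W Y] ddg_sym[of x _ _ W X] ddg_sym[of x _ _ Z Y] ddg_sym[of x _ _ Z X] field_simps)

lemma rm_anti34: "x \<in> S \<Longrightarrow> rm x X Y W Z = - rm x X Y Z W"
  using rm_pair rm_anti12 by metis

lemma linear_rm: "x \<in> S \<Longrightarrow> linear (rm x X Y Z)"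
  by (rule linearI) (simp_all add: rm_def ddg_simps ddg_simps_dir ip_simps linear_add[OF linear_ch] linear_scale[OF linear_ch] field_simps)

lemma smooth_rm: "smooth_on S (\<lambda>x. rm x X Y Z W)"
  unfolding rm_def
  by (rule smooth_on_add[OF open_S smooth_on_diff[OF open_S
      smooth_on_divide[OF open_S smooth_on_add[OF open_S smooth_on_diff[OF open_S smooth_on_diff[OF open_S smooth_ddg smooth_ddg] smooth_ddg] smooth_ddg] smooth_on_const]
      smooth_ip_fields[OF smooth_ch smooth_ch]] smooth_ip_fields[OF smooth_ch smooth_ch]]) simp

end

section \<open>Consequences of the existence of a limiting Carleman weight\<close>

locale weight_domain = metric_domain S g for S :: "(real^'n) set" and g +
  fixes \<phi> f :: "real^'n \<Rightarrow> real"
  assumes smooth_phi: "smooth_on S \<phi>" and smooth_f: "smooth_on S f"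
    and hess_phi: "\<And>x X Y. x \<in> S \<Longrightarrow> hess \<phi> x X Y = ddir X f x * ddir Y \<phi> x + ddir Y f x * ddir X \<phi> x
        - ip (g x) X Y * ip (g x) (grad f x) (grad \<phi> x)"
begin

text \<open>By \<open>hess_phi\<close>, the Hessian of \<open>\<phi>\<close> with respect to \<open>e\<^sup>2\<^sup>f g\<close> vanishes; \<open>K\<close> is \<open>e\<^sup>-\<^sup>2\<^sup>f\<close> times the curvature
  tensor of that metric.\<close>

definition "A x X Y = hess f x X Y - ddir X f x * ddir Y f x + ip (g x) X Y * (ip (g x) (grad f x) (grad f x) / 2)"
definition "K x X Y Z W = rm x X Y Z W + A x X Z * ip (g x) Y W - A x Y Z * ip (g x) X W
  - A x X W * ip (g x) Y Z + A x Y W * ip (g x) X Z"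

lemma smooth_df: "smooth_on S (\<lambda>x. ddir X f x)"
  using smooth_on_ddir[OF open_S smooth_f] .

lemma smooth_eta: "smooth_on S (\<lambda>x. ddir X \<phi> x)"
  using smooth_on_ddir[OF open_S smooth_phi] .

lemma smooth_mu: "smooth_on S (\<lambda>x. ip (g x) (grad f x) (grad \<phi> x))"
  by (rule smooth_ip_fields[OF smooth_grad[OF smooth_f] smooth_grad[OF smooth_phi]])

lemma smooth_A: "smooth_on S (\<lambda>x. A x X Y)"
  unfolding A_def
  by (rule smooth_on_add[OF open_S smooth_on_diff[OF open_S smooth_hess[OF smooth_f] smooth_on_mult[OF open_S smooth_df smooth_df]]
      smooth_on_mult[OF open_S smooth_ip smooth_on_divide[OF open_S smooth_ip_fields[OF smooth_grad[OF smooth_f] smooth_grad[OF smooth_f]] smooth_on_const]]]) simp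

lemma A_sym: "x \<in> S \<Longrightarrow> A x X Y = A x Y X"
  by (simp add: A_def hess_sym[OF smooth_f, of x X Y] ip_sym[of x X Y])

text \<open>With grad f as one argument, the first and the last term of \<open>hess_phi\<close>
  cancel. The identity enters through the derivative of the function g(grad f, grad \<phi>).\<close>

lemma hess_phi_grad_f: "x \<in> S \<Longrightarrow> hess \<phi> x M (grad f x) = ddir M \<phi> x * ip (g x) (grad f x) (grad f x)"
  unfolding hess_phi
  by (simp add: ip_grad(1)[OF smooth_phi, symmetric] ip_grad(1)[OF smooth_f, symmetric] ip_sym[of x "grad \<phi> x"]
    ip_sym[of x M "grad f x"])

lemma nab2_hess_phi:
  assumes x: "x \<in> S"
  shows "nab2 (hess \<phi>) M x X Y = hess f x M X * ddir Y \<phi> x + ddir X f x * hess \<phi> x M Y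
    + (hess f x M Y * ddir X \<phi> x + ddir Y f x * hess \<phi> x M X)
    - ip (g x) X Y * (hess f x M (grad \<phi> x) + ddir M \<phi> x * ip (g x) (grad f x) (grad f x))"
proof -
  have d: "(\<lambda>x. ddir X f x) differentiable (at x)" "(\<lambda>x. ddir X \<phi> x) differentiable (at x)"
    "(\<lambda>x. ip (g x) (grad f x) (grad \<phi> x)) differentiable (at x)" "(\<lambda>x. ip (g x) X Y) differentiable (at x)" for X Y
    by (rule sm[OF smooth_df x], rule sm[OF smooth_eta x], rule sm[OF smooth_mu x], rule sm[OF smooth_ip x])
  have "nab2 (hess \<phi>) M x X Y = nab2 (\<lambda>x X Y. ddir X f x * ddir Y \<phi> x + ddir Y f x * ddir X \<phi> x
        - ip (g x) X Y * ip (g x) (grad f x) (grad \<phi> x)) M x X Y"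
    by (rule nab2_cong[OF x hess_phi])
  also have "\<dots> = nab2 (\<lambda>x X Y. ddir X f x * ddir Y \<phi> x) M x X Y + nab2 (\<lambda>x X Y. ddir Y f x * ddir X \<phi> x) M x X Y
      - nab2 (\<lambda>x X Y. ip (g x) X Y * ip (g x) (grad f x) (grad \<phi> x)) M x X Y"
    by (subst nab2_diff, rule differentiable_add[OF differentiable_mult[OF d(1,2)] differentiable_mult[OF d(1,2)]],
        rule differentiable_mult[OF d(4,3)], subst nab2_add, rule differentiable_mult[OF d(1,2)], rule differentiable_mult[OF d(1,2)], rule refl)
  finally show ?thesis
    by (simp only: nab2_mult[OF d(1,2)] nab2_mult'[OF d(1,2)] nab2_ip[OF x d(3)] nab1_ddir
      ddir_ip_grad[OF smooth_f smooth_phi x] hess_phi_grad_f[OF x])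
qed

text \<open>The Ricci identity for \<phi>, with its Hessian replaced by the right-hand side of
  \<open>hess_phi\<close>. In terms of the conformal metric: d\<phi> is parallel, hence annihilated
  by the curvature.\<close>

lemma K_grad_phi:
  assumes x: "x \<in> S"
  shows "K x X Y Z (grad \<phi> x) = 0"
proof -
  have e: "hess f x M (grad \<phi> x) = A x M (grad \<phi> x) + ddir M f x * ip (g x) (grad f x) (grad \<phi> x)
     - ddir M \<phi> x * (ip (g x) (grad f x) (grad f x) / 2)"
    "hess f x M N = A x M N + ddir M f x * ddir N f x - ip (g x) M N * (ip (g x) (grad f x) (grad f x) / 2)" for M N
    using ip_grad(1)[OF smooth_f x, of "grad \<phi> x"] by (simp_all add: A_def ip_grad[OF smooth_phi x])
  have q: "ddir (grad f x) \<phi> x = ddir (grad \<phi> x) f x"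
    using ip_grad(2)[OF smooth_phi x, of "grad f x"] ip_grad(1)[OF smooth_f x, of "grad \<phi> x"] by simp
  have "- rm x X Y Z (grad \<phi> x) = nab2 (hess \<phi>) X x Y Z - nab2 (hess \<phi>) Y x X Z"
    using nab2_hess[OF smooth_phi x] by simp
  also have "\<dots> = A x X Z * ddir Y \<phi> x - A x Y Z * ddir X \<phi> x - ip (g x) Y Z * A x X (grad \<phi> x) + ip (g x) X Z * A x Y (grad \<phi> x)"
    unfolding nab2_hess_phi[OF x] e hess_phi[OF x] A_sym[OF x, of Y X] ip_sym[OF x, of Y X]
    by (simp add: ip_grad(2)[OF smooth_phi x] ip_grad(1)[OF smooth_f x] q algebra_simps)
  finally show ?thesis by (simp add: K_def ip_grad[OF smooth_phi x] mult.commute)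
qed

text \<open>The Ricci identity for f, corrected by the lower-order terms of A, is an equation of
  Codazzi type. It is later applied to arguments for which the curvature term on the right
  vanishes.\<close>

lemma nab2_A:
  assumes x: "x \<in> S"
  shows "nab2 A X x Y Z - nab2 A Y x X Z = - K x X Y Z (grad f x)"
proof -
  have d: "(\<lambda>x. ddir X f x) differentiable (at x)" "(\<lambda>x. hess f x X Y) differentiable (at x)"
    "(\<lambda>x. ip (g x) X Y) differentiable (at x)" for X Y
    by (rule sm[OF smooth_df x], rule sm[OF smooth_hess[OF smooth_f] x], rule sm[OF smooth_ip x])
  have d2: "(\<lambda>x. ip (g x) (grad f x) (grad f x)) differentiable (at x)"
    by (rule sm[OF smooth_ip_fields[OF smooth_grad[OF smooth_f] smooth_grad[OF smooth_f]] x])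
  have d3: "(\<lambda>x. ip (g x) (grad f x) (grad f x) / 2) differentiable (at x)"
    by (rule differentiable_bounded_linear[OF bounded_linear_divide d2])
  have dn: "ddir M (\<lambda>x. ip (g x) (grad f x) (grad f x) / 2) x = hess f x M (grad f x)" for M
    using ddir_bounded_linear[OF bounded_linear_divide d2, of M 2] ddir_ip_grad[OF smooth_f smooth_f x, of M] by simp
  have N: "nab2 A M x X Y = nab2 (hess f) M x X Y - (hess f x M X * ddir Y f x + ddir X f x * hess f x M Y)
      + ip (g x) X Y * hess f x M (grad f x)" for M X Y
    unfolding A_def
    by (subst nab2_add, rule differentiable_diff[OF d(2) differentiable_mult[OF d(1) d(1)]],
        rule differentiable_mult[OF d(3) d3], subst nab2_diff, rule d(2), rule differentiable_mult[OF d(1) d(1)])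
      (simp only: nab2_mult[OF d(1) d(1)] nab2_ip[OF x d3] nab1_ddir dn)
  have Af: "A x M (grad f x) = hess f x M (grad f x) - ddir M f x * (ip (g x) (grad f x) (grad f x) / 2)" for M
    by (simp add: A_def ip_grad[OF smooth_f x] field_simps)
  have "nab2 (hess f) X x Y Z = nab2 (hess f) Y x X Z - rm x X Y Z (grad f x)"
    using nab2_hess[OF smooth_f x, of X Y Z] by simp
  then show ?thesis
    unfolding K_def N Af ip_grad[OF smooth_f x] A_def[of x X Z] A_def[of x Y Z] hess_sym[OF smooth_f x, of Y X]
    by (simp add: algebra_simps)
qed

lemma smooth_K: "smooth_on S (\<lambda>x. K x X Y Z W)"
  unfolding K_def
  by (rule smooth_on_add[OF open_S smooth_on_diff[OF open_S smooth_on_diff[OF open_S smooth_on_add[OF open_S smooth_rm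
     smooth_on_mult[OF open_S smooth_A smooth_ip]] smooth_on_mult[OF open_S smooth_A smooth_ip]]
     smooth_on_mult[OF open_S smooth_A smooth_ip]] smooth_on_mult[OF open_S smooth_A smooth_ip]])

lemma linear_A: "x \<in> S \<Longrightarrow> linear (A x X)"
  by (rule linearI) (simp_all add: A_def linear_add[OF hess_linear(2)[OF smooth_f]] linear_scale[OF hess_linear(2)[OF smooth_f]]
     linear_add[OF ddir_linear_ddir[OF smooth_f]] linear_scale[OF ddir_linear_ddir[OF smooth_f]] ip_simps algebra_simps)

lemma linear_K: "x \<in> S \<Longrightarrow> linear (K x X Y Z)"
  by (rule linearI) (simp_all add: K_def linear_add[OF linear_rm] linear_scale[OF linear_rm]
     linear_add[OF linear_A] linear_scale[OF linear_A] ip_simps algebra_simps)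

lemma K_pair: "x \<in> S \<Longrightarrow> K x Z W X Y = K x X Y Z W"
  by (simp add: K_def rm_pair[of x Z W X Y] A_sym[of x Z X] A_sym[of x Z Y] A_sym[of x W X] A_sym[of x W Y]
     ip_sym[of x Z X] ip_sym[of x Z Y] ip_sym[of x W X] ip_sym[of x W Y])

lemma K_anti34: "x \<in> S \<Longrightarrow> K x X Y W Z = - K x X Y Z W"
  using rm_anti34[of x X Y W Z] by (simp add: K_def)

text \<open>Differentiate K(X, Y, Z, grad \<phi>) = 0. The covariant derivative of grad \<phi> is
  known from \<open>hess_phi\<close>, and K kills its component along grad \<phi>.\<close>

lemma nab4_K:
  assumes x: "x \<in> S"
  shows "nab4 K M x X Y Z (grad \<phi> x) =
    ip (g x) (grad f x) (grad \<phi> x) * K x X Y Z M - ddir M \<phi> x * K x X Y Z (grad f x)"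
proof -
  let ?v = "grad \<phi> x"
  have dv: "grad \<phi> differentiable (at x)" by (rule sm[OF smooth_grad[OF smooth_phi] x])
  have "0 = ddir M (\<lambda>y. K y X Y Z (grad \<phi> y)) x"
    using ddir_cong_open[OF open_S x, of "\<lambda>y. K y X Y Z (grad \<phi> y)" "\<lambda>_. 0"] K_grad_phi by simp
  also have "\<dots> = ddir M (\<lambda>y. K y X Y Z ?v) x + K x X Y Z (ddir M (grad \<phi>) x)"
    by (rule ddir_linear_field[OF open_S x linear_K sm[OF smooth_K x] dv])
  finally have 1: "ddir M (\<lambda>y. K y X Y Z ?v) x = - K x X Y Z (ddir M (grad \<phi>) x)" by simp
  have 2: "ddir M (grad \<phi>) x + ch x M ?v
    = ddir M f x *\<^sub>R ?v + ddir M \<phi> x *\<^sub>R grad f x - ip (g x) (grad f x) ?v *\<^sub>R M"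
    by (rule ip_eqI[OF x])
      (simp add: ip_simps ip_ddir_grad[OF smooth_phi x] ip_ch[OF x] hess_phi[OF x] ip_grad[OF smooth_phi x] ip_grad[OF smooth_f x] ip_grad(1)[OF smooth_phi x])
  have "nab4 K M x X Y Z ?v = - K x X Y Z (ddir M (grad \<phi>) x + ch x M ?v)"
    by (simp add: nab4_def 1 K_grad_phi[OF x] linear_add[OF linear_K[OF x]])
  also have "\<dots> = ip (g x) (grad f x) ?v * K x X Y Z M - ddir M \<phi> x * K x X Y Z (grad f x)"
    unfolding 2 by (simp add: linear_add[OF linear_K[OF x]] linear_diff[OF linear_K[OF x]] linear_scale[OF linear_K[OF x]] K_grad_phi[OF x])
  finally show ?thesis .
qed

text \<open>Every term by which K differs from the curvature contains a metric product of X or Y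
  with Z or grad \<phi>. All of them vanish, and the unknown f disappears.\<close>

lemma rm_orthogonal:
  assumes x: "x \<in> S" and o: "ip (g x) X Y = 0" "ip (g x) X Z = 0" "ip (g x) Y Z = 0"
    "ip (g x) X (grad \<phi> x) = 0" "ip (g x) Y (grad \<phi> x) = 0"
  shows "rm x X Y Z (grad \<phi> x) = 0"
  using K_grad_phi[OF x, of X Y Z] by (simp add: K_def o)

text \<open>Write v for grad \<phi>. By orthogonality the first curvature derivative is a multiple
  of the Z-derivative of A(X, v), the second one of the v-derivative of A(X, Z). By
  \<open>nab2_A\<close> these two derivatives of A agree, and the weights |v|^2 and |Z|^2 make the
  sum cancel, which eliminates f.\<close>

lemma nab_rm_orthogonal:
  assumes x: "x \<in> S" and o: "ip (g x) X Z = 0" "ip (g x) X (grad \<phi> x) = 0" "ip (g x) Z (grad \<phi> x) = 0"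
  shows "ip (g x) (grad \<phi> x) (grad \<phi> x) * nab4 rm Z x X Z Z (grad \<phi> x)
    + ip (g x) Z Z * nab4 rm (grad \<phi> x) x X (grad \<phi> x) Z (grad \<phi> x) = 0"
proof -
  let ?v = "grad \<phi> x"
  have dA: "(\<lambda>y. A y X Y) differentiable (at x)" for X Y by (rule sm[OF smooth_A x])
  have dm: "(\<lambda>y. A y X Y * ip (g y) Z W) differentiable (at x)" for X Y Z W
    by (rule differentiable_mult[OF dA sm[OF smooth_ip x]])
  have dr: "(\<lambda>y. rm y X Y Z W) differentiable (at x)" for X Y Z W by (rule sm[OF smooth_rm x])
  have N: "nab4 K M x X Y Z W = nab4 rm M x X Y Z W + nab2 A M x X Z * ip (g x) Y W - nab2 A M x Y Z * ip (g x) X W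
    - nab2 A M x X W * ip (g x) Y Z + nab2 A M x Y W * ip (g x) X Z" for M X Y Z W
    unfolding K_def
    by (subst nab4_add, (rule differentiable_diff differentiable_add dm dr)+,
        subst nab4_diff, (rule differentiable_diff differentiable_add dm dr)+,
        subst nab4_diff, (rule differentiable_diff differentiable_add dm dr)+,
        subst nab4_add, (rule differentiable_diff differentiable_add dm dr)+)
      (simp only: nab4_mult[OF x dA])
  have K0: "K x X Z Z Z = 0" using K_anti34[OF x, of X Z Z Z] by simp
  have dZ: "ddir Z \<phi> x = 0" using o(3) by (simp add: ip_grad[OF smooth_phi x])
  have o': "ip (g x) Z X = 0" "ip (g x) ?v X = 0" "ip (g x) ?v Z = 0" using o by (simp_all add: ip_sym[OF x])
  have 1: "nab4 rm Z x X Z Z ?v = ip (g x) Z Z * nab2 A Z x X ?v"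
    using nab4_K[OF x, of Z X Z Z] by (simp add: N o o' K0 dZ)
  \<comment> \<open>Pair symmetry moves grad \<phi> into the last slot, where
    \<open>K_grad_phi\<close> applies.\<close>
  have Kw: "K x X ?v Z (grad f x) = 0"
    using K_pair[OF x, of Z "grad f x" X ?v] K_grad_phi[OF x, of Z "grad f x" X] by simp
  have 2: "nab4 rm ?v x X ?v Z ?v = - (nab2 A ?v x X Z * ip (g x) ?v ?v)"
    using nab4_K[OF x, of ?v X ?v Z] by (simp add: N o o' Kw K_grad_phi[OF x] eq_neg_iff_add_eq_0)
  have Aswap: "nab2 A M x X Y = nab2 A M x Y X" for M X Y
    using ddir_cong_open[OF open_S x, of "\<lambda>y. A y X Y" "\<lambda>y. A y Y X" M] A_sym[of _ X Y]
    by (simp add: nab2_def A_sym[OF x, of "ch x M X"] A_sym[OF x, of X "ch x M Y"])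
  have "nab2 A Z x ?v X - nab2 A ?v x Z X = - K x Z ?v X (grad f x)" by (rule nab2_A[OF x])
  moreover have "K x Z ?v X (grad f x) = 0"
    using K_pair[OF x, of X "grad f x" Z ?v] K_grad_phi[OF x, of X "grad f x" Z] by simp
  ultimately have "nab2 A Z x X ?v = nab2 A ?v x X Z" using Aswap[of Z ?v X] Aswap[of ?v Z X] by simp
  then show ?thesis by (simp add: 1 2)
qed

end

section \<open>From the Poisson bracket to the Hessian equation\<close>

context metric_domain
begin

text \<open>Let B be the difference of the two sides of the Hessian equation. The choice f = ln
  |grad \<phi>| is exactly what makes B vanish as soon as one argument is grad \<phi>. The
  hypothesis gives B(Y, Y) = 0 for Y orthogonal to grad \<phi>, and polarisation does the
  rest.\<close>

lemma weight_domain_of_umbilic: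
  assumes phi: "smooth_on S \<phi>" and nz: "\<And>x. x \<in> S \<Longrightarrow> grad \<phi> x \<noteq> 0"
    and H: "\<And>x X. x \<in> S \<Longrightarrow> ip (g x) X (grad \<phi> x) = 0 \<Longrightarrow>
      ip (g x) X X = ip (g x) (grad \<phi> x) (grad \<phi> x) \<Longrightarrow>
      hess \<phi> x X X + hess \<phi> x (grad \<phi> x) (grad \<phi> x) = 0"
  shows "weight_domain S g \<phi> (\<lambda>x. ln (ip (g x) (grad \<phi> x) (grad \<phi> x)) / 2)"
proof -
  define q where "q = (\<lambda>x. ip (g x) (grad \<phi> x) (grad \<phi> x))"
  define f where "f = (\<lambda>x. ln (q x) / 2)"
  have q_pos: "q x > 0" if "x \<in> S" for x using ip_pos nz that by (simp add: q_def)
  have q_sm: "smooth_on S q"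
    unfolding q_def by (rule smooth_ip_fields[OF smooth_grad[OF phi] smooth_grad[OF phi]])
  have ln_sm: "smooth_on S (\<lambda>x. ln (q x))" by (rule smooth_on_ln(1)[OF open_S q_sm q_pos])
  have f_sm: "smooth_on S f"
    unfolding f_def by (rule smooth_on_divide[OF open_S ln_sm smooth_on_const]) simp
  have df: "ddir M f x = hess \<phi> x M (grad \<phi> x) / q x" if x: "x \<in> S" for M x
  proof -
    have "ddir M f x = ddir M (\<lambda>x. ln (q x)) x / 2"
      unfolding f_def by (rule ddir_bounded_linear[OF bounded_linear_divide sm[OF ln_sm x]])
    also have "ddir M (\<lambda>x. ln (q x)) x = ddir M q x / q x"
      by (rule smooth_on_ln(2)[OF open_S q_sm q_pos x])
    also have "ddir M q x = 2 * hess \<phi> x M (grad \<phi> x)"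
      unfolding q_def using ddir_ip_grad[OF phi phi x] by simp
    finally show ?thesis by simp
  qed
  have "hess \<phi> x X Y = ddir X f x * ddir Y \<phi> x + ddir Y f x * ddir X \<phi> x
        - ip (g x) X Y * ip (g x) (grad f x) (grad \<phi> x)" if x: "x \<in> S" for x X Y
  proof -
    let ?v = "grad \<phi> x"
    define \<mu> where "\<mu> = hess \<phi> x ?v ?v / q x"
    define B where "B = (\<lambda>X Y. hess \<phi> x X Y - ddir X f x * ddir Y \<phi> x - ddir Y f x * ddir X \<phi> x + ip (g x) X Y * \<mu>)"
    have mu: "ip (g x) (grad f x) ?v = \<mu>"
      by (simp add: ip_grad(1)[OF f_sm x] df[OF x] \<mu>_def)
    have qx: "q x > 0" by (rule q_pos[OF x])
    have lin: "hess \<phi> x (X + Y) Z = hess \<phi> x X Z + hess \<phi> x Y Z" "hess \<phi> x (r *\<^sub>R X) Z = r * hess \<phi> x X Z"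
       "hess \<phi> x Z (X + Y) = hess \<phi> x Z X + hess \<phi> x Z Y" "hess \<phi> x Z (r *\<^sub>R X) = r * hess \<phi> x Z X"
       "ddir (X + Y) f x = ddir X f x + ddir Y f x" "ddir (r *\<^sub>R X) f x = r * ddir X f x"
       "ddir (X + Y) \<phi> x = ddir X \<phi> x + ddir Y \<phi> x" "ddir (r *\<^sub>R X) \<phi> x = r * ddir X \<phi> x" for X Y Z r
      using linear_add[OF hess_linear(1)[OF phi x]] linear_scale[OF hess_linear(1)[OF phi x]]
        linear_add[OF hess_linear(2)[OF phi x]] linear_scale[OF hess_linear(2)[OF phi x]]
        ddir_add_dir[OF sm[OF f_sm x]] ddir_scale_dir[OF sm[OF f_sm x]]
        ddir_add_dir[OF sm[OF phi x]] ddir_scale_dir[OF sm[OF phi x]] by simp_all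
    have Badd: "B (X + Y) Z = B X Z + B Y Z" and Bscale: "B (r *\<^sub>R X) Z = r * B X Z" for X Y Z r
      unfolding B_def lin ip_simps by (simp_all add: algebra_simps)
    have Bsym: "B X Y = B Y X" for X Y
      by (simp add: B_def hess_sym[OF phi x, of X Y] ip_sym[OF x, of X Y])
    have Badd2: "B Z (X + Y) = B Z X + B Z Y" and Bscale2: "B Z (r *\<^sub>R X) = r * B Z X" for X Y Z r
      unfolding B_def lin ip_simps by (simp_all add: algebra_simps)
    have eta_v: "ddir ?v \<phi> x = q x" by (simp add: q_def ip_grad(1)[OF phi x])
    have Bv: "B ?v Y = 0" for Y
      using qx by (simp add: B_def eta_v df[OF x] \<mu>_def ip_grad(1)[OF phi x] hess_sym[OF phi x, of Y] field_simps)
    have Bperp: "B Y Y = 0" if o: "ip (g x) Y ?v = 0" for Y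
    proof (cases "Y = 0")
      case True
      then show ?thesis using Bscale[of 0 0 0] by simp
    next
      case False
      then have p: "ip (g x) Y Y > 0" by (rule ip_pos[OF x])
      \<comment> \<open>Rescales Y to the length of grad \<phi>, the only length for which the
        hypothesis speaks.\<close>
      define r where "r = sqrt (q x / ip (g x) Y Y)"
      have r2: "r * r = q x / ip (g x) Y Y" using p qx by (simp add: r_def)
      have eta: "ddir Y \<phi> x = 0" using o by (simp add: ip_grad(2)[OF phi x])
      have "ip (g x) (r *\<^sub>R Y) (r *\<^sub>R Y) = q x" using r2 p by (simp add: ip_simps mult.assoc[symmetric])
      then have "hess \<phi> x (r *\<^sub>R Y) (r *\<^sub>R Y) + hess \<phi> x ?v ?v = 0"
        using H[OF x, of "r *\<^sub>R Y"] o by (simp add: ip_simps q_def)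
      then have "(r * r) * hess \<phi> x Y Y + hess \<phi> x ?v ?v = 0" by (simp add: lin)
      then show ?thesis unfolding r2 using p qx by (simp add: B_def eta \<mu>_def field_simps)
    qed
    have Bdiag: "B Z Z = 0" for Z
    proof -
      \<comment> \<open>Removing the component along grad \<phi> does not change B(Z, Z), because
        that component is in the kernel of B.\<close>
      define a where "a = ip (g x) Z ?v / q x"
      define Y where "Y = Z + (- a) *\<^sub>R ?v"
      have "ip (g x) Y ?v = 0" using qx by (simp add: Y_def ip_simps a_def q_def)
      then have "B Y Y = 0" by (rule Bperp)
      then show ?thesis
        unfolding Y_def Badd Bscale Bv Badd2 Bscale2 Bsym[of Z ?v] by simp
    qed
    have "B (X + Y) (X + Y) = B X X + B X Y + (B Y X + B Y Y)" by (simp only: Badd Badd2)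
    then have "B X Y = 0" by (simp add: Bdiag Bsym[of Y X])
    then show ?thesis by (simp add: B_def mu)
  qed
  then have "weight_domain S g \<phi> f"
    using f_sm phi by unfold_locales auto
  then show ?thesis by (simp add: f_def q_def)
qed

text \<open>With p = a + 2ib for real a and b, the bracket of the conjugate of p with p is 4i times
  the bracket of a and b. At the covector dual to X the hypotheses on X say that p = 0; there the
  \<xi>-gradients of a and b are 2X and grad \<phi>, and the x-derivatives along grad \<phi> and X
  yield the two Hessian values.\<close>

lemma bracket_condition:
  assumes phi: "smooth_on S \<phi>" and x: "x \<in> S"
    and sym: "\<And>y \<xi>. y \<in> S \<Longrightarrow> p (y, \<xi>) = of_real (\<xi> \<bullet> (matrix_inv (g y) *v \<xi>) - ip (g y) (grad \<phi> y) (grad \<phi> y))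
      + 2 * \<i> * of_real (\<xi> \<bullet> grad \<phi> y)"
    and br: "\<And>\<xi>. p (x, \<xi>) = 0 \<Longrightarrow> poisson_bracket (cnj \<circ> p) p (x, \<xi>) = 0"
    and o: "ip (g x) X (grad \<phi> x) = 0" and n: "ip (g x) X X = ip (g x) (grad \<phi> x) (grad \<phi> x)"
  shows "hess \<phi> x X X + hess \<phi> x (grad \<phi> x) (grad \<phi> x) = 0"
proof -
  let ?v = "grad \<phi> x"
  define G where "G = (\<lambda>y. matrix_inv (g y))"
  define \<xi> where "\<xi> = g x *v X"
  have G_sm: "smooth_on S G"
    unfolding G_def by (rule smooth_on_matrix_inv[OF open_S smooth_g invertible_g])
  have Gg: "G x *v (g x *v Y) = Y" "g x *v (G x *v Y) = Y" for Y
    by (simp_all add: G_def matrix_vector_mul_assoc matrix_inv_mult[OF invertible_g[OF x]])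
  have xi: "\<xi> \<bullet> Y = ip (g x) X Y" for Y
    using ip_sym[OF x, of X Y] by (simp add: \<xi>_def ip_def inner_commute)
  have xiG: "\<xi> \<bullet> (G x *v Y) = X \<bullet> Y" for Y
    by (simp add: xi ip_def Gg)
  have Gxi: "G x *v \<xi> = X" by (simp add: \<xi>_def Gg)
  have q_sm: "smooth_on S (\<lambda>y. ip (g y) (grad \<phi> y) (grad \<phi> y))"
    by (rule smooth_ip_fields[OF smooth_grad[OF phi] smooth_grad[OF phi]])
  have fst_d: "(fst has_derivative fst) (at (x, \<xi>))" and snd_d: "(snd has_derivative snd) (at (x, \<xi>))"
    by (auto intro!: derivative_eq_intros)
  have comp: "((\<lambda>z. F (fst z)) has_derivative (\<lambda>h. ddir (fst h) F x)) (at (x, \<xi>))"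
    if "smooth_on S F" for F :: "real^'n \<Rightarrow> 'c::real_normed_vector"
    using diff_chain_at[OF fst_d, of F "\<lambda>M. ddir M F x"] differentiable_has_ddir[OF sm[OF that x]]
    by (simp add: o_def)
  define a where "a = (\<lambda>z. snd z \<bullet> (G (fst z) *v snd z) - ip (g (fst z)) (grad \<phi> (fst z)) (grad \<phi> (fst z)))"
  define b where "b = (\<lambda>z. snd z \<bullet> grad \<phi> (fst z))"
  define Da where "Da = (\<lambda>h. (\<xi> \<bullet> (G x *v snd h + ddir (fst h) G x *v \<xi>) + snd h \<bullet> (G x *v \<xi>))
    - ddir (fst h) (\<lambda>y. ip (g y) (grad \<phi> y) (grad \<phi> y)) x)"
  define Db where "Db = (\<lambda>h. \<xi> \<bullet> ddir (fst h) (grad \<phi>) x + snd h \<bullet> ?v)"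
  have a_d: "(a has_derivative Da) (at (x, \<xi>))"
    unfolding a_def Da_def
    using has_derivative_diff[OF has_derivative_inner[OF snd_d bounded_bilinear.FDERIV[OF bounded_bilinear_matrix_vector_mult comp[OF G_sm] snd_d]] comp[OF q_sm]]
    by simp
  have b_d: "(b has_derivative Db) (at (x, \<xi>))"
    unfolding b_def Db_def
    using has_derivative_inner[OF snd_d comp[OF smooth_grad[OF phi]]] by simp
  have p_eq: "p z = of_real (a z) + 2 * \<i> * of_real (b z)" if "z \<in> S \<times> UNIV" for z
    using that sym[of "fst z" "snd z"] by (cases z) (auto simp: a_def b_def G_def)
  have op: "open (S \<times> (UNIV :: (real^'n) set))" using open_S by (intro open_Times) auto
  have zin: "(x, \<xi>) \<in> S \<times> UNIV" using x by simp
  have p_d0: "((\<lambda>z. of_real (a z) + 2 * \<i> * of_real (b z)) has_derivative (\<lambda>h. of_real (Da h) + 2 * \<i> * of_real (Db h))) (at (x, \<xi>))"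
    by (intro has_derivative_add has_derivative_mult_right has_derivative_of_real a_d b_d)
  have p_d: "(p has_derivative (\<lambda>h. of_real (Da h) + 2 * \<i> * of_real (Db h))) (at (x, \<xi>))"
    by (rule has_derivative_transform_within_open[OF p_d0 op zin]) (simp add: p_eq)
  have cp_d: "(cnj \<circ> p has_derivative (\<lambda>h. cnj (of_real (Da h) + 2 * \<i> * of_real (Db h)))) (at (x, \<xi>))"
    unfolding o_def by (rule bounded_linear.has_derivative[OF bounded_linear_cnj p_d])
  have p0: "p (x, \<xi>) = 0"
    using sym[OF x, of \<xi>] Gxi[unfolded G_def] o n by (simp add: xi)
  have "0 = poisson_bracket (cnj \<circ> p) p (x, \<xi>)" using br[OF p0] by simp
  also have "\<dots> = (\<Sum>j\<in>UNIV. 4 * \<i> * of_real (Da (0, axis j 1) * Db (axis j 1, 0) - Db (0, axis j 1) * Da (axis j 1, 0)))"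
    unfolding poisson_bracket_def Let_def frechet_derivative_at[OF p_d, symmetric] frechet_derivative_at[OF cp_d, symmetric]
    by (rule sum.cong[OF refl]) (simp add: algebra_simps complex_eq_iff)
  also have "\<dots> = 4 * \<i> * of_real (\<Sum>j\<in>UNIV. Da (0, axis j 1) * Db (axis j 1, 0) - Db (0, axis j 1) * Da (axis j 1, 0))"
    by (simp only: of_real_sum sum_distrib_left)
  finally have s0: "(\<Sum>j\<in>UNIV. Da (0, axis j 1) * Db (axis j 1, 0) - Db (0, axis j 1) * Da (axis j 1, 0)) = 0"
    by (simp del: of_real_sum)
  have z0: "ddir 0 F x = 0" if "smooth_on S F" for F :: "real^'n \<Rightarrow> 'c::real_normed_vector"
    using linear_0[OF ddir_linear[OF sm[OF that x]]] .
  have Da_xi: "Da (0, axis j 1) = 2 * X $ j" for j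
    by (simp add: Da_def z0[OF G_sm] z0[OF q_sm] Gxi xiG inner_axis inner_axis')
  have Db_xi: "Db (0, axis j 1) = ?v $ j" for j
    by (simp add: Db_def z0[OF smooth_grad[OF phi]] inner_axis')
  have lDa: "linear (\<lambda>Y. Da (Y, 0))"
    using linear_compose[OF _ has_derivative_linear[OF a_d], of "\<lambda>Y. (Y, 0)"] by (simp add: o_def linear_iff)
  have lDb: "linear (\<lambda>Y. Db (Y, 0))"
    using linear_compose[OF _ has_derivative_linear[OF b_d], of "\<lambda>Y. (Y, 0)"] by (simp add: o_def linear_iff)
  have s1: "2 * Db (X, 0) = Da (?v, 0)"
    using s0 unfolding Da_xi Db_xi sum_subtractf
    by (simp add: linear_eq_sum_axis[OF lDa, of ?v] linear_eq_sum_axis[OF lDb, of X] sum_distrib_left mult.assoc)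
  \<comment> \<open>The derivative of the inverse metric comes from differentiating the constant
    g(X, G\<xi>), where G is the inverse of g.\<close>
  have dGxi: "\<xi> \<bullet> (ddir M G x *v \<xi>) = - dg M x X X" for M
  proof -
    have dG: "(\<lambda>y. G y *v \<xi>) differentiable (at x)"
      by (rule sm[OF smooth_on_bilinear[OF open_S bounded_bilinear_matrix_vector_mult G_sm smooth_on_const] x])
    have 1: "ddir M (\<lambda>y. G y *v \<xi>) x = ddir M G x *v \<xi>"
      using ddir_bilinear[OF bounded_bilinear_matrix_vector_mult sm[OF G_sm x], of "\<lambda>_. \<xi>" M] by simp
    have "ip (g y) X (G y *v \<xi>) = X \<bullet> \<xi>" if "y \<in> S" for y
      by (simp add: ip_def G_def matrix_vector_mul_assoc matrix_inv_mult[OF invertible_g[OF that]])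
    then have "0 = ddir M (\<lambda>y. ip (g y) X (G y *v \<xi>)) x"
      using ddir_cong_open[OF open_S x, of "\<lambda>y. ip (g y) X (G y *v \<xi>)" "\<lambda>_. X \<bullet> \<xi>" M] by simp
    also have "\<dots> = dg M x X X + ip (g x) X (ddir M G x *v \<xi>)"
      using ddir_ip_fields[OF x _ dG, of "\<lambda>_. X" M] by (simp add: 1 Gxi ip_simps)
    finally show ?thesis by (simp add: xi)
  qed
  have 1: "Db (X, 0) = hess \<phi> x X X - c1 x X ?v X"
    using ip_ddir_grad[OF phi x, of X X] by (simp add: Db_def xi ip_sym[OF x, of X])
  have 2: "Da (?v, 0) = - dg ?v x X X - 2 * hess \<phi> x ?v ?v"
    by (simp add: Da_def inner_add_right dGxi ddir_ip_grad[OF phi phi x])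
  \<comment> \<open>The Christoffel term of \<open>1\<close> thus cancels the derivative of the
    metric in \<open>2\<close>.\<close>
  have 3: "2 * c1 x X ?v X = dg ?v x X X"
    by (simp add: c1_def dg_sym[OF x, of X ?v])
  show ?thesis using s1 unfolding 1 2 using 3 by simp
qed

section \<open>The derivative of the curvature in terms of the 3-jet of the metric\<close>

definition "dddg M N P x X Y = ip (ddir M (ddir N (ddir P g)) x) X Y"

lemma ddir_ddg: "x \<in> S \<Longrightarrow> ddir M (\<lambda>x. ddg N P x X Y) x = dddg M N P x X Y"
  unfolding ddg_def dddg_def
  by (rule ddir_bounded_linear[OF bounded_linear_ip sm[OF smooth_on_ddir[OF open_S smooth_on_ddir[OF open_S smooth_g]]]])

text \<open>Pairing the derivative of a Christoffel vector with a vector expresses it by derivatives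
  of first-kind symbols. The derivative of the inverse metric is absorbed into the term with
  \<open>dg\<close>.\<close>

lemma ddir_ip_ch:
  assumes x: "x \<in> S"
  shows "ddir M (\<lambda>y. ip (g y) (ch y X Y) (ch y Z W)) x
    = dc1 M x X Y (ch x Z W) + dc1 M x Z W (ch x X Y) - dg M x (ch x X Y) (ch x Z W)"
proof -
  have d: "(\<lambda>y. ch y A B) differentiable (at x)" for A B by (rule sm[OF smooth_ch x])
  have e: "ip (g x) (ddir M (\<lambda>y. ch y A B) x) U = dc1 M x A B U - dg M x (ch x A B) U" for A B U
  proof -
    have "dc1 M x A B U = ddir M (\<lambda>y. ip (g y) (ch y A B) U) x"
      unfolding ddir_c1[OF x, symmetric] by (rule ddir_cong_open[OF open_S x]) (simp add: ip_ch)
    then show ?thesis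
      using ddir_ip_fields[OF x d, of "\<lambda>_. U" M A B] by (simp add: ip_simps)
  qed
  show ?thesis
    unfolding ddir_ip_fields[OF x d d] e ip_sym[OF x, of "ch x X Y"]
    using dg_sym[OF x, of M "ch x X Y" "ch x Z W"] by simp
qed

lemma ddir_rm:
  assumes x: "x \<in> S"
  shows "ddir M (\<lambda>y. rm y X Y Z W) x =
    (dddg M X Z x Y W - dddg M X W x Y Z - dddg M Y Z x X W + dddg M Y W x X Z) / 2
    - (dc1 M x Y Z (ch x X W) + dc1 M x X W (ch x Y Z) - dg M x (ch x Y Z) (ch x X W))
    + (dc1 M x X Z (ch x Y W) + dc1 M x Y W (ch x X Z) - dg M x (ch x X Z) (ch x Y W))"
proof -
  have d: "(\<lambda>y. ddg A B y C D) differentiable (at x)" for A B C D by (rule sm[OF smooth_ddg x])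
  have di: "(\<lambda>y. ip (g y) (ch y A B) (ch y C D)) differentiable (at x)" for A B C D
    by (rule sm[OF smooth_ip_fields[OF smooth_ch smooth_ch] x])
  have d2: "(\<lambda>y. ddg X Z y Y W - ddg X W y Y Z) differentiable (at x)"
    "(\<lambda>y. ddg X Z y Y W - ddg X W y Y Z - ddg Y Z y X W) differentiable (at x)"
    "(\<lambda>y. ddg X Z y Y W - ddg X W y Y Z - ddg Y Z y X W + ddg Y W y X Z) differentiable (at x)"
    by (rule differentiable_diff[OF d d], rule differentiable_diff[OF differentiable_diff[OF d d] d],
        rule differentiable_add[OF differentiable_diff[OF differentiable_diff[OF d d] d] d])
  have d3: "(\<lambda>y. (ddg X Z y Y W - ddg X W y Y Z - ddg Y Z y X W + ddg Y W y X Z) / 2) differentiable (at x)"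
    by (rule differentiable_bounded_linear[OF bounded_linear_divide d2(3)])
  have "ddir M (\<lambda>y. (ddg X Z y Y W - ddg X W y Y Z - ddg Y Z y X W + ddg Y W y X Z) / 2) x
    = ddir M (\<lambda>y. (ddg X Z y Y W - ddg X W y Y Z - ddg Y Z y X W + ddg Y W y X Z)) x / 2"
    by (rule ddir_bounded_linear[OF bounded_linear_divide d2(3)])
  also have "\<dots> = (dddg M X Z x Y W - dddg M X W x Y Z - dddg M Y Z x X W + dddg M Y W x X Z) / 2"
    by (simp only: ddir_add[OF d2(2) d] ddir_diff[OF d2(1) d] ddir_diff[OF d d] ddir_ddg[OF x])
  finally show ?thesis
    unfolding rm_def
    by (simp only: ddir_add[OF differentiable_diff[OF d3 di] di] ddir_diff[OF d3 di] ddir_ip_ch[OF x])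
qed

text \<open>Linearity in the last argument is carried to the others by antisymmetry and pair
  symmetry.\<close>

lemma rm_add:
  assumes "x \<in> S"
  shows "rm x (X + X') Y Z W = rm x X Y Z W + rm x X' Y Z W" "rm x (r *\<^sub>R X) Y Z W = r * rm x X Y Z W"
    "rm x X (Y + Y') Z W = rm x X Y Z W + rm x X Y' Z W" "rm x X (r *\<^sub>R Y) Z W = r * rm x X Y Z W"
    "rm x X Y (Z + Z') W = rm x X Y Z W + rm x X Y Z' W" "rm x X Y (r *\<^sub>R Z) W = r * rm x X Y Z W"
    "rm x X Y Z (W + W') = rm x X Y Z W + rm x X Y Z W'" "rm x X Y Z (r *\<^sub>R W) = r * rm x X Y Z W"
proof -
  note l = linear_add[OF linear_rm[OF assms]] linear_scale[OF linear_rm[OF assms]]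
  show 4: "rm x X Y Z (W + W') = rm x X Y Z W + rm x X Y Z W'" "rm x X Y Z (r *\<^sub>R W) = r * rm x X Y Z W" for X Y Z W W' r
    by (simp_all add: l)
  show 3: "rm x X Y (Z + Z') W = rm x X Y Z W + rm x X Y Z' W" "rm x X Y (r *\<^sub>R Z) W = r * rm x X Y Z W" for X Y Z Z' W r
    unfolding rm_anti34[OF assms, of X Y _ W] 4 by simp_all
  show "rm x (X + X') Y Z W = rm x X Y Z W + rm x X' Y Z W" "rm x (r *\<^sub>R X) Y Z W = r * rm x X Y Z W"
    "rm x X (Y + Y') Z W = rm x X Y Z W + rm x X Y' Z W" "rm x X (r *\<^sub>R Y) Z W = r * rm x X Y Z W"
    unfolding rm_pair[OF assms, of _ _ Z W] 3 4 by simp_all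
qed

definition "nrm x M X Y Z W = nab4 rm M x X Y Z W"

lemma nrm_add:
  assumes x: "x \<in> S"
  shows "nrm x (M + M') X Y Z W = nrm x M X Y Z W + nrm x M' X Y Z W" "nrm x (r *\<^sub>R M) X Y Z W = r * nrm x M X Y Z W"
    "nrm x M (X + X') Y Z W = nrm x M X Y Z W + nrm x M X' Y Z W" "nrm x M (r *\<^sub>R X) Y Z W = r * nrm x M X Y Z W"
    "nrm x M X (Y + Y') Z W = nrm x M X Y Z W + nrm x M X Y' Z W" "nrm x M X (r *\<^sub>R Y) Z W = r * nrm x M X Y Z W"
    "nrm x M X Y (Z + Z') W = nrm x M X Y Z W + nrm x M X Y Z' W" "nrm x M X Y (r *\<^sub>R Z) W = r * nrm x M X Y Z W"
    "nrm x M X Y Z (W + W') = nrm x M X Y Z W + nrm x M X Y Z W'" "nrm x M X Y Z (r *\<^sub>R W) = r * nrm x M X Y Z W"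
proof -
  have d: "(\<lambda>y. rm y X Y Z W) differentiable (at x)" for X Y Z W by (rule sm[OF smooth_rm x])
  have ca: "\<And>F M X Y Z W X' Y' Z' W'. (\<And>y. y \<in> S \<Longrightarrow> F y = rm y X Y Z W + rm y X' Y' Z' W') \<Longrightarrow> ddir M F x = ddir M (\<lambda>y. rm y X Y Z W) x + ddir M (\<lambda>y. rm y X' Y' Z' W') x"
    unfolding ddir_add[OF d d, symmetric] by (rule ddir_cong_open[OF open_S x])
  have cs: "\<And>F M r X Y Z W. (\<And>y. y \<in> S \<Longrightarrow> F y = r * rm y X Y Z W) \<Longrightarrow> ddir M F x = r * ddir M (\<lambda>y. rm y X Y Z W) x"
    unfolding ddir_bounded_linear[OF bounded_linear_mult_right d, symmetric] by (rule ddir_cong_open[OF open_S x])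
  have dir: "ddir (M + M') (\<lambda>y. rm y X Y Z W) x = ddir M (\<lambda>y. rm y X Y Z W) x + ddir M' (\<lambda>y. rm y X Y Z W) x"
      "ddir (r *\<^sub>R M) (\<lambda>y. rm y X Y Z W) x = r * ddir M (\<lambda>y. rm y X Y Z W) x" for M M' r X Y Z W
    using ddir_add_dir[OF d] ddir_scale_dir[OF d] by simp_all
  have c2: "ch x A (B + B') = ch x A B + ch x A B'" "ch x A (r *\<^sub>R B) = r *\<^sub>R ch x A B" for A B B' r
    by (simp_all add: linear_add[OF linear_ch[OF x]] linear_scale[OF linear_ch[OF x]])
  have c1: "ch x (A + A') B = ch x A B + ch x A' B" "ch x (r *\<^sub>R A) B = r *\<^sub>R ch x A B" for A A' B r
    using c2 by (simp_all add: ch_sym[OF x, of _ B])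
  note a = rm_add
  have D: "ddir M (\<lambda>y. rm y (X + X') Y Z W) x = ddir M (\<lambda>y. rm y X Y Z W) x + ddir M (\<lambda>y. rm y X' Y Z W) x"
    "ddir M (\<lambda>y. rm y X (Y + Y') Z W) x = ddir M (\<lambda>y. rm y X Y Z W) x + ddir M (\<lambda>y. rm y X Y' Z W) x"
    "ddir M (\<lambda>y. rm y X Y (Z + Z') W) x = ddir M (\<lambda>y. rm y X Y Z W) x + ddir M (\<lambda>y. rm y X Y Z' W) x"
    "ddir M (\<lambda>y. rm y X Y Z (W + W')) x = ddir M (\<lambda>y. rm y X Y Z W) x + ddir M (\<lambda>y. rm y X Y Z W') x"
    by ((rule ca, rule a(1), assumption) | (rule ca, rule a(3), assumption) | (rule ca, rule a(5), assumption)
      | (rule ca, rule a(7), assumption))+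
  have E: "ddir M (\<lambda>y. rm y (r *\<^sub>R X) Y Z W) x = r * ddir M (\<lambda>y. rm y X Y Z W) x"
    "ddir M (\<lambda>y. rm y X (r *\<^sub>R Y) Z W) x = r * ddir M (\<lambda>y. rm y X Y Z W) x"
    "ddir M (\<lambda>y. rm y X Y (r *\<^sub>R Z) W) x = r * ddir M (\<lambda>y. rm y X Y Z W) x"
    "ddir M (\<lambda>y. rm y X Y Z (r *\<^sub>R W)) x = r * ddir M (\<lambda>y. rm y X Y Z W) x"
    by ((rule cs, rule a(2), assumption) | (rule cs, rule a(4), assumption) | (rule cs, rule a(6), assumption)
      | (rule cs, rule a(8), assumption))+
  show "nrm x (M + M') X Y Z W = nrm x M X Y Z W + nrm x M' X Y Z W" "nrm x (r *\<^sub>R M) X Y Z W = r * nrm x M X Y Z W"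
    unfolding nrm_def nab4_def dir c1 rm_add[OF x] by (simp_all add: algebra_simps)
  show "nrm x M (X + X') Y Z W = nrm x M X Y Z W + nrm x M X' Y Z W" "nrm x M (r *\<^sub>R X) Y Z W = r * nrm x M X Y Z W"
    unfolding nrm_def nab4_def c2 rm_add[OF x] D E by (simp_all add: algebra_simps)
  show "nrm x M X (Y + Y') Z W = nrm x M X Y Z W + nrm x M X Y' Z W" "nrm x M X (r *\<^sub>R Y) Z W = r * nrm x M X Y Z W"
    unfolding nrm_def nab4_def c2 rm_add[OF x] D E by (simp_all add: algebra_simps)
  show "nrm x M X Y (Z + Z') W = nrm x M X Y Z W + nrm x M X Y Z' W" "nrm x M X Y (r *\<^sub>R Z) W = r * nrm x M X Y Z W"
    unfolding nrm_def nab4_def c2 rm_add[OF x] D E by (simp_all add: algebra_simps)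
  show "nrm x M X Y Z (W + W') = nrm x M X Y Z W + nrm x M X Y Z W'" "nrm x M X Y Z (r *\<^sub>R W) = r * nrm x M X Y Z W"
    unfolding nrm_def nab4_def c2 rm_add[OF x] D E by (simp_all add: algebra_simps)
qed

lemma linear_rm_args:
  assumes "x \<in> S"
  shows "linear (\<lambda>X. rm x X Y Z W)" "linear (\<lambda>Y. rm x X Y Z W)"
    "linear (\<lambda>Z. rm x X Y Z W)" "linear (\<lambda>W. rm x X Y Z W)"
  by (rule linearI; simp add: rm_add[OF assms])+

lemma linear_nrm_args:
  assumes "x \<in> S"
  shows "linear (\<lambda>M. nrm x M X Y Z W)" "linear (\<lambda>X. nrm x M X Y Z W)"
    "linear (\<lambda>Y. nrm x M X Y Z W)" "linear (\<lambda>Z. nrm x M X Y Z W)" "linear (\<lambda>W. nrm x M X Y Z W)"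
  by (rule linearI; simp add: nrm_add[OF assms])+

text \<open>In this form the dependence on the 3-jet at x is visibly continuous, and the third
  derivatives enter linearly and only in the first line.\<close>

lemma nrm_explicit:
  assumes x: "x \<in> S"
  shows "nrm x M X Y Z W =
    (dddg M X Z x Y W - dddg M X W x Y Z - dddg M Y Z x X W + dddg M Y W x X Z) / 2
    - (dc1 M x Y Z (ch x X W) + dc1 M x X W (ch x Y Z) - dg M x (ch x Y Z) (ch x X W))
    + (dc1 M x X Z (ch x Y W) + dc1 M x Y W (ch x X Z) - dg M x (ch x X Z) (ch x Y W))
    - rm x (ch x M X) Y Z W - rm x X (ch x M Y) Z W - rm x X Y (ch x M Z) W - rm x X Y Z (ch x M W)"
  by (simp add: nrm_def nab4_def ddir_rm[OF x])

end

text \<open>In dimension 3 the obstruction is a component of the Cotton tensor and ignores its argument \<open>Z\<close>.\<close>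

definition obstruction ::
  "(real^'n \<Rightarrow> real^'n^'n) \<Rightarrow> real^'n \<Rightarrow> real^'n \<Rightarrow> real^'n \<Rightarrow> real^'n \<Rightarrow> real^'n \<Rightarrow> real"
  where "obstruction g x X Y Z v = (if CARD('n) = 3
    then ip (g x) v v * metric_domain.nrm g x Y X Y Y v + ip (g x) Y Y * metric_domain.nrm g x v X v Y v
    else metric_domain.rm g x X Y Z v)"

lemma (in weight_domain) obstruction_zero:
  assumes x: "x \<in> S" and o: "ip (g x) X Y = 0" "ip (g x) X Z = 0" "ip (g x) Y Z = 0"
    "ip (g x) X (grad \<phi> x) = 0" "ip (g x) Y (grad \<phi> x) = 0"
  shows "obstruction g x X Y Z (grad \<phi> x) = 0"
  using rm_orthogonal[OF assms] nab_rm_orthogonal[OF x o(1,4,5)]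
  by (simp add: obstruction_def nrm_def)

text \<open>Gram--Schmidt orthogonalisation without denominators.\<close>

definition gsp :: "real^'n^'n \<Rightarrow> real^'n \<Rightarrow> real^'n \<Rightarrow> real^'n"
  where "gsp G u X = ip G u u *\<^sub>R X - ip G X u *\<^sub>R u"

definition "gs1 G v X = gsp G v X"
definition "gs2 G v X Y = gsp G (gs1 G v X) (gsp G v Y)"
definition "gs3 G v X Y Z = gsp G (gs2 G v X Y) (gsp G (gs1 G v X) (gsp G v Z))"

lemma gsp_orthogonal: "ip G (gsp G u X) u = 0"
  by (simp add: gsp_def ip_simps)

lemma gsp_keeps: "ip G X w = 0 \<Longrightarrow> ip G u w = 0 \<Longrightarrow> ip G (gsp G u X) w = 0"
  by (simp add: gsp_def ip_simps)

lemma gs_orthogonal: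
  assumes "\<And>X Y. ip G X Y = ip G Y X"
  shows "ip G (gs1 G v X) (gs2 G v X Y) = 0" "ip G (gs1 G v X) (gs3 G v X Y Z) = 0"
    "ip G (gs2 G v X Y) (gs3 G v X Y Z) = 0"
    "ip G (gs1 G v X) v = 0" "ip G (gs2 G v X Y) v = 0" "ip G (gs3 G v X Y Z) v = 0"
proof -
  show 1: "ip G (gs1 G v X) v = 0" by (simp add: gs1_def gsp_orthogonal)
  show 2: "ip G (gs2 G v X Y) v = 0" by (simp add: gs2_def gsp_orthogonal gsp_keeps 1)
  show "ip G (gs3 G v X Y Z) v = 0" by (simp add: gs3_def gsp_orthogonal gsp_keeps 1 2)
  have 3: "ip G (gs2 G v X Y) (gs1 G v X) = 0" by (simp add: gs2_def gsp_orthogonal)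
  then show "ip G (gs1 G v X) (gs2 G v X Y) = 0" using assms by metis
  have "ip G (gs3 G v X Y Z) (gs1 G v X) = 0"
    unfolding gs3_def by (rule gsp_keeps[OF gsp_orthogonal 3])
  then show "ip G (gs1 G v X) (gs3 G v X Y Z) = 0" using assms by metis
  have "ip G (gs3 G v X Y Z) (gs2 G v X Y) = 0" by (simp add: gs3_def gsp_orthogonal)
  then show "ip G (gs2 G v X Y) (gs3 G v X Y Z) = 0" using assms by metis
qed

text \<open>For constant X, Y, Z this is a function of v alone, defined and smooth for every v,
  since the orthogonality to v is produced inside.\<close>

definition gs_obstruction :: "(real^'n \<Rightarrow> real^'n^'n) \<Rightarrow> real^'n \<Rightarrow> real^'n \<Rightarrow> real^'n \<Rightarrow> real^'n \<Rightarrow> real^'n \<Rightarrow> real"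
  where "gs_obstruction g x X Y Z v =
    obstruction g x (gs1 (g x) v X) (gs2 (g x) v X Y) (gs3 (g x) v X Y Z) v"

definition degenerate_at :: "(real^'n \<Rightarrow> real^'n^'n) \<Rightarrow> real^'n \<Rightarrow> real^'n \<Rightarrow> bool"
  where "degenerate_at g x v \<longleftrightarrow> (\<forall>X Y Z. gs_obstruction g x X Y Z v = 0)"

context metric_domain
begin

lemma obstruction_scale:
  assumes "x \<in> S"
  shows "obstruction g x (a *\<^sub>R X) (b *\<^sub>R Y) (c *\<^sub>R Z) (r *\<^sub>R v) =
    (if CARD('n) = 3 then a * b ^ 3 * r ^ 3 else a * b * c * r) * obstruction g x X Y Z v"
  by (simp add: obstruction_def nrm_add[OF assms] rm_add[OF assms] ip_simps power3_eq_cube algebra_simps)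

text \<open>The obstruction vanishes at grad \<phi>; it is homogeneous in v, so the gradient can be
  normalised to a vector of the compact unit sphere.\<close>

lemma degenerate_of_weight:
  assumes x: "x \<in> S" and w: "weight_domain S g \<phi> f" and nz: "grad \<phi> x \<noteq> 0"
  shows "\<exists>v. norm v = 1 \<and> degenerate_at g x v"
proof (intro exI conjI)
  let ?v = "inverse (norm (grad \<phi> x)) *\<^sub>R grad \<phi> x"
  show "norm ?v = 1" using nz by simp
  show "degenerate_at g x ?v"
    unfolding degenerate_at_def gs_obstruction_def
  proof (intro allI)
    fix X Y Z
    have orth: "ip (g x) (gs1 (g x) ?v X) (gs2 (g x) ?v X Y) = 0" "ip (g x) (gs1 (g x) ?v X) (gs3 (g x) ?v X Y Z) = 0"
      "ip (g x) (gs2 (g x) ?v X Y) (gs3 (g x) ?v X Y Z) = 0"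
      "ip (g x) (gs1 (g x) ?v X) ?v = 0" "ip (g x) (gs2 (g x) ?v X Y) ?v = 0"
      by (rule gs_orthogonal[OF ip_sym[OF x]])+
    have orth': "ip (g x) (gs1 (g x) ?v X) (grad \<phi> x) = 0" "ip (g x) (gs2 (g x) ?v X Y) (grad \<phi> x) = 0"
      using orth(4,5) nz by (simp_all add: ip_simps)
    have "obstruction g x (gs1 (g x) ?v X) (gs2 (g x) ?v X Y) (gs3 (g x) ?v X Y Z) (grad \<phi> x) = 0"
      by (rule weight_domain.obstruction_zero[OF w x orth(1-3) orth'])
    then show "obstruction g x (gs1 (g x) ?v X) (gs2 (g x) ?v X Y) (gs3 (g x) ?v X Y Z) ?v = 0"
      using obstruction_scale[OF x, of 1 "gs1 (g x) ?v X" 1 "gs2 (g x) ?v X Y" 1 "gs3 (g x) ?v X Y Z" _ "grad \<phi> x"]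
      by simp
  qed
qed

end

section \<open>The obstruction depends continuously on the jet of the metric\<close>

lemma smooth_on_linear_field:
  fixes T :: "real^'n \<Rightarrow> real^'m \<Rightarrow> real"
  assumes "open U" "\<And>v. v \<in> U \<Longrightarrow> linear (T v)" "\<And>Y. smooth_on U (\<lambda>v. T v Y)" "smooth_on U X"
  shows "smooth_on U (\<lambda>v. T v (X v))"
proof (rule smooth_on_eqI[OF assms(1)])
  show "smooth_on U (\<lambda>v. \<Sum>i\<in>UNIV. (X v $ i) * T v (axis i 1))"
    by (rule smooth_on_sum[OF assms(1) smooth_on_mult[OF assms(1) smooth_on_vec_nth[OF assms(1,4)] assms(3)]])
  show "T v (X v) = (\<Sum>i\<in>UNIV. (X v $ i) * T v (axis i 1))" if "v \<in> U" for v
    using linear_eq_sum_axis[OF assms(2)[OF that], of "X v"] by simp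
qed

text \<open>Testing on the basis suffices. Applied to one argument at a time, it upgrades
  convergence of a tensor at constant arguments to convergence at convergent arguments.\<close>

lemma tendsto_linear_field:
  fixes T :: "nat \<Rightarrow> real^'m \<Rightarrow> real"
  assumes "\<And>m. linear (T m)" "linear T'" "\<And>Y. (\<lambda>m. T m Y) \<longlonglongrightarrow> T' Y" "X \<longlonglongrightarrow> X'"
  shows "(\<lambda>m. T m (X m)) \<longlonglongrightarrow> T' X'"
proof -
  have "(\<lambda>m. \<Sum>i\<in>UNIV. (X m $ i) * T m (axis i 1)) \<longlonglongrightarrow> (\<Sum>i\<in>UNIV. (X' $ i) * T' (axis i 1))"
    by (rule tendsto_sum, rule tendsto_mult[OF tendsto_vec_nth[OF assms(4)] assms(3)])
  moreover have "T m (X m) = (\<Sum>i\<in>UNIV. (X m $ i) * T m (axis i 1))" for m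
    using linear_eq_sum_axis[OF assms(1), of m "X m"] by simp
  moreover have "T' X' = (\<Sum>i\<in>UNIV. (X' $ i) * T' (axis i 1))"
    using linear_eq_sum_axis[OF assms(2), of X'] by simp
  ultimately show ?thesis by simp
qed

lemma tendsto_ip:
  assumes "(G \<longlongrightarrow> G') F" "(X \<longlongrightarrow> X') F" "(Y \<longlongrightarrow> Y') F"
  shows "((\<lambda>m. ip (G m) (X m) (Y m)) \<longlongrightarrow> ip G' X' Y') F"
  unfolding ip_sum
  by (rule tendsto_sum, rule tendsto_sum, rule tendsto_mult[OF tendsto_vec_nth[OF tendsto_vec_nth[OF assms(1)]]
      tendsto_mult[OF tendsto_vec_nth[OF assms(2)] tendsto_vec_nth[OF assms(3)]]])

lemma tendsto_det:
  fixes A :: "'a \<Rightarrow> real^'n^'n"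
  assumes "\<And>i j. ((\<lambda>m. A m $ i $ j) \<longlongrightarrow> B $ i $ j) F"
  shows "((\<lambda>m. det (A m)) \<longlongrightarrow> det B) F"
  unfolding det_def
  by (rule tendsto_sum, rule tendsto_mult[OF tendsto_const], rule tendsto_prod, rule assms)

lemma tendsto_matrix_inv:
  fixes A :: "'a \<Rightarrow> real^'n^'n"
  assumes "(A \<longlongrightarrow> B) F" "\<And>m. invertible (A m)" "invertible B"
  shows "((\<lambda>m. matrix_inv (A m)) \<longlongrightarrow> matrix_inv B) F"
proof (rule vec_tendstoI, rule vec_tendstoI)
  fix i j
  have e: "((\<lambda>m. A m $ i $ j) \<longlongrightarrow> B $ i $ j) F" for i j
    by (rule tendsto_vec_nth[OF tendsto_vec_nth[OF assms(1)]])
  have e2: "((\<lambda>m. (\<chi> r c. if c = i then axis j 1 $ r else A m $ r $ c) $ r $ c) \<longlongrightarrow>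
     (\<chi> r c. if c = i then axis j 1 $ r else B $ r $ c) $ r $ c) F" for i j r c :: 'n
    using e[of r c] by (cases "c = i") simp_all
  have "det B \<noteq> 0" using assms(3) by (simp add: invertible_det_nz)
  then show "((\<lambda>m. matrix_inv (A m) $ i $ j) \<longlongrightarrow> matrix_inv B $ i $ j) F"
    unfolding matrix_inv_entry[OF assms(2)] matrix_inv_entry[OF assms(3)]
    by (rule tendsto_divide[OF tendsto_det[OF e2] tendsto_det[OF e]])
qed

text \<open>Reduces iterated directional derivatives to partial ones, the quantities that the
  topology of metrics controls.\<close>

lemma ddir2_expand:
  fixes f :: "real^'n \<Rightarrow> 'b::real_normed_vector"
  assumes "open S" "x \<in> S" "smooth_on S f"
  shows "ddir M (ddir N f) x = (\<Sum>j\<in>UNIV. (N $ j) *\<^sub>R ddir M (partial_deriv j f) x)"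
proof -
  have d: "(\<lambda>y. (N $ j) *\<^sub>R partial_deriv j f y) differentiable (at x)"
     "partial_deriv j f differentiable (at x)" for j
    by (rule smooth_on_differentiable[OF smooth_on_scaleR[OF assms(1) smooth_on_const smooth_on_partial[OF assms(3)]] assms(1,2)],
      rule smooth_on_differentiable[OF smooth_on_partial[OF assms(3)] assms(1,2)])
  have "ddir M (ddir N f) x = ddir M (\<lambda>y. \<Sum>j\<in>UNIV. (N $ j) *\<^sub>R partial_deriv j f y) x"
    by (rule ddir_cong_open[OF assms(1,2)], rule ddir_expand[OF smooth_on_differentiable[OF assms(3,1)]])
  also have "\<dots> = (\<Sum>j\<in>UNIV. ddir M (\<lambda>y. (N $ j) *\<^sub>R partial_deriv j f y) x)"
    by (rule ddir_sum) (rule d(1))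
  also have "\<dots> = (\<Sum>j\<in>UNIV. (N $ j) *\<^sub>R ddir M (partial_deriv j f) x)"
    by (rule sum.cong[OF refl], rule ddir_bounded_linear[OF bounded_linear_scaleR_right d(2)])
  finally show ?thesis .
qed

text \<open>Only the k-jets at the one point x are assumed to converge. Sequences are enough because
  the openness argument runs through a countable family of shrinking neighbourhoods.\<close>

locale converging_metrics =
  fixes S :: "(real^'n) set" and g :: "real^'n \<Rightarrow> real^'n^'n" and h :: "nat \<Rightarrow> real^'n \<Rightarrow> real^'n^'n"
    and x :: "real^'n" and k :: nat
  assumes md: "metric_domain S g" and md': "\<And>m. metric_domain S (h m)" and x: "x \<in> S"
    and jets: "\<And>js. length js \<le> k \<Longrightarrow> (\<lambda>m. iter_partial js (h m) x) \<longlonglongrightarrow> iter_partial js g x"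
    and k2: "k \<ge> 2"
begin

lemmas open_S = metric_domain.open_S[OF md]
lemmas sm_g = metric_domain.smooth_g[OF md]
lemmas sm_h = metric_domain.smooth_g[OF md']

lemma lim0: "(\<lambda>m. h m x) \<longlonglongrightarrow> g x"
  using jets[of "[]"] by (simp add: iter_partial_def)

lemma lim1: "(\<lambda>m. ddir M (h m) x) \<longlonglongrightarrow> ddir M g x"
proof -
  have "(\<lambda>m. partial_deriv j (h m) x) \<longlonglongrightarrow> partial_deriv j g x" for j
    using jets[of "[j]"] k2 by (simp add: iter_partial_def)
  then show ?thesis
    unfolding ddir_expand[OF smooth_on_differentiable[OF sm_g open_S x]] ddir_expand[OF smooth_on_differentiable[OF sm_h open_S x]]
    by (intro tendsto_sum tendsto_scaleR tendsto_const)
qed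

lemma lim2: "(\<lambda>m. ddir M (ddir N (h m)) x) \<longlonglongrightarrow> ddir M (ddir N g) x"
proof -
  have "(\<lambda>m. partial_deriv i (partial_deriv j (h m)) x) \<longlonglongrightarrow> partial_deriv i (partial_deriv j g) x" for i j
    using jets[of "[i,j]"] k2 by (simp add: iter_partial_def)
  then have "(\<lambda>m. ddir M (partial_deriv j (h m)) x) \<longlonglongrightarrow> ddir M (partial_deriv j g) x" for j
    unfolding ddir_expand[OF smooth_on_differentiable[OF smooth_on_partial[OF sm_g] open_S x]]
      ddir_expand[OF smooth_on_differentiable[OF smooth_on_partial[OF sm_h] open_S x]]
    by (intro tendsto_sum tendsto_scaleR tendsto_const)
  then show ?thesis
    unfolding ddir2_expand[OF open_S x sm_g] ddir2_expand[OF open_S x sm_h]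
    by (intro tendsto_sum tendsto_scaleR tendsto_const)
qed

lemma lim3:
  assumes "k \<ge> 3"
  shows "(\<lambda>m. ddir M (ddir N (ddir P (h m))) x) \<longlonglongrightarrow> ddir M (ddir N (ddir P g)) x"
proof -
  have e: "ddir M (ddir N (ddir P f)) x = (\<Sum>l\<in>UNIV. (P $ l) *\<^sub>R ddir M (ddir N (partial_deriv l f)) x)"
    if f: "smooth_on S f" for f :: "real^'n \<Rightarrow> real^'n^'n"
  proof -
    have d: "(\<lambda>y. (P $ l) *\<^sub>R ddir N (partial_deriv l f) y) differentiable (at x)"
       "ddir N (partial_deriv l f) differentiable (at x)" for l
      by (rule smooth_on_differentiable[OF smooth_on_scaleR[OF open_S smooth_on_const smooth_on_ddir[OF open_S smooth_on_partial[OF f]]] open_S x],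
        rule smooth_on_differentiable[OF smooth_on_ddir[OF open_S smooth_on_partial[OF f]] open_S x])
    have "ddir M (ddir N (ddir P f)) x = ddir M (\<lambda>y. \<Sum>l\<in>UNIV. (P $ l) *\<^sub>R ddir N (partial_deriv l f) y) x"
      by (rule ddir_cong_open[OF open_S x], rule ddir2_expand[OF open_S _ f])
    also have "\<dots> = (\<Sum>l\<in>UNIV. ddir M (\<lambda>y. (P $ l) *\<^sub>R ddir N (partial_deriv l f) y) x)"
      by (rule ddir_sum) (rule d(1))
    also have "\<dots> = (\<Sum>l\<in>UNIV. (P $ l) *\<^sub>R ddir M (ddir N (partial_deriv l f)) x)"
      by (rule sum.cong[OF refl], rule ddir_bounded_linear[OF bounded_linear_scaleR_right d(2)])
    finally show ?thesis .
  qed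
  have "(\<lambda>m. partial_deriv i (partial_deriv j (partial_deriv l (h m))) x) \<longlonglongrightarrow> partial_deriv i (partial_deriv j (partial_deriv l g)) x" for i j l
    using jets[of "[i,j,l]"] assms by (simp add: iter_partial_def)
  then have "(\<lambda>m. ddir M (partial_deriv j (partial_deriv l (h m))) x) \<longlonglongrightarrow> ddir M (partial_deriv j (partial_deriv l g)) x" for j l
    unfolding ddir_expand[OF smooth_on_differentiable[OF smooth_on_partial[OF smooth_on_partial[OF sm_g]] open_S x]]
      ddir_expand[OF smooth_on_differentiable[OF smooth_on_partial[OF smooth_on_partial[OF sm_h]] open_S x]]
    by (intro tendsto_sum tendsto_scaleR tendsto_const)
  then have "(\<lambda>m. ddir M (ddir N (partial_deriv l (h m))) x) \<longlonglongrightarrow> ddir M (ddir N (partial_deriv l g)) x" for l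
    unfolding ddir2_expand[OF open_S x smooth_on_partial[OF sm_g]] ddir2_expand[OF open_S x smooth_on_partial[OF sm_h]]
    by (intro tendsto_sum tendsto_scaleR tendsto_const)
  then show ?thesis
    unfolding e[OF sm_g] e[OF sm_h] by (intro tendsto_sum tendsto_scaleR tendsto_const)
qed

lemma lim_dg:
  assumes "X \<longlonglongrightarrow> X'" "Y \<longlonglongrightarrow> Y'"
  shows "(\<lambda>m. metric_domain.dg (h m) M x (X m) (Y m)) \<longlonglongrightarrow> metric_domain.dg g M x X' Y'"
  unfolding metric_domain.dg_def[OF md] metric_domain.dg_def[OF md'] by (rule tendsto_ip[OF lim1 assms])

lemma lim_ddg: "(\<lambda>m. metric_domain.ddg (h m) M N x X Y) \<longlonglongrightarrow> metric_domain.ddg g M N x X Y"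
  unfolding metric_domain.ddg_def[OF md] metric_domain.ddg_def[OF md'] by (rule tendsto_ip[OF lim2 tendsto_const tendsto_const])

lemma lim_dddg: "k \<ge> 3 \<Longrightarrow> (\<lambda>m. metric_domain.dddg (h m) M N P x X Y) \<longlonglongrightarrow> metric_domain.dddg g M N P x X Y"
  unfolding metric_domain.dddg_def[OF md] metric_domain.dddg_def[OF md'] by (rule tendsto_ip[OF lim3 tendsto_const tendsto_const])

lemma lim_c1: "(\<lambda>m. metric_domain.c1 (h m) x X Y Z) \<longlonglongrightarrow> metric_domain.c1 g x X Y Z"
  unfolding metric_domain.c1_def[OF md] metric_domain.c1_def[OF md']
  by (intro tendsto_divide tendsto_diff tendsto_add lim_dg tendsto_const) simp

lemma lim_dc1:
  assumes "Z \<longlonglongrightarrow> Z'"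
  shows "(\<lambda>m. metric_domain.dc1 (h m) M x X Y (Z m)) \<longlonglongrightarrow> metric_domain.dc1 g M x X Y Z'"
proof (rule tendsto_linear_field[OF metric_domain.linear_dc1[OF md' x] metric_domain.linear_dc1[OF md x] _ assms])
  show "(\<lambda>m. metric_domain.dc1 (h m) M x X Y Z) \<longlonglongrightarrow> metric_domain.dc1 g M x X Y Z" for Z
    unfolding metric_domain.dc1_def[OF md] metric_domain.dc1_def[OF md']
    by (intro tendsto_divide tendsto_diff tendsto_add lim_ddg tendsto_const) simp
qed

lemma lim_ch: "(\<lambda>m. metric_domain.ch (h m) x X Y) \<longlonglongrightarrow> metric_domain.ch g x X Y"
proof -
  have i: "(\<lambda>m. matrix_inv (h m x) $ i $ j) \<longlonglongrightarrow> matrix_inv (g x) $ i $ j" for i j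
    by (rule tendsto_vec_nth[OF tendsto_vec_nth[OF tendsto_matrix_inv[OF lim0 metric_domain.invertible_g[OF md' x] metric_domain.invertible_g[OF md x]]]])
  show ?thesis
    unfolding metric_domain.ch_def[OF md] metric_domain.ch_def[OF md'] metric_domain.raise_def[OF md] metric_domain.raise_def[OF md']
    by (rule vec_tendstoI) (auto simp: matrix_vector_mult_def intro!: tendsto_sum tendsto_mult i lim_c1)
qed

lemma lim_rm_const: "(\<lambda>m. metric_domain.rm (h m) x X Y Z W) \<longlonglongrightarrow> metric_domain.rm g x X Y Z W"
  unfolding metric_domain.rm_def[OF md] metric_domain.rm_def[OF md']
  by (intro tendsto_divide tendsto_diff tendsto_add lim_ddg tendsto_const tendsto_ip lim_ch lim0) simp

lemmas rm_lin = metric_domain.linear_rm_args[OF md x]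
lemmas rm_lin' = metric_domain.linear_rm_args[OF md' x]
lemmas nrm_lin = metric_domain.linear_nrm_args[OF md x]
lemmas nrm_lin' = metric_domain.linear_nrm_args[OF md' x]

lemma lim_rm:
  assumes "X \<longlonglongrightarrow> X'" "Y \<longlonglongrightarrow> Y'" "Z \<longlonglongrightarrow> Z'" "W \<longlonglongrightarrow> W'"
  shows "(\<lambda>m. metric_domain.rm (h m) x (X m) (Y m) (Z m) (W m)) \<longlonglongrightarrow> metric_domain.rm g x X' Y' Z' W'"
  by (rule tendsto_linear_field[OF rm_lin'(1) rm_lin(1) _ assms(1)],
      rule tendsto_linear_field[OF rm_lin'(2) rm_lin(2) _ assms(2)],
      rule tendsto_linear_field[OF rm_lin'(3) rm_lin(3) _ assms(3)],
      rule tendsto_linear_field[OF rm_lin'(4) rm_lin(4) _ assms(4)],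
      rule lim_rm_const)

lemma lim_nrm:
  assumes "k \<ge> 3" "M \<longlonglongrightarrow> M'" "X \<longlonglongrightarrow> X'" "Y \<longlonglongrightarrow> Y'" "Z \<longlonglongrightarrow> Z'" "W \<longlonglongrightarrow> W'"
  shows "(\<lambda>m. metric_domain.nrm (h m) x (M m) (X m) (Y m) (Z m) (W m)) \<longlonglongrightarrow> metric_domain.nrm g x M' X' Y' Z' W'"
proof -
  have "(\<lambda>m. metric_domain.nrm (h m) x M X Y Z W) \<longlonglongrightarrow> metric_domain.nrm g x M X Y Z W" for M X Y Z W
    unfolding metric_domain.nrm_explicit[OF md x] metric_domain.nrm_explicit[OF md' x]
    by (intro tendsto_divide tendsto_diff tendsto_add lim_dddg[OF assms(1)] tendsto_const lim_rm lim_ch lim_dc1 lim_dg) simp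
  then show ?thesis
  by - (rule tendsto_linear_field[OF nrm_lin'(1) nrm_lin(1) _ assms(2)],
      rule tendsto_linear_field[OF nrm_lin'(2) nrm_lin(2) _ assms(3)],
      rule tendsto_linear_field[OF nrm_lin'(3) nrm_lin(3) _ assms(4)],
      rule tendsto_linear_field[OF nrm_lin'(4) nrm_lin(4) _ assms(5)],
      rule tendsto_linear_field[OF nrm_lin'(5) nrm_lin(5) _ assms(6)])
qed

lemma lim_gsp: "X \<longlonglongrightarrow> X' \<Longrightarrow> u \<longlonglongrightarrow> u' \<Longrightarrow> (\<lambda>m. gsp (h m x) (u m) (X m)) \<longlonglongrightarrow> gsp (g x) u' X'"
  unfolding gsp_def by (intro tendsto_diff tendsto_scaleR tendsto_ip lim0)

lemma lim_gs:
  assumes "v \<longlonglongrightarrow> v'"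
  shows "(\<lambda>m. gs1 (h m x) (v m) X) \<longlonglongrightarrow> gs1 (g x) v' X" "(\<lambda>m. gs2 (h m x) (v m) X Y) \<longlonglongrightarrow> gs2 (g x) v' X Y"
    "(\<lambda>m. gs3 (h m x) (v m) X Y Z) \<longlonglongrightarrow> gs3 (g x) v' X Y Z"
  unfolding gs1_def gs2_def gs3_def by (intro lim_gsp assms tendsto_const)+

text \<open>Degeneracy is a system of equations that are continuous jointly in the jet and in the
  direction, hence closed in both together.\<close>

lemma degenerate_limit:
  assumes k3: "CARD('n) = 3 \<Longrightarrow> k \<ge> 3" and v: "v \<longlonglongrightarrow> v'" and d: "\<And>m. degenerate_at (h m) x (v m)"
  shows "degenerate_at g x v'"
  unfolding degenerate_at_def
proof (intro allI)
  fix X Y Z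
  have "(\<lambda>m. gs_obstruction (h m) x X Y Z (v m)) \<longlonglongrightarrow> gs_obstruction g x X Y Z v'"
  proof (cases "CARD('n) = 3")
    case True
    show ?thesis
      unfolding gs_obstruction_def obstruction_def if_P[OF True]
      by (intro tendsto_add tendsto_mult tendsto_ip lim0 v lim_gs lim_nrm[OF k3[OF True]])
  next
    case False
    show ?thesis
      unfolding gs_obstruction_def obstruction_def if_not_P[OF False]
      by (intro lim_rm lim_gs v)
  qed
  moreover have "(\<lambda>m. gs_obstruction (h m) x X Y Z (v m)) = (\<lambda>m. 0)" using d by (simp add: degenerate_at_def)
  ultimately show "gs_obstruction g x X Y Z v' = 0" using LIMSEQ_unique tendsto_const by metis
qed

end

section \<open>Smooth dependence of the obstruction on the direction\<close>

lemma smooth_ip_vectors: "smooth_on UNIV V \<Longrightarrow> smooth_on UNIV W \<Longrightarrow> smooth_on UNIV (\<lambda>v. ip G (V v) (W v))"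
  by (rule smooth_on_bilinear[OF open_UNIV bounded_bilinear_ip])

lemma smooth_gsp:
  assumes "smooth_on UNIV V" "smooth_on UNIV W"
  shows "smooth_on UNIV (\<lambda>v. gsp G (V v) (W v))"
  unfolding gsp_def
  by (rule smooth_on_diff[OF open_UNIV smooth_on_scaleR[OF open_UNIV smooth_ip_vectors[OF assms(1,1)] assms(2)]
      smooth_on_scaleR[OF open_UNIV smooth_ip_vectors[OF assms(2,1)] assms(1)]])

lemma smooth_gs:
  shows "smooth_on UNIV (\<lambda>v. gs1 G v X)" "smooth_on UNIV (\<lambda>v. gs2 G v X Y)" "smooth_on UNIV (\<lambda>v. gs3 G v X Y Z)"
proof -
  show s1: "smooth_on UNIV (\<lambda>v. gs1 G v X)"
    unfolding gs1_def by (rule smooth_gsp[OF smooth_on_ident smooth_on_const])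
  show s2: "smooth_on UNIV (\<lambda>v. gs2 G v X Y)"
    unfolding gs2_def by (rule smooth_gsp[OF s1 smooth_gsp[OF smooth_on_ident smooth_on_const]])
  show "smooth_on UNIV (\<lambda>v. gs3 G v X Y Z)"
    unfolding gs3_def by (rule smooth_gsp[OF s2 smooth_gsp[OF s1 smooth_gsp[OF smooth_on_ident smooth_on_const]]])
qed

lemma (in metric_domain) smooth_gs_obstruction:
  assumes x: "x \<in> S"
  shows "smooth_on UNIV (\<lambda>v. gs_obstruction g x X Y Z v)"
proof -
  note s1 = smooth_gs(1)[of "g x" X] and s2 = smooth_gs(2)[of "g x" X Y] and s3 = smooth_gs(3)[of "g x" X Y Z]
  note rl = linear_rm_args[OF x] and nl = linear_nrm_args[OF x]
  have srm: "smooth_on UNIV (\<lambda>v. rm x (X v) (Y v) (Z v) (W v))"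
    if "smooth_on UNIV X" "smooth_on UNIV Y" "smooth_on UNIV Z" "smooth_on UNIV W" for X Y Z and W :: "real^'n \<Rightarrow> real^'n"
    by (rule smooth_on_linear_field[OF open_UNIV rl(1) _ that(1)], rule smooth_on_linear_field[OF open_UNIV rl(2) _ that(2)],
      rule smooth_on_linear_field[OF open_UNIV rl(3) _ that(3)], rule smooth_on_linear_field[OF open_UNIV rl(4) _ that(4)],
      rule smooth_on_const)
  have snrm: "smooth_on UNIV (\<lambda>v. nrm x (M v) (X v) (Y v) (Z v) (W v))"
    if "smooth_on UNIV M" "smooth_on UNIV X" "smooth_on UNIV Y" "smooth_on UNIV Z" "smooth_on UNIV W" for M X Y Z and W :: "real^'n \<Rightarrow> real^'n"
    by (rule smooth_on_linear_field[OF open_UNIV nl(1) _ that(1)], rule smooth_on_linear_field[OF open_UNIV nl(2) _ that(2)],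
      rule smooth_on_linear_field[OF open_UNIV nl(3) _ that(3)], rule smooth_on_linear_field[OF open_UNIV nl(4) _ that(4)],
      rule smooth_on_linear_field[OF open_UNIV nl(5) _ that(5)], rule smooth_on_const)
  show ?thesis
  proof (cases "CARD('n) = 3")
    case True
    show ?thesis
      unfolding gs_obstruction_def obstruction_def if_P[OF True]
      by (rule smooth_on_add[OF open_UNIV smooth_on_mult[OF open_UNIV smooth_ip_vectors[OF smooth_on_ident smooth_on_ident] snrm[OF s2 s1 s2 s2 smooth_on_ident]]
          smooth_on_mult[OF open_UNIV smooth_ip_vectors[OF s2 s2] snrm[OF smooth_on_ident s1 smooth_on_ident s2 smooth_on_ident]]])
  next
    case False
    show ?thesis
      unfolding gs_obstruction_def obstruction_def if_not_P[OF False]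
      by (rule srm[OF s1 s2 s3 smooth_on_ident])
  qed
qed

section \<open>Perturbations with prescribed leading jet\<close>

text \<open>The powers of 1/t make the family closed under differentiation up to linear
  combinations; m = 0 is the classical flat function.\<close>

definition flat_exp :: "nat \<Rightarrow> real \<Rightarrow> real"
  where "flat_exp m t = (if t \<le> 0 then 0 else exp (- inverse t) * inverse t ^ m)"

lemma flat_exp_tendsto_0: "((\<lambda>t. exp (- inverse t) * inverse t ^ m) \<longlongrightarrow> 0) (at_right (0::real))"
proof -
  have "((\<lambda>y::real. y ^ m / exp y) \<longlongrightarrow> 0) at_top" by (rule tendsto_power_div_exp_0)
  then have "((\<lambda>t. inverse t ^ m / exp (inverse t)) \<longlongrightarrow> 0) (at_right (0::real))"
    by (rule filterlim_compose[OF _ filterlim_inverse_at_top_right])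
  then show ?thesis by (simp add: exp_minus divide_inverse mult.commute)
qed

lemma flat_exp_deriv:
  "(flat_exp m has_real_derivative flat_exp (m + 2) t - real m * flat_exp (m + 1) t) (at t)"
proof -
  consider "t < 0" | "t > 0" | "t = 0" by linarith
  then show ?thesis
  proof cases
    case 1
    have "((\<lambda>_. 0) has_real_derivative 0) (at t)" by simp
    then have "(flat_exp m has_real_derivative 0) (at t)"
      by (rule has_field_derivative_transform_within_open[of _ _ _ "{..<0}"]) (use 1 in \<open>auto simp: flat_exp_def\<close>)
    then show ?thesis using 1 by (simp add: flat_exp_def)
  next
    case 2
    have i: "(inverse has_real_derivative - (inverse t ^ 2)) (at t)"
      using DERIV_inverse[of t] 2 by (simp add: numeral_2_eq_2)
    have a: "((\<lambda>t. exp (- inverse t)) has_real_derivative exp (- inverse t) * inverse t ^ 2) (at t)"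
      using DERIV_chain'[OF DERIV_minus[OF i] DERIV_exp] by (simp add: mult.commute)
    have b: "((\<lambda>t. inverse t ^ m) has_real_derivative real m * (- (inverse t ^ 2) * inverse t ^ (m - 1))) (at t)"
      using DERIV_power[OF i, of m] by simp
    have bm: "real m * (- (inverse t ^ 2) * inverse t ^ (m - 1)) = - (real m * inverse t ^ (m + 1))"
      by (cases m) (simp_all add: power2_eq_square)
    have "((\<lambda>t. exp (- inverse t) * inverse t ^ m) has_real_derivative
        exp (- inverse t) * (- (real m * inverse t ^ (m + 1))) + exp (- inverse t) * inverse t ^ 2 * inverse t ^ m) (at t)"
      using DERIV_mult'[OF a b] unfolding bm .
    then have "(flat_exp m has_real_derivative
        exp (- inverse t) * (- (real m * inverse t ^ (m + 1))) + exp (- inverse t) * inverse t ^ 2 * inverse t ^ m) (at t)"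
      by (rule has_field_derivative_transform_within_open[of _ _ _ "{0<..}"]) (use 2 in \<open>auto simp: flat_exp_def\<close>)
    then show ?thesis using 2 by (simp add: flat_exp_def power2_eq_square algebra_simps)
  next
    case 3
    \<comment> \<open>From the right the difference quotient is exp(-1/h) / h^(m+1); from the left
      it is zero.\<close>
    have "((\<lambda>h. (flat_exp m (0 + h) - flat_exp m 0) / h) \<longlongrightarrow> 0) (at 0)"
      unfolding filterlim_at_split
    proof
      have "((\<lambda>_. 0) \<longlongrightarrow> (0::real)) (at_left (0::real))" by simp
      then show "((\<lambda>h. (flat_exp m (0 + h) - flat_exp m 0) / h) \<longlongrightarrow> 0) (at_left 0)"
        by (rule Lim_transform_eventually) (simp add: eventually_at_left_field flat_exp_def, rule exI[of _ "-1"], simp)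
      show "((\<lambda>h. (flat_exp m (0 + h) - flat_exp m 0) / h) \<longlongrightarrow> 0) (at_right 0)"
        by (rule Lim_transform_eventually[OF flat_exp_tendsto_0[of "Suc m"]])
          (simp add: eventually_at_right_field flat_exp_def divide_inverse, rule exI[of _ 1], simp)
    qed
    then show ?thesis using 3 by (simp add: DERIV_def flat_exp_def)
  qed
qed

lemma smooth_on_flat_exp:
  assumes "open S" "smooth_on S u"
  shows "smooth_on S (\<lambda>x. flat_exp m (u x))"
proof -
  have hd: "((\<lambda>x. flat_exp m (u x)) has_derivative
      (\<lambda>M. (flat_exp (m + 2) (u x) - real m * flat_exp (m + 1) (u x)) * ddir M u x)) (at x)" if "x \<in> S" for m x
    using diff_chain_at[OF differentiable_has_ddir[OF smooth_on_differentiable[OF assms(2,1) that]]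
      flat_exp_deriv[unfolded has_field_derivative_def]] by (simp add: o_def)
  show ?thesis
  proof (rule smooth_on_family[OF assms(1), of "\<lambda>m x. flat_exp m (u x)"])
    show "(\<lambda>x. flat_exp m (u x)) differentiable_on S" for m
      using differentiableI[OF hd] assms(1) by (simp add: differentiable_on_eq_differentiable_at)
    fix m j k assume k: "\<And>i. diffk k S (\<lambda>x. flat_exp i (u x))"
    have "diffk k S (\<lambda>x. (flat_exp (m + 2) (u x) + (- real m) * flat_exp (m + 1) (u x)) * partial_deriv j u x)"
    proof (rule diffk_bilinear[OF assms(1) bounded_bilinear_mult])
      show "diffk k S (\<lambda>x. flat_exp (m + 2) (u x) + (- real m) * flat_exp (m + 1) (u x))"
        by (rule diffk_add[OF assms(1) k diffk_bounded_linear[OF assms(1) bounded_linear_mult_right k]])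
      show "diffk k S (partial_deriv j u)" using smooth_on_partial[OF assms(2)] by (simp add: smooth_on_diffk)
    qed
    then show "diffk k S (partial_deriv j (\<lambda>x. flat_exp m (u x)))"
      by (rule diffk_eqI[OF assms(1)]) (simp add: partial_deriv_ddir ddir_has_derivative[OF hd])
  qed
qed

definition bump :: "real^'n \<Rightarrow> real \<Rightarrow> real^'n \<Rightarrow> real"
  where "bump x0 r x = flat_exp 0 (r\<^sup>2 - (x - x0) \<bullet> (x - x0))"

lemma smooth_bump: "smooth_on UNIV (bump x0 r)"
  unfolding bump_def
  by (rule smooth_on_flat_exp[OF open_UNIV smooth_on_diff[OF open_UNIV smooth_on_const
      smooth_on_inner[OF open_UNIV smooth_on_diff[OF open_UNIV smooth_on_ident smooth_on_const]
        smooth_on_diff[OF open_UNIV smooth_on_ident smooth_on_const]]]])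

lemma bump_center: "r > 0 \<Longrightarrow> bump x0 r x0 > 0"
  by (simp add: bump_def flat_exp_def)

lemma bump_outside: "r > 0 \<Longrightarrow> x \<notin> ball x0 r \<Longrightarrow> bump x0 r x = 0"
proof -
  assume "r > 0" "x \<notin> ball x0 r"
  then have "r \<le> norm (x - x0)" by (simp add: dist_norm norm_minus_commute)
  then have "r\<^sup>2 \<le> (x - x0) \<bullet> (x - x0)"
    using \<open>r > 0\<close> by (simp add: power_mono flip: power2_norm_eq_inner)
  then show "bump x0 r x = 0" by (simp add: bump_def flat_exp_def)
qed

text \<open>Leibniz rule for a factor that is affine and vanishes at \<open>x0\<close>. The third
  derivative is taken at \<open>x0\<close> only, where the terms that still contain this factor drop
  out.\<close>

lemma ddir_mult_lin:
  fixes u ul :: "real^'n \<Rightarrow> real"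
  assumes u: "smooth_on UNIV u"
    and ul_def: "ul = (\<lambda>x. u x * (w \<bullet> (x - x0)))"
  shows "smooth_on UNIV ul"
    and "ddir N ul = (\<lambda>x. u x * (w \<bullet> N) + ddir N u x * (w \<bullet> (x - x0)))"
    and "ddir M (ddir N ul) = (\<lambda>x. (w \<bullet> N) * ddir M u x + (w \<bullet> M) * ddir N u x + ddir M (ddir N u) x * (w \<bullet> (x - x0)))"
    and "ddir M (ddir N (ddir P ul)) x0 = (w \<bullet> P) * ddir M (ddir N u) x0 + (w \<bullet> N) * ddir M (ddir P u) x0
       + (w \<bullet> M) * ddir N (ddir P u) x0"
proof -
  let ?l = "\<lambda>x. w \<bullet> (x - x0)"
  have lsm: "smooth_on UNIV ?l"
    by (rule smooth_on_inner[OF open_UNIV smooth_on_const smooth_on_diff[OF open_UNIV smooth_on_ident smooth_on_const]])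
  have sm: "smooth_on UNIV f \<Longrightarrow> f differentiable (at x)" for f :: "real^'n \<Rightarrow> real" and x
    using smooth_on_differentiable by blast
  have dl: "ddir M ?l x = w \<bullet> M" for M x
    by (rule ddir_has_derivative) (auto intro!: derivative_eq_intros)
  show ulsm: "smooth_on UNIV ul" unfolding ul_def by (rule smooth_on_mult[OF open_UNIV u lsm])
  have A: "ddir N (\<lambda>x. f x * ?l x) x = f x * (w \<bullet> N) + ddir N f x * ?l x" if "smooth_on UNIV f" for f N x
    using ddir_mult[OF sm[OF that] sm[OF lsm]] by (simp add: dl)
  have C: "ddir N (\<lambda>x. c * f x) x = c * ddir N f x" if "smooth_on UNIV f" for f :: "real^'n \<Rightarrow> real" and c N x
    by (rule ddir_bounded_linear[OF bounded_linear_mult_right sm[OF that]])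
  have du: "smooth_on UNIV (ddir N u)" "smooth_on UNIV (ddir M (ddir N u))" for M N
    by (intro smooth_on_ddir open_UNIV u)+
  have cs: "smooth_on UNIV (\<lambda>x. c * f x)" "smooth_on UNIV (\<lambda>x. f x * c)" "smooth_on UNIV (\<lambda>x. f x * ?l x)" if "smooth_on UNIV f" for f :: "real^'n \<Rightarrow> real" and c
    by (rule smooth_on_mult[OF open_UNIV smooth_on_const that], rule smooth_on_mult[OF open_UNIV that smooth_on_const],
        rule smooth_on_mult[OF open_UNIV that lsm])
  show 1: "ddir N ul = (\<lambda>x. u x * (w \<bullet> N) + ddir N u x * ?l x)" for N
    unfolding ul_def by (rule ext) (rule A[OF u])
  have B: "ddir M (\<lambda>x. u x * (w \<bullet> N) + ddir N u x * ?l x) x =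
     ddir M (\<lambda>x. (w \<bullet> N) * u x) x + ddir M (\<lambda>x. ddir N u x * ?l x) x" for M N x
    unfolding mult.commute[of _ "w \<bullet> N"] by (rule ddir_add[OF sm[OF cs(1)[OF u]] sm[OF cs(3)[OF du(1)]]])
  show 2: "ddir M (ddir N ul) = (\<lambda>x. (w \<bullet> N) * ddir M u x + (w \<bullet> M) * ddir N u x + ddir M (ddir N u) x * ?l x)" for M N
    unfolding 1 by (rule ext) (simp only: B A[OF du(1)] C[OF u], simp add: algebra_simps)
  have "ddir M (\<lambda>x. (w \<bullet> P) * ddir N u x + (w \<bullet> N) * ddir P u x + ddir N (ddir P u) x * ?l x) x0
    = (w \<bullet> P) * ddir M (ddir N u) x0 + (w \<bullet> N) * ddir M (ddir P u) x0 + (w \<bullet> M) * ddir N (ddir P u) x0"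
    unfolding ddir_add[OF differentiable_add[OF sm[OF cs(1)[OF du(1)]] sm[OF cs(1)[OF du(1)]]] sm[OF cs(3)[OF du(2)]]]
      ddir_add[OF sm[OF cs(1)[OF du(1)]] sm[OF cs(1)[OF du(1)]]] C[OF du(1)] A[OF du(2)] by simp
  then show "ddir M (ddir N (ddir P ul)) x0 = (w \<bullet> P) * ddir M (ddir N u) x0 + (w \<bullet> N) * ddir M (ddir P u) x0
       + (w \<bullet> M) * ddir N (ddir P u) x0" unfolding 2 .
qed

lemma ddir_scaleR_const:
  fixes F :: "real^'n \<Rightarrow> real" and \<sigma> :: "'b::real_normed_vector"
  assumes "smooth_on UNIV F"
  shows "ddir M (\<lambda>x. F x *\<^sub>R \<sigma>) = (\<lambda>x. ddir M F x *\<^sub>R \<sigma>)"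
  by (rule ext, rule ddir_bounded_linear[OF bounded_linear_scaleR_left smooth_on_differentiable[OF assms]]) auto

lemma ddir_sum_scaleR:
  fixes h :: "'i \<Rightarrow> real^'n \<Rightarrow> 'b::real_normed_vector"
  assumes "\<And>a. smooth_on UNIV (h a)"
  shows "ddir M (\<lambda>x. \<Sum>a\<in>I. s a *\<^sub>R h a x) = (\<lambda>x. \<Sum>a\<in>I. s a *\<^sub>R ddir M (h a) x)"
proof
  fix x
  have d: "h a differentiable (at x)" for a using smooth_on_differentiable[OF assms] by blast
  show "ddir M (\<lambda>x. \<Sum>a\<in>I. s a *\<^sub>R h a x) x = (\<Sum>a\<in>I. s a *\<^sub>R ddir M (h a) x)"
    by (subst ddir_sum, rule differentiable_bounded_linear[OF bounded_linear_scaleR_right d])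
      (simp only: ddir_bounded_linear[OF bounded_linear_scaleR_right d])
qed

text \<open>\<open>princ\<close> is the part of the curvature tensor that is linear in the second derivatives \<open>D\<close> of the metric.\<close>

definition princ :: "(real^'n \<Rightarrow> real^'n \<Rightarrow> real^'n^'n) \<Rightarrow> real^'n \<Rightarrow> real^'n \<Rightarrow> real^'n \<Rightarrow> real^'n \<Rightarrow> real"
  where "princ D X Y Z W = (ip (D X Z) Y W - ip (D X W) Y Z - ip (D Y Z) X W + ip (D Y W) X Z) / 2"

definition leading_obstruction :: "real^'n^'n \<Rightarrow> (real^'n \<Rightarrow> real^'n^'n) \<Rightarrow> real^'n \<Rightarrow> real^'n \<Rightarrow> real^'n \<Rightarrow> real^'n \<Rightarrow> real^'n \<Rightarrow> real"
  where "leading_obstruction G H x X Y Z v = (if CARD('n) = 3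
    then ip G v v * princ (\<lambda>M N. ddir Y (ddir M (ddir N H)) x) X Y Y v + ip G Y Y * princ (\<lambda>M N. ddir v (ddir M (ddir N H)) x) X v Y v
    else princ (\<lambda>M N. ddir M (ddir N H) x) X Y Z v)"

text \<open>H leaves the lower-order jet at x unchanged, so Christoffel symbols and all nonlinear
  terms are those of g. The obstruction is therefore exactly affine in the perturbation, not just to
  first order.\<close>

lemma obstruction_perturbed:
  fixes g H :: "real^'n \<Rightarrow> real^'n^'n"
  assumes md: "metric_domain S g" and md': "metric_domain S (\<lambda>y. g y + H y)" and x: "x \<in> S" and H: "smooth_on UNIV H"
    and H0: "H x = 0" and H1: "\<And>M. ddir M H x = 0" and H2: "CARD('n) = 3 \<Longrightarrow> (\<And>M N. ddir M (ddir N H) x = 0)"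
  shows "obstruction (\<lambda>y. g y + H y) x X Y Z v = obstruction g x X Y Z v + leading_obstruction (g x) H x X Y Z v"
proof -
  let ?g = "\<lambda>y. g y + H y"
  note open_S = metric_domain.open_S[OF md]
  have dH: "H differentiable (at y)" "ddir M H differentiable (at y)" "ddir M (ddir N H) differentiable (at y)" for y M N
    using smooth_on_differentiable[OF H] smooth_on_differentiable[OF smooth_on_ddir[OF open_UNIV H]]
      smooth_on_differentiable[OF smooth_on_ddir[OF open_UNIV smooth_on_ddir[OF open_UNIV H]]] by auto
  have dg: "g differentiable (at y)" "ddir M g differentiable (at y)" "ddir M (ddir N g) differentiable (at y)" if "y \<in> S" for y M N
    using smooth_on_differentiable[OF metric_domain.smooth_g[OF md] open_S that]
      smooth_on_differentiable[OF smooth_on_ddir[OF open_S metric_domain.smooth_g[OF md]] open_S that]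
      smooth_on_differentiable[OF smooth_on_ddir[OF open_S smooth_on_ddir[OF open_S metric_domain.smooth_g[OF md]]] open_S that] by auto
  have 1: "ddir M ?g y = ddir M g y + ddir M H y" if "y \<in> S" for M y
    by (rule ddir_add[OF dg(1)[OF that] dH(1)])
  have 2: "ddir M (ddir N ?g) y = ddir M (ddir N g) y + ddir M (ddir N H) y" if "y \<in> S" for M N y
    using ddir_cong_open[OF open_S that 1] ddir_add[OF dg(2)[OF that] dH(2)] by simp
  have 3: "ddir M (ddir N (ddir P ?g)) x = ddir M (ddir N (ddir P g)) x + ddir M (ddir N (ddir P H)) x" for M N P
    using ddir_cong_open[OF open_S x 2] ddir_add[OF dg(3)[OF x] dH(3)] by simp
  have e0: "?g x = g x" by (simp add: H0)
  have edg: "metric_domain.dg ?g M x = metric_domain.dg g M x" for M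
    by (simp add: fun_eq_iff metric_domain.dg_def[OF md] metric_domain.dg_def[OF md'] 1[OF x] H1)
  have ec1: "metric_domain.c1 ?g x = metric_domain.c1 g x"
    by (simp add: fun_eq_iff metric_domain.c1_def[OF md] metric_domain.c1_def[OF md'] edg)
  have ech: "metric_domain.ch ?g x = metric_domain.ch g x"
    by (simp add: fun_eq_iff metric_domain.ch_def[OF md] metric_domain.ch_def[OF md']
        metric_domain.raise_def[OF md] metric_domain.raise_def[OF md'] ec1 e0)
  have eddg: "metric_domain.ddg ?g M N x X Y = metric_domain.ddg g M N x X Y + ip (ddir M (ddir N H) x) X Y" for M N X Y
    by (simp add: metric_domain.ddg_def[OF md] metric_domain.ddg_def[OF md'] 2[OF x] ip_simps)
  have erm: "metric_domain.rm ?g x X Y Z W = metric_domain.rm g x X Y Z W + princ (\<lambda>M N. ddir M (ddir N H) x) X Y Z W" for X Y Z W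
    unfolding metric_domain.rm_def[OF md] metric_domain.rm_def[OF md'] e0 ech eddg princ_def
    by (simp add: field_simps)
  show ?thesis
  proof (cases "CARD('n) = 3")
    case False
    then show ?thesis by (simp add: obstruction_def leading_obstruction_def erm)
  next
    case True
    note H2' = H2[OF True]
    have eddg': "metric_domain.ddg ?g M N x X Y = metric_domain.ddg g M N x X Y" for M N X Y
      by (simp add: eddg H2' ip_simps)
    have edc1: "metric_domain.dc1 ?g M x X Y Z = metric_domain.dc1 g M x X Y Z" for M X Y Z
      by (simp add: metric_domain.dc1_def[OF md] metric_domain.dc1_def[OF md'] eddg')
    have erm': "metric_domain.rm ?g x X Y Z W = metric_domain.rm g x X Y Z W" for X Y Z W
      by (simp add: erm princ_def H2' ip_simps)
    have edddg: "metric_domain.dddg ?g M N P x X Y = metric_domain.dddg g M N P x X Y + ip (ddir M (ddir N (ddir P H)) x) X Y" for M N P X Y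
      by (simp add: metric_domain.dddg_def[OF md] metric_domain.dddg_def[OF md'] 3 ip_simps)
    have enrm: "metric_domain.nrm ?g x M X Y Z W = metric_domain.nrm g x M X Y Z W
        + princ (\<lambda>N P. ddir M (ddir N (ddir P H)) x) X Y Z W" for M X Y Z W
      unfolding metric_domain.nrm_explicit[OF md x] metric_domain.nrm_explicit[OF md' x] ech edc1 erm' edg edddg princ_def
      by (simp add: field_simps)
    show ?thesis
      unfolding obstruction_def leading_obstruction_def if_P[OF True] enrm e0 by (simp add: algebra_simps)
  qed
qed

lemma leading_obstruction_sum:
  fixes h :: "'i \<Rightarrow> real^'n \<Rightarrow> real^'n^'n"
  assumes "\<And>a. smooth_on UNIV (h a)"
  shows "leading_obstruction G (\<lambda>x. \<Sum>a\<in>I. s a *\<^sub>R h a x) x X Y Z v = (\<Sum>a\<in>I. s a * leading_obstruction G (h a) x X Y Z v)"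
proof -
  have d: "smooth_on UNIV (ddir M (h a))" "smooth_on UNIV (ddir M (ddir N (h a)))" for M N a
    by (intro smooth_on_ddir open_UNIV assms)+
  have ips: "ip (\<Sum>a\<in>I. s a *\<^sub>R A a) X Y = (\<Sum>a\<in>I. s a * ip (A a) X Y)" for A X Y
    by (simp add: linear_sum[OF linear_ip(3)] ip_simps)
  have p: "princ (\<lambda>M N. \<Sum>a\<in>I. s a *\<^sub>R D a M N) X Y Z W = (\<Sum>a\<in>I. s a * princ (D a) X Y Z W)" for D X Y Z W
    by (simp add: princ_def ips sum_distrib_left sum_subtractf sum.distrib algebra_simps flip: sum_divide_distrib)
  show ?thesis
    unfolding leading_obstruction_def ddir_sum_scaleR[OF assms] ddir_sum_scaleR[OF d(1)] ddir_sum_scaleR[OF d(2)] p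
    by (simp add: sum_distrib_left sum.distrib algebra_simps)
qed

text \<open>Induction over the set of indices already treated, with the direction of
  \<open>v0\<close> placed at the prescribed index d before the induction starts.\<close>

lemma orthonormal_frame:
  fixes G :: "real^'n^'n"
  assumes sym: "\<And>X Y. ip G X Y = ip G Y X" and pos: "\<And>X. X \<noteq> 0 \<Longrightarrow> ip G X X > 0" and v0: "v0 \<noteq> 0"
  obtains e :: "'n \<Rightarrow> real^'n" and \<rho> where "\<And>i j. ip G (e i) (e j) = (if i = j then 1 else 0)" "\<rho> > 0" "v0 = \<rho> *\<^sub>R e d"
proof -
  define \<rho> where "\<rho> = sqrt (ip G v0 v0)"
  have rho: "\<rho> > 0" "\<rho> * \<rho> = ip G v0 v0" using pos[OF v0] by (simp_all add: \<rho>_def)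
  have "\<exists>e :: 'n \<Rightarrow> real^'n. v0 = \<rho> *\<^sub>R e d \<and> (\<forall>i\<in>insert d I. \<forall>j\<in>insert d I. ip G (e i) (e j) = (if i = j then 1 else 0))"
    if "finite I" for I
    using that
  proof (induction I rule: finite_induct)
    case empty
    show ?case
      by (rule exI[of _ "\<lambda>_. inverse \<rho> *\<^sub>R v0"]) (use rho(1) in \<open>simp add: ip_simps rho(2)[symmetric] field_simps\<close>)
  next
    case (insert i I)
    then obtain e where e: "v0 = \<rho> *\<^sub>R e d" "\<forall>i\<in>insert d I. \<forall>j\<in>insert d I. ip G (e i) (e j) = (if i = j then 1 else 0)"
      by blast
    show ?case
    proof (cases "i = d")
      case True
      then show ?thesis using e by (intro exI[of _ e]) simp
    next
      case False
      \<comment> \<open>Euclidean orthogonality to G e_j is orthogonality to e_j with respect to G;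
        fewer than n such vectors leave room for a nonzero u.\<close>
      define B where "B = (\<lambda>j. G *v e j) ` insert d I"
      have "dim B \<le> card B" using insert.hyps by (intro dim_le_card') (simp add: B_def)
      also have "\<dots> \<le> card (insert d I)" unfolding B_def using insert.hyps by (intro card_image_le) simp
      also have "\<dots> < CARD('n)"
        by (rule psubset_card_mono) (use False insert.hyps in auto)
      finally have "dim B < DIM(real^'n)" by simp
      then obtain u where u: "u \<noteq> 0" "\<And>y. y \<in> span B \<Longrightarrow> orthogonal u y"
        using orthogonal_to_subspace_exists by blast
      have o: "ip G u (e j) = 0" "ip G (e j) u = 0" if "j \<in> insert d I" for j
      proof -
        have "G *v e j \<in> span B" using that by (auto simp: B_def intro: span_base)
        then show "ip G u (e j) = 0" using u(2) by (simp add: ip_def orthogonal_def)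
        then show "ip G (e j) u = 0" by (simp add: sym)
      qed
      define q where "q = sqrt (ip G u u)"
      have q: "q > 0" "q * q = ip G u u" using pos[OF u(1)] by (simp_all add: q_def)
      let ?e = "e(i := inverse q *\<^sub>R u)"
      have "ip G (inverse q *\<^sub>R u) (inverse q *\<^sub>R u) = 1"
        using q(1) by (simp add: ip_simps q(2)[symmetric] field_simps)
      then have "\<forall>k\<in>insert d (insert i I). \<forall>j\<in>insert d (insert i I). ip G (?e k) (?e j) = (if k = j then 1 else 0)"
        using e(2) o insert.hyps(2) False by (auto simp: ip_simps)
      then show ?thesis using e(1) False by (intro exI[of _ ?e]) simp
    qed
  qed
  from this[OF finite[of UNIV]] that rho(1) show thesis by (auto simp: insert_UNIV)
qed

section \<open>Perturbation tensors: bump times linear forms times a symmetrised product of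
  covectors\<close>

definition sg :: "real^'n \<Rightarrow> real^'n \<Rightarrow> real^'n^'n"
  where "sg w w' = (\<chi> r c. (w $ r * w' $ c + w' $ r * w $ c) / 2)"

lemma ip_sg:
  fixes w w' X Y :: "real^'n"
  shows "ip (sg w w') X Y = ((w \<bullet> X) * (w' \<bullet> Y) + (w' \<bullet> X) * (w \<bullet> Y)) / 2"
proof -
  have p: "(\<Sum>i\<in>UNIV. \<Sum>j\<in>UNIV. (a $ i * X $ i) * (b $ j * Y $ j)) = (a \<bullet> X) * (b \<bullet> Y)" for a b :: "real^'n"
    by (simp add: inner_vec_def sum_product)
  have "ip (sg w w') X Y = (\<Sum>i\<in>UNIV. \<Sum>j\<in>UNIV. ((w $ i * X $ i) * (w' $ j * Y $ j) + (w' $ i * X $ i) * (w $ j * Y $ j)) / 2)"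
    unfolding ip_sum sg_def by (intro sum.cong refl) (simp add: field_simps)
  also have "\<dots> = ((w \<bullet> X) * (w' \<bullet> Y) + (w' \<bullet> X) * (w \<bullet> Y)) / 2"
    by (simp only: sum_divide_distrib[symmetric] sum.distrib p)
  finally show ?thesis .
qed

lemma transpose_sg: "transpose (sg w w') = sg w w'"
  by (simp add: sg_def transpose_def vec_eq_iff algebra_simps)

text \<open>Each linear form raises the order of vanishing at \<open>x0\<close> by one. The leading
  jet is the symmetrised product of the forms, and the bump enters it only through its value at
  \<open>x0\<close>.\<close>

definition poly_bump :: "real^'n \<Rightarrow> real \<Rightarrow> (real^'n) list \<Rightarrow> real^'n \<Rightarrow> real"
  where "poly_bump x0 r ws = foldr (\<lambda>w u x. u x * (w \<bullet> (x - x0))) ws (bump x0 r)"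

lemma poly_bump_simps: "poly_bump x0 r [] = bump x0 r"
  "poly_bump x0 r (w # ws) = (\<lambda>x. poly_bump x0 r ws x * (w \<bullet> (x - x0)))"
  by (simp_all add: poly_bump_def)

lemma smooth_poly_bump: "smooth_on UNIV (poly_bump x0 r ws)"
  by (induction ws) (simp_all add: poly_bump_simps(1) smooth_bump ddir_mult_lin(1)[OF _ poly_bump_simps(2)])

lemma poly_bump_outside: "r > 0 \<Longrightarrow> x \<notin> ball x0 r \<Longrightarrow> poly_bump x0 r ws x = 0"
  by (induction ws) (simp_all add: poly_bump_simps bump_outside)

lemma poly_bump_jets:
  shows "poly_bump x0 r (w # ws) x0 = 0"
    and "ddir M (poly_bump x0 r [w]) x0 = bump x0 r x0 * (w \<bullet> M)"
    and "ddir M (poly_bump x0 r (w # w' # ws)) x0 = 0"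
    and "ddir M (ddir N (poly_bump x0 r [w, w'])) x0 = bump x0 r x0 * ((w \<bullet> M) * (w' \<bullet> N) + (w \<bullet> N) * (w' \<bullet> M))"
    and "ddir M (ddir N (poly_bump x0 r [w, w', w''])) x0 = 0"
    and "ddir P (ddir M (ddir N (poly_bump x0 r [w'', w, w']))) x0 = bump x0 r x0 * (
      (w'' \<bullet> P) * ((w \<bullet> M) * (w' \<bullet> N) + (w \<bullet> N) * (w' \<bullet> M)) + (w'' \<bullet> M) * ((w \<bullet> P) * (w' \<bullet> N) + (w \<bullet> N) * (w' \<bullet> P))
      + (w'' \<bullet> N) * ((w \<bullet> P) * (w' \<bullet> M) + (w \<bullet> M) * (w' \<bullet> P)))"
proof -
  note D = ddir_mult_lin[OF smooth_poly_bump poly_bump_simps(2)]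
  show 0: "poly_bump x0 r (w # ws) x0 = 0" for w ws by (simp add: poly_bump_simps)
  show 1: "ddir M (poly_bump x0 r [w]) x0 = bump x0 r x0 * (w \<bullet> M)" for M w
    by (simp add: D(2) poly_bump_simps(1))
  show 2: "ddir M (poly_bump x0 r (w # w' # ws)) x0 = 0" for M w w' ws
    by (simp add: D(2) 0)
  show 3: "ddir M (ddir N (poly_bump x0 r [w, w'])) x0 = bump x0 r x0 * ((w \<bullet> M) * (w' \<bullet> N) + (w \<bullet> N) * (w' \<bullet> M))" for M N w w'
    by (simp add: D(3) 1 algebra_simps)
  show 4: "ddir M (ddir N (poly_bump x0 r [w, w', w''])) x0 = 0" for M N w w' w''
    by (simp add: D(3) 2)
  show "ddir P (ddir M (ddir N (poly_bump x0 r [w'', w, w']))) x0 = bump x0 r x0 * (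
      (w'' \<bullet> P) * ((w \<bullet> M) * (w' \<bullet> N) + (w \<bullet> N) * (w' \<bullet> M)) + (w'' \<bullet> M) * ((w \<bullet> P) * (w' \<bullet> N) + (w \<bullet> N) * (w' \<bullet> P))
      + (w'' \<bullet> N) * ((w \<bullet> P) * (w' \<bullet> M) + (w \<bullet> M) * (w' \<bullet> P)))"
    unfolding D(4) 3 by (simp add: algebra_simps)
qed

definition pbump :: "real^'n \<Rightarrow> real \<Rightarrow> (real^'n) list \<Rightarrow> real^'n^'n \<Rightarrow> real^'n \<Rightarrow> real^'n^'n"
  where "pbump x0 r ws \<sigma> = (\<lambda>x. poly_bump x0 r ws x *\<^sub>R \<sigma>)"

lemma smooth_pbump: "smooth_on UNIV (pbump x0 r ws \<sigma>)"
  unfolding pbump_def by (rule smooth_on_scaleR[OF open_UNIV smooth_poly_bump smooth_on_const])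

lemma pbump_outside: "r > 0 \<Longrightarrow> x \<notin> ball x0 r \<Longrightarrow> pbump x0 r ws \<sigma> x = 0"
  by (simp add: pbump_def poly_bump_outside)

lemma ddir_pbump:
  "ddir M (pbump x0 r ws \<sigma>) = (\<lambda>x. ddir M (poly_bump x0 r ws) x *\<^sub>R \<sigma>)"
  "ddir M (ddir N (pbump x0 r ws \<sigma>)) = (\<lambda>x. ddir M (ddir N (poly_bump x0 r ws)) x *\<^sub>R \<sigma>)"
  "ddir M (ddir N (ddir P (pbump x0 r ws \<sigma>))) = (\<lambda>x. ddir M (ddir N (ddir P (poly_bump x0 r ws))) x *\<^sub>R \<sigma>)"
proof -
  note s = smooth_poly_bump[of x0 r ws]
  note s1 = smooth_on_ddir[OF open_UNIV s]
  note s2 = smooth_on_ddir[OF open_UNIV s1]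
  show 1: "ddir M (pbump x0 r ws \<sigma>) = (\<lambda>x. ddir M (poly_bump x0 r ws) x *\<^sub>R \<sigma>)" for M
    unfolding pbump_def by (rule ddir_scaleR_const[OF s])
  show 2: "ddir M (ddir N (pbump x0 r ws \<sigma>)) = (\<lambda>x. ddir M (ddir N (poly_bump x0 r ws)) x *\<^sub>R \<sigma>)" for M N
    unfolding 1 by (rule ddir_scaleR_const[OF s1])
  show "ddir M (ddir N (ddir P (pbump x0 r ws \<sigma>))) = (\<lambda>x. ddir M (ddir N (ddir P (poly_bump x0 r ws))) x *\<^sub>R \<sigma>)"
    unfolding 2 by (rule ddir_scaleR_const[OF s2])
qed

text \<open>Up to the bump value, \<open>qq\<close> and \<open>q3\<close> are the second and third
  derivatives at the centre of a product of two or three linear forms, \<open>ss\<close> is the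
  bilinear form of \<open>sg w w'\<close>, and \<open>pr4\<close> is the linearised curvature for a
  metric perturbation with second derivatives q times s. With these, leading obstructions become
  finite computations on a frame.\<close>

definition "qq w1 w2 M N = (w1 \<bullet> M) * (w2 \<bullet> N) + (w1 \<bullet> N) * (w2 \<bullet> (M::real^'n))"
definition "ss w w' X Y = ((w \<bullet> X) * (w' \<bullet> Y) + (w' \<bullet> X) * (w \<bullet> Y)) * (1/2 :: real)" for w :: "real^'n"
definition "pr4 q s X Y Z W = (q X Z * s Y W - q X W * s Y Z - q Y Z * s X W + q Y W * s X Z) * (1/2 :: real)" for X :: "real^'n"
definition "q3 w'' w w' P M N = (w'' \<bullet> P) * qq w w' M N + (w'' \<bullet> M) * qq w w' P N + (w'' \<bullet> N) * qq w w' P (M::real^'n)"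

lemma leading_obstruction_4:
  fixes X :: "real^'n"
  assumes "CARD('n) \<noteq> 3"
  shows "leading_obstruction G (pbump x0 r [w1, w2] (sg w w')) x0 X Y Z v = bump x0 r x0 * pr4 (qq w1 w2) (ss w w') X Y Z v"
proof -
  have e: "ip (ddir M (ddir N (pbump x0 r [w1, w2] (sg w w'))) x0) A B = bump x0 r x0 * (qq w1 w2 M N * ss w w' A B)" for M N A B
    unfolding ddir_pbump(2) poly_bump_jets(4) ip_simps ip_sg by (simp add: qq_def ss_def)
  show ?thesis
    unfolding leading_obstruction_def if_not_P[OF assms] princ_def e pr4_def by (simp add: field_simps)
qed

lemma leading_obstruction_3:
  fixes X :: "real^'n"
  assumes "CARD('n) = 3"
  shows "leading_obstruction G (pbump x0 r [w1, w2, w3] (sg w w')) x0 X Y Z v = bump x0 r x0 *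
    (ip G v v * pr4 (q3 w1 w2 w3 Y) (ss w w') X Y Y v + ip G Y Y * pr4 (q3 w1 w2 w3 v) (ss w w') X v Y v)"
proof -
  have e: "ip (ddir P (ddir M (ddir N (pbump x0 r [w1, w2, w3] (sg w w')))) x0) A B = bump x0 r x0 * (q3 w1 w2 w3 P M N * ss w w' A B)" for P M N A B
    unfolding ddir_pbump(3) poly_bump_jets(6) ip_simps ip_sg by (simp add: q3_def qq_def ss_def)
  show ?thesis
    unfolding leading_obstruction_def if_P[OF assms] princ_def e pr4_def by (simp add: field_simps)
qed

text \<open>The number of linear forms equals the order of the highest derivative in the
  obstruction: every lower derivative of h vanishes at the centre.\<close>

definition perturbation :: "real^'n \<Rightarrow> real \<Rightarrow> (real^'n \<Rightarrow> real^'n^'n) \<Rightarrow> bool"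
  where "perturbation x0 r h \<longleftrightarrow> (\<exists>w1 w2 w3 w w'.
    h = pbump x0 r (if CARD('n) = 3 then [w1, w2, w3] else [w1, w2]) (sg w w'))"

lemma perturbationI:
  fixes w1 :: "real^'n"
  shows "CARD('n) = 3 \<Longrightarrow> perturbation x0 r (pbump x0 r [w1, w2, w3] (sg w w'))"
    and "CARD('n) \<noteq> 3 \<Longrightarrow> perturbation x0 r (pbump x0 r [w1, w2] (sg w w'))"
  unfolding perturbation_def
  by (rule exI[of _ w1], rule exI[of _ w2], rule exI[of _ w3], rule exI[of _ w], rule exI[of _ w'], simp)+

lemma perturbationE:
  assumes "perturbation x0 r (h :: real^'n \<Rightarrow> real^'n^'n)"
  obtains w1 w2 w3 w w' where "CARD('n) = 3" "h = pbump x0 r [w1, w2, w3] (sg w w')"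
  | w1 w2 w w' where "CARD('n) \<noteq> 3" "h = pbump x0 r [w1, w2] (sg w w')"
  using assms unfolding perturbation_def by (cases "CARD('n) = 3") auto

lemma perturbation_jet:
  assumes "perturbation x0 r (h :: real^'n \<Rightarrow> real^'n^'n)"
  shows "h x0 = 0" "ddir M h x0 = 0" "CARD('n) = 3 \<Longrightarrow> ddir M (ddir N h) x0 = 0"
proof -
  show "h x0 = 0"
    using assms by (cases rule: perturbationE) (simp_all add: pbump_def poly_bump_jets(1))
  show "ddir M h x0 = 0"
    using assms by (cases rule: perturbationE) (simp_all add: ddir_pbump(1) poly_bump_jets(3))
  show "ddir M (ddir N h) x0 = 0" if "CARD('n) = 3"
    using assms by (cases rule: perturbationE) (simp_all add: that ddir_pbump(2) poly_bump_jets(5))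
qed

lemma perturbation_basic:
  assumes "perturbation x0 r h"
  shows "smooth_on UNIV h" "transpose (h x) = h x" "r > 0 \<Longrightarrow> x \<notin> ball x0 r \<Longrightarrow> h x = 0"
  using assms unfolding perturbation_def
  by (auto simp: smooth_pbump pbump_outside) (simp_all add: pbump_def transpose_scalar transpose_sg)

text \<open>The same degrees as in \<open>obstruction_scale\<close>; it strips the factors that
  Gram-Schmidt without denominators introduces.\<close>

lemma leading_obstruction_scale:
  fixes X :: "real^'n"
  assumes "perturbation x0 r h"
  shows "leading_obstruction G h x0 (a *\<^sub>R X) (b *\<^sub>R Y) (c *\<^sub>R Z) (d *\<^sub>R v) =
   (if CARD('n) = 3 then a * b ^ 3 * d ^ 3 else a * b * c * d) * leading_obstruction G h x0 X Y Z v"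
  using assms
proof (cases rule: perturbationE)
  case (1 w1 w2 w3 w w')
  have q: "q3 w1 w2 w3 (a *\<^sub>R P) (b *\<^sub>R M) (c *\<^sub>R N) = a * b * c * q3 w1 w2 w3 P M N" for a b c P M N
    by (simp add: q3_def qq_def algebra_simps)
  have s: "ss w w' (a *\<^sub>R M) (b *\<^sub>R N) = a * b * ss w w' M N" for a b M N
    by (simp add: ss_def algebra_simps)
  show ?thesis
    unfolding 1(2) leading_obstruction_3[OF 1(1)] if_P[OF 1(1)] pr4_def q s ip_simps
    by (simp add: power3_eq_cube algebra_simps)
next
  case (2 w1 w2 w w')
  have q: "qq w1 w2 (b *\<^sub>R M) (c *\<^sub>R N) = b * c * qq w1 w2 M N" for b c M N
    by (simp add: qq_def algebra_simps)
  have s: "ss w w' (a *\<^sub>R M) (b *\<^sub>R N) = a * b * ss w w' M N" for a b M N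
    by (simp add: ss_def algebra_simps)
  show ?thesis
    unfolding 2(2) leading_obstruction_4[OF 2(1)] if_not_P[OF 2(1)] pr4_def q s
    by (simp add: algebra_simps)
qed

definition gs_leading :: "real^'n^'n \<Rightarrow> (real^'n \<Rightarrow> real^'n^'n) \<Rightarrow> real^'n \<Rightarrow> real^'n \<Rightarrow> real^'n \<Rightarrow> real^'n \<Rightarrow> real^'n \<Rightarrow> real"
  where "gs_leading G H x X Y Z v = leading_obstruction G H x (gs1 G v X) (gs2 G v X Y) (gs3 G v X Y Z) v"

lemma smooth_gs_leading:
  fixes X Y Z :: "real^'n"
  assumes "perturbation x0 r h"
  shows "smooth_on UNIV (gs_leading G h x0 X Y Z)"
proof -
  have si: "smooth_on UNIV (\<lambda>v. w \<bullet> V v)" if "smooth_on UNIV V" for w and V :: "real^'n \<Rightarrow> real^'n"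
    by (rule smooth_on_inner[OF open_UNIV smooth_on_const that])
  note mult = smooth_on_mult[OF open_UNIV] and add = smooth_on_add[OF open_UNIV] and diff = smooth_on_diff[OF open_UNIV]
  have sq: "smooth_on UNIV (\<lambda>v. qq w w' (V v) (W v))" if "smooth_on UNIV V" "smooth_on UNIV W" for w w' V and W :: "real^'n \<Rightarrow> real^'n"
    unfolding qq_def by (rule add[OF mult[OF si[OF that(1)] si[OF that(2)]] mult[OF si[OF that(2)] si[OF that(1)]]])
  have ssm: "smooth_on UNIV (\<lambda>v. ss w w' (V v) (W v))" if "smooth_on UNIV V" "smooth_on UNIV W" for w w' V and W :: "real^'n \<Rightarrow> real^'n"
    unfolding ss_def by (rule mult[OF add[OF mult[OF si[OF that(1)] si[OF that(2)]] mult[OF si[OF that(1)] si[OF that(2)]]] smooth_on_const])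
  have sq3: "smooth_on UNIV (\<lambda>v. q3 w'' w w' (P v) (V v) (W v))" if "smooth_on UNIV P" "smooth_on UNIV V" "smooth_on UNIV W" for w'' w w' P V and W :: "real^'n \<Rightarrow> real^'n"
    unfolding q3_def
    by (rule add[OF add[OF mult[OF si[OF that(1)] sq[OF that(2,3)]] mult[OF si[OF that(2)] sq[OF that(1,3)]]] mult[OF si[OF that(3)] sq[OF that(1,2)]]])
  have sp: "smooth_on UNIV (\<lambda>v. pr4 (q v) s (X v) (Y v) (Z v) (W v))"
    if q: "\<And>V W. smooth_on UNIV V \<Longrightarrow> smooth_on UNIV W \<Longrightarrow> smooth_on UNIV (\<lambda>v. q v (V v) (W v))"
      and s: "\<And>(V :: real^'n \<Rightarrow> real^'n) W. smooth_on UNIV V \<Longrightarrow> smooth_on UNIV W \<Longrightarrow> smooth_on UNIV (\<lambda>v. s (V v) (W v))"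
      and "smooth_on UNIV X" "smooth_on UNIV Y" "smooth_on UNIV Z" "smooth_on UNIV W"
    for q :: "real^'n \<Rightarrow> real^'n \<Rightarrow> real^'n \<Rightarrow> real" and s :: "real^'n \<Rightarrow> real^'n \<Rightarrow> real" and X Y Z W :: "real^'n \<Rightarrow> real^'n"
    unfolding pr4_def using that(3-)
    by (intro mult[OF add[OF diff[OF diff[OF mult[OF q s] mult[OF q s]] mult[OF q s]] mult[OF q s]] smooth_on_const])
  note g1 = smooth_gs(1)[of G X] and g2 = smooth_gs(2)[of G X Y] and g3 = smooth_gs(3)[of G X Y Z]
  have "smooth_on UNIV (\<lambda>v. leading_obstruction G h x0 (gs1 G v X) (gs2 G v X Y) (gs3 G v X Y Z) v)"
    using assms
  proof (cases rule: perturbationE)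
    case 1
    show ?thesis
      unfolding 1(2) leading_obstruction_3[OF 1(1)]
      by (rule mult[OF smooth_on_const add[OF mult[OF smooth_ip_vectors[OF smooth_on_ident smooth_on_ident] sp[OF sq3[OF g2] ssm g1 g2 g2 smooth_on_ident]]
           mult[OF smooth_ip_vectors[OF g2 g2] sp[OF sq3[OF smooth_on_ident] ssm g1 smooth_on_ident g2 smooth_on_ident]]]])
  next
    case 2
    show ?thesis
      unfolding 2(2) leading_obstruction_4[OF 2(1)]
      by (rule mult[OF smooth_on_const sp[OF sq ssm g1 g2 g3 smooth_on_ident]])
  qed
  then show ?thesis by (simp add: gs_leading_def[abs_def])
qed

section \<open>Independence of the leading obstructions\<close>

lemma sum_single: "(\<And>b. b \<noteq> j \<Longrightarrow> f b = 0) \<Longrightarrow> (\<Sum>b\<in>UNIV. f b) = (f j :: real)" for f :: "'n::finite \<Rightarrow> real"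
  by (subst sum.remove[of _ j]) auto

text \<open>On vectors that are already orthogonal each projection only rescales. The exponents of
  \<rho> arise as 2, then 2 * 2 + 2 = 6, then 2 * 6 + 6 = 18.\<close>

lemma gs_at_frame:
  fixes G :: "real^'n^'n"
  assumes sym: "\<And>X Y. ip G X Y = ip G Y X" and ee: "ip G e e = 1"
    and o: "ip G X e = 0" "ip G Y e = 0" "ip G Z e = 0" "ip G X Y = 0" "ip G X Z = 0" "ip G Y Z = 0"
  shows "gs1 G (\<rho> *\<^sub>R e) X = (\<rho>\<^sup>2) *\<^sub>R X" (is ?g1)
    and "gs2 G (\<rho> *\<^sub>R e) X Y = (\<rho> ^ 6 * ip G X X) *\<^sub>R Y" (is ?g2)
    and "gs3 G (\<rho> *\<^sub>R e) X Y Z = (\<rho> ^ 18 * ip G X X ^ 3 * ip G Y Y) *\<^sub>R Z" (is ?g3)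
proof -
  have p: "gsp G (\<rho> *\<^sub>R e) V = (\<rho>\<^sup>2) *\<^sub>R V" if "ip G V e = 0" for V
    using that ee by (simp add: gsp_def ip_simps power2_eq_square)
  show 1: ?g1 by (simp add: gs1_def p o)
  have q: "gsp G (c *\<^sub>R U) (a *\<^sub>R V) = (c\<^sup>2 * ip G U U * a) *\<^sub>R V" if "ip G V U = 0" for U V a c
    using that by (simp add: gsp_def ip_simps power2_eq_square)
  have o': "ip G Y X = 0" "ip G Z X = 0" "ip G Z Y = 0" using o by (simp_all add: sym)
  show 2: ?g2
    unfolding gs2_def 1 p[OF o(2)] q[OF o'(1)] by (simp add: algebra_simps flip: power_mult power_add)
  show ?g3
    unfolding gs3_def 1 2 p[OF o(3)] q[OF o'(2)] q[OF o'(3)]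
    by (rule arg_cong[of _ _ "\<lambda>c. c *\<^sub>R Z"]) (simp add: power_mult_distrib power2_eq_square power3_eq_cube algebra_simps eval_nat_numeral)
qed

text \<open>The choices make the matrix of leading obstructions triangular, with the index \<open>d\<close> ordered last
  in dimension 3 and first otherwise.\<close>

lemma perturbation_family_frame:
  fixes G :: "real^'n^'n" and e :: "'n \<Rightarrow> real^'n"
  assumes e: "\<And>i j. ip G (e i) (e j) = (if i = j then 1 else 0)" and card: "CARD('n) \<ge> 3" and r: "r > 0"
  shows "\<exists>(h :: 'n \<Rightarrow> real^'n \<Rightarrow> real^'n^'n) (x :: 'n \<Rightarrow> real^'n) y z. (\<forall>b. perturbation x0 r (h b)) \<and>
    (\<forall>a. ip G (x a) (e d) = 0 \<and> ip G (y a) (e d) = 0 \<and> ip G (z a) (e d) = 0 \<and>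
      ip G (x a) (y a) = 0 \<and> ip G (x a) (z a) = 0 \<and> ip G (y a) (z a) = 0 \<and> ip G (x a) (x a) > 0 \<and> ip G (y a) (y a) > 0) \<and>
    (\<forall>s. (\<forall>a. (\<Sum>b\<in>UNIV. s b * leading_obstruction G (h b) x0 (x a) (y a) (z a) (e d)) = 0) \<longrightarrow> (\<forall>b. s b = 0))"
proof -
  define w where "w = (\<lambda>i. transpose G *v e i)"
  have hw: "w i \<bullet> e j = (if i = j then 1 else 0)" for i j
  proof -
    have "w i \<bullet> e j = ip G (e i) (e j)"
      by (simp add: w_def ip_def dot_lmul_matrix[symmetric])
    then show ?thesis using e by simp
  qed
  let ?k = "bump x0 r x0"
  have k: "?k > 0" using bump_center[OF r] .
  note calc = hw e ip_simps inner_add_right inner_diff_right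
  show ?thesis
  proof (cases "CARD('n) = 3")
    case True
    then obtain p q where pq: "p \<noteq> d" "q \<noteq> d" "p \<noteq> q" and U: "(UNIV :: 'n set) = {d, p, q}"
    proof -
      have "card (UNIV - {d}) = 2" using True by (simp add: card_Diff_singleton)
      then obtain p q where "UNIV - {d} = {p, q}" "p \<noteq> q" unfolding card_2_iff by blast
      then show thesis by (intro that[of p q]) auto
    qed
    \<comment> \<open>The pairs (e p, e q) and (e q, e p) give only two conditions, but three are
      needed; the third comes from the frame rotated by 45 degrees. Each tensor leaves one surviving
      term in its own row: s(Y, Y) for the rows p and q, s(v, v) for the row d, where s is the
      symmetric factor.\<close>
    define ws where "ws = (\<lambda>b. if b = d then [w p, w p, w d] else [w p, w q, w d])"
    define s1 where "s1 = (\<lambda>b. if b = d then w d else if b = p then w q else w p)"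
    define x where "x = (\<lambda>b. if b = d then e p + e q else if b = p then e p else e q)"
    define y where "y = (\<lambda>b. if b = d then e p - e q else if b = p then e q else e p)"
    have cases: "b = d \<or> b = p \<or> b = q" for b using U by (metis UNIV_I empty_iff insert_iff)
    define h where "h = (\<lambda>b. pbump x0 r (ws b) (sg (s1 b) (s1 b)))"
    show ?thesis
    proof (rule exI[of _ h], rule exI[of _ x], rule exI[of _ y], rule exI[of _ "\<lambda>_. 0"], intro conjI allI impI)
      show "perturbation x0 r (h b)" for b using True by (simp add: h_def ws_def perturbationI)
      show "ip G (x a) (e d) = 0" "ip G (y a) (e d) = 0" "ip G 0 (e d) = 0" "ip G (x a) (y a) = 0"
        "ip G (x a) 0 = 0" "ip G (y a) 0 = 0" "ip G (x a) (x a) > 0" "ip G (y a) (y a) > 0" for a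
        using pq by (auto simp: x_def y_def calc)
      fix s b
      let ?m = "\<lambda>a b. leading_obstruction G (h b) x0 (x a) (y a) 0 (e d)"
      assume s: "\<forall>a. (\<Sum>b\<in>UNIV. s b * ?m a b) = 0"
      have m0: "?m a b = 0" if "a \<noteq> d" "b \<noteq> a" for a b
        using cases[of a] cases[of b] that pq
        by (auto simp: h_def ws_def s1_def x_def y_def leading_obstruction_3[OF True] pr4_def q3_def qq_def ss_def calc)
      have md: "?m a a \<noteq> 0" for a
        using cases[of a] pq k
        by (auto simp: h_def ws_def s1_def x_def y_def leading_obstruction_3[OF True] pr4_def q3_def qq_def ss_def calc)
      have sa: "s a = 0" if "a \<noteq> d" for a
        using s[rule_format, of a] sum_single[of a "\<lambda>b. s b * ?m a b"] m0[OF that] md[of a] by simp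
      have "s d = 0"
        using s[rule_format, of d] sum_single[of d "\<lambda>b. s b * ?m d b"] sa md[of d] by simp
      then show "s b = 0" using sa by (cases "b = d") auto
    qed
  next
    case False
    then have c4: "CARD('n) \<ge> 4" using card by simp
    have "3 \<le> card (UNIV - {d})" using c4 by (simp add: card_Diff_singleton)
    then obtain A where A: "A \<subseteq> UNIV - {d}" "card A = 3" using obtain_subset_with_card_n by metis
    then obtain a1 a2 a3 where a: "a1 \<noteq> d" "a2 \<noteq> d" "a3 \<noteq> d" "a1 \<noteq> a2" "a1 \<noteq> a3" "a2 \<noteq> a3"
      by (auto simp: card_3_iff)
    \<comment> \<open>Here dimension at least 4 enters: besides d and j there are two more
      indices.\<close>
    have "\<exists>i k. i \<noteq> d \<and> k \<noteq> d \<and> i \<noteq> j \<and> k \<noteq> j \<and> i \<noteq> k" for j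
    proof -
      have "card {d, j} \<le> 2" by (simp add: card_insert_if)
      then have "2 \<le> card (UNIV - {d, j})" using c4 by (subst card_Diff_subset) auto
      then obtain B where "B \<subseteq> UNIV - {d, j}" "card B = 2" using obtain_subset_with_card_n by metis
      then show ?thesis by (auto simp: card_2_iff)
    qed
    then obtain I K where IK: "\<And>j. I j \<noteq> d" "\<And>j. K j \<noteq> d" "\<And>j. I j \<noteq> j" "\<And>j. K j \<noteq> j" "\<And>j. I j \<noteq> K j"
      by metis
    \<comment> \<open>The term to survive is q(Y, v) s(X, Z): the linear forms detect Y and v, the
      symmetric factor X and Z. For b other than d, X and Z are sum and difference of two frame
      vectors, so that s can be a square; the row d does not see a square, because its X, Y and Z
      are distinct frame vectors.\<close>
    define ws where "ws = (\<lambda>b. if b = d then [w a2, w d] else [w b, w d])"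
    define s1 where "s1 = (\<lambda>b. if b = d then w a1 else w (I b))"
    define s2 where "s2 = (\<lambda>b. if b = d then w a3 else w (I b))"
    define x where "x = (\<lambda>b. if b = d then e a1 else e (I b) + e (K b))"
    define y where "y = (\<lambda>b. if b = d then e a2 else e b)"
    define z where "z = (\<lambda>b. if b = d then e a3 else e (I b) - e (K b))"
    note ne = a IK a[symmetric] IK[symmetric]
    define h where "h = (\<lambda>b. pbump x0 r (ws b) (sg (s1 b) (s2 b)))"
    show ?thesis
    proof (rule exI[of _ h], rule exI[of _ x], rule exI[of _ y], rule exI[of _ z], intro conjI allI impI)
      show "perturbation x0 r (h b)" for b using False by (simp add: h_def ws_def perturbationI)
      show "ip G (x a) (e d) = 0" "ip G (y a) (e d) = 0" "ip G (z a) (e d) = 0" "ip G (x a) (y a) = 0"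
        "ip G (x a) (z a) = 0" "ip G (y a) (z a) = 0" "ip G (x a) (x a) > 0" "ip G (y a) (y a) > 0" for a
        by (simp_all add: x_def y_def z_def calc ne)
      fix s b
      let ?m = "\<lambda>a b. leading_obstruction G (h b) x0 (x a) (y a) (z a) (e d)"
      assume s: "\<forall>a. (\<Sum>b\<in>UNIV. s b * ?m a b) = 0"
      have l1: "?m d b = 0" if "b \<noteq> d" for b
        using that by (auto simp: h_def ws_def s1_def s2_def x_def y_def z_def leading_obstruction_4[OF False] pr4_def qq_def ss_def calc ne)
      have l2: "?m d d \<noteq> 0"
        using k by (simp add: h_def ws_def s1_def s2_def x_def y_def z_def leading_obstruction_4[OF False] pr4_def qq_def ss_def calc ne)
      have l3: "?m a b = 0" if "a \<noteq> d" "b \<noteq> d" "b \<noteq> a" for a b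
        using that by (auto simp: h_def ws_def s1_def s2_def x_def y_def z_def leading_obstruction_4[OF False] pr4_def qq_def ss_def calc ne)
      have l4: "?m a a \<noteq> 0" if "a \<noteq> d" for a
        using that k by (simp add: h_def ws_def s1_def s2_def x_def y_def z_def leading_obstruction_4[OF False] pr4_def qq_def ss_def calc ne)
      have sd: "s d = 0"
        using s[rule_format, of d] sum_single[of d "\<lambda>b. s b * ?m d b"] l1 l2 by simp
      have "s a = 0" if "a \<noteq> d" for a
      proof -
        have "s b * ?m a b = 0" if "b \<noteq> a" for b using l3[OF \<open>a \<noteq> d\<close> _ that] sd by (cases "b = d") auto
        then show ?thesis using s[rule_format, of a] sum_single[of a "\<lambda>b. s b * ?m a b"] l4[OF that] by simp
      qed
      then show "s b = 0" using sd by (cases "b = d") auto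
    qed
  qed
qed

text \<open>In a frame with one vector along \<open>v0\<close>, Gram-Schmidt and the length of
  \<open>v0\<close> multiply each row of the frame matrix by a positive constant, which does not
  affect its kernel.\<close>

lemma perturbation_family:
  fixes G :: "real^'n^'n"
  assumes sym: "\<And>X Y. ip G X Y = ip G Y X" and pos: "\<forall>X. X \<noteq> 0 \<longrightarrow> ip G X X > 0"
    and card: "CARD('n) \<ge> 3" and v0: "v0 \<noteq> 0" and r: "r > 0"
  shows "\<exists>(h :: 'n \<Rightarrow> real^'n \<Rightarrow> real^'n^'n) (x :: 'n \<Rightarrow> real^'n) y z. (\<forall>b. perturbation x0 r (h b)) \<and>
    (\<forall>s. (\<forall>a. (\<Sum>b\<in>UNIV. s b * gs_leading G (h b) x0 (x a) (y a) (z a) v0) = 0) \<longrightarrow> (\<forall>b. s b = 0))"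
proof -
  obtain d :: 'n where True by blast
  obtain e :: "'n \<Rightarrow> real^'n" and \<rho> where e: "\<And>i j. ip G (e i) (e j) = (if i = j then 1 else 0)"
    and rho: "\<rho> > 0" and v0: "v0 = \<rho> *\<^sub>R e d"
  proof (rule orthonormal_frame[OF sym pos[rule_format] v0, where d = d])
    fix e :: "'n \<Rightarrow> real^'n" and \<rho>
    assume "\<And>i j. ip G (e i) (e j) = (if i = j then 1 else 0)" "\<rho> > 0" "v0 = \<rho> *\<^sub>R e d"
    then show thesis by (rule that)
  qed
  obtain h :: "'n \<Rightarrow> real^'n \<Rightarrow> real^'n^'n" and x y z :: "'n \<Rightarrow> real^'n" where P: "(\<forall>b. perturbation x0 r (h b)) \<and>
      (\<forall>a. ip G (x a) (e d) = 0 \<and> ip G (y a) (e d) = 0 \<and> ip G (z a) (e d) = 0 \<and>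
        ip G (x a) (y a) = 0 \<and> ip G (x a) (z a) = 0 \<and> ip G (y a) (z a) = 0 \<and> ip G (x a) (x a) > 0 \<and> ip G (y a) (y a) > 0) \<and>
      (\<forall>s. (\<forall>a. (\<Sum>b\<in>UNIV. s b * leading_obstruction G (h b) x0 (x a) (y a) (z a) (e d)) = 0) \<longrightarrow> (\<forall>b. s b = 0))"
    using perturbation_family_frame[OF e card r, where d = d and ?x0.0 = x0] by (elim exE) (rule that)
  have adm: "perturbation x0 r (h b)" for b using P by blast
  have o: "ip G (x a) (e d) = 0" "ip G (y a) (e d) = 0" "ip G (z a) (e d) = 0"
    "ip G (x a) (y a) = 0" "ip G (x a) (z a) = 0" "ip G (y a) (z a) = 0"
    and p: "ip G (x a) (x a) > 0" "ip G (y a) (y a) > 0" for a using P by blast+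
  have inj: "s b = 0" if "\<And>a. (\<Sum>b\<in>UNIV. s b * leading_obstruction G (h b) x0 (x a) (y a) (z a) (e d)) = 0" for s b
    using P that by blast
  have ed: "ip G (e d) (e d) = 1" using e by simp
  show ?thesis
  proof (rule exI[of _ h], rule exI[of _ x], rule exI[of _ y], rule exI[of _ z], intro conjI allI impI adm, rule inj)
    fix s a
    assume s: "\<forall>a. (\<Sum>b\<in>UNIV. s b * gs_leading G (h b) x0 (x a) (y a) (z a) v0) = 0"
    note g = gs_at_frame[OF sym ed o(1)[of a] o(2)[of a] o(3)[of a] o(4)[of a] o(5)[of a] o(6)[of a], where \<rho> = \<rho>, folded v0]
    let ?a = "\<rho>\<^sup>2" and ?b = "\<rho> ^ 6 * ip G (x a) (x a)" and ?c = "\<rho> ^ 18 * ip G (x a) (x a) ^ 3 * ip G (y a) (y a)"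
    let ?L = "\<lambda>b. leading_obstruction G (h b) x0 (x a) (y a) (z a) (e d)"
    define C where "C = (if CARD('n) = 3 then ?a * ?b ^ 3 * \<rho> ^ 3 else ?a * ?b * ?c * \<rho>)"
    have C: "C > 0" using rho p by (simp add: C_def)
    have L: "gs_leading G (h b) x0 (x a) (y a) (z a) v0 = C * ?L b" for b
      using leading_obstruction_scale[OF adm, of G b ?a "x a" ?b "y a" ?c "z a" \<rho> "e d"]
      unfolding gs_leading_def g v0[symmetric] C_def .
    have "0 = (\<Sum>b\<in>UNIV. s b * (C * ?L b))" using s[rule_format, of a, symmetric] unfolding L .
    also have "\<dots> = C * (\<Sum>b\<in>UNIV. s b * ?L b)" by (simp add: sum_distrib_left mult_ac)
    finally show "(\<Sum>b\<in>UNIV. s b * ?L b) = 0" using C by simp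
  qed
qed

text \<open>The order of quantifiers matters: h and \<epsilon> are chosen from G and
  \<open>v0\<close>, before the metric g, so they remain valid after other perturbations that keep
  G. A bad parameter solves a linear system for some unit v near \<open>v0\<close>; Cramer's rule
  gives it as F v, and a differentiable map between spaces of equal dimension sends the null set
  \<open>sphere 0 1\<close> to a null set.\<close>

lemma degenerate_negligible:
  fixes G :: "real^'n^'n"
  assumes sym: "\<And>X Y. ip G X Y = ip G Y X" and pos: "\<forall>X. X \<noteq> 0 \<longrightarrow> ip G X X > 0"
    and card: "CARD('n) \<ge> 3" and v0: "v0 \<noteq> 0" and r: "r > 0"
  shows "\<exists>(h :: 'n \<Rightarrow> real^'n \<Rightarrow> real^'n^'n) \<epsilon>. (\<forall>b. perturbation x0 r (h b)) \<and> \<epsilon> > 0 \<and>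
    (\<forall>S g. metric_domain S g \<longrightarrow> x0 \<in> S \<longrightarrow> g x0 = G \<longrightarrow>
      negligible {s :: real^'n. metric_domain S (\<lambda>x. g x + (\<Sum>b\<in>UNIV. (s $ b) *\<^sub>R h b x)) \<and>
        (\<exists>v\<in>cball v0 \<epsilon>. norm v = 1 \<and> degenerate_at (\<lambda>x. g x + (\<Sum>b\<in>UNIV. (s $ b) *\<^sub>R h b x)) x0 v)})"
proof -
  obtain h :: "'n \<Rightarrow> real^'n \<Rightarrow> real^'n^'n" and x y z :: "'n \<Rightarrow> real^'n" where P: "(\<forall>b. perturbation x0 r (h b)) \<and>
    (\<forall>s. (\<forall>a. (\<Sum>b\<in>UNIV. s b * gs_leading G (h b) x0 (x a) (y a) (z a) v0) = 0) \<longrightarrow> (\<forall>b. s b = 0))"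
    using perturbation_family[OF sym pos card v0 r, of x0] by (elim exE) (rule that)
  then have adm: "perturbation x0 r (h b)" for b by blast
  have inj: "s b = 0" if "\<And>a. (\<Sum>b\<in>UNIV. s b * gs_leading G (h b) x0 (x a) (y a) (z a) v0) = 0" for s b
    using P that by blast
  define m where "m = (\<lambda>v a b. gs_leading G (h b) x0 (x a) (y a) (z a) v)"
  define Mt where "Mt = (\<lambda>v. (\<chi> a b. m v a b) :: real^'n^'n)"
  have m_sm: "smooth_on UNIV (\<lambda>v. m v a b)" for a b
    using smooth_gs_leading[OF adm, of G b] by (simp add: m_def)
  have det_sm: "smooth_on UNIV (\<lambda>v. det (Mt v))"
    by (rule smooth_on_det[OF open_UNIV]) (simp add: Mt_def m_sm)
  have "invertible (Mt v0)"
    unfolding invertible_left_inverse matrix_left_invertible_ker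
  proof (intro allI impI)
    fix s :: "real^'n" assume "Mt v0 *v s = 0"
    then have "(\<Sum>b\<in>UNIV. s $ b * m v0 a b) = 0" for a
      by (simp add: vec_eq_iff matrix_vector_mult_def Mt_def mult.commute)
    then have "s $ b = 0" for b
      using inj[of "\<lambda>b. s $ b" b] by (simp add: m_def)
    then show "s = 0" by (simp add: vec_eq_iff)
  qed
  then have d0: "det (Mt v0) \<noteq> 0" by (simp add: invertible_det_nz)
  define U where "U = {v. det (Mt v) \<noteq> 0}"
  have "open (U :: (real^'n) set)"
    unfolding U_def
    using continuous_open_preimage[OF smooth_on_continuous_on[OF det_sm] open_UNIV, of "- {0}"]
    by (simp add: vimage_def Collect_neg_eq open_Compl)
  then obtain \<epsilon> where eps: "\<epsilon> > 0" "cball v0 \<epsilon> \<subseteq> U"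
    using d0 open_contains_cball[of U] by (auto simp: U_def)
  show ?thesis
  proof (rule exI[of _ h], rule exI[of _ \<epsilon>], intro conjI allI impI adm eps(1))
    fix S and g :: "real^'n \<Rightarrow> real^'n^'n"
    assume md: "metric_domain S g" and x0: "x0 \<in> S" and G: "g x0 = G"
    define H where "H = (\<lambda>s :: real^'n. \<lambda>x. \<Sum>b\<in>UNIV. (s $ b) *\<^sub>R h b x)"
    define bv where "bv = (\<lambda>v. (\<chi> a. - gs_obstruction g x0 (x a) (y a) (z a) v) :: real^'n)"
    define F where "F = (\<lambda>v. (\<chi> k. det (\<chi> i j. if j = k then bv v $ i else Mt v $ i $ j) / det (Mt v)) :: real^'n)"
    have h_sm: "smooth_on UNIV (h b)" for b by (rule perturbation_basic(1)[OF adm])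
    have H_sm: "smooth_on UNIV (H s)" for s
      unfolding H_def by (rule smooth_on_sum[OF open_UNIV smooth_on_scaleR[OF open_UNIV smooth_on_const h_sm]])
    have HJ: "H s x0 = 0" "ddir M (H s) x0 = 0" "CARD('n) = 3 \<Longrightarrow> ddir M (ddir N (H s)) x0 = 0" for s M N
      by (simp_all add: H_def perturbation_jet[OF adm] ddir_sum_scaleR[OF h_sm] ddir_sum_scaleR[OF smooth_on_ddir[OF open_UNIV h_sm]])
    have F_sm: "smooth_on U F"
      unfolding F_def
    proof (rule smooth_on_vec_lambda[OF \<open>open U\<close>], rule smooth_on_divide[OF \<open>open U\<close>])
      fix k
      show "smooth_on U (\<lambda>v. det (\<chi> i j. if j = k then bv v $ i else Mt v $ i $ j))"
      proof (rule smooth_on_det[OF \<open>open U\<close>])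
        fix i j
        show "smooth_on U (\<lambda>v. (\<chi> i j. if j = k then bv v $ i else Mt v $ i $ j) $ i $ j)"
          using smooth_on_subset[OF m_sm, of U i j]
            smooth_on_subset[OF smooth_on_minus[OF open_UNIV metric_domain.smooth_gs_obstruction[OF md x0, of "x i" "y i" "z i"]], of U]
          by (cases "j = k") (simp_all add: bv_def Mt_def)
      qed
      show "smooth_on U (\<lambda>v. det (Mt v))" using smooth_on_subset[OF det_sm] by simp
    qed (simp add: U_def)
    have "{s. metric_domain S (\<lambda>x. g x + H s x) \<and> (\<exists>v\<in>cball v0 \<epsilon>. norm v = 1 \<and> degenerate_at (\<lambda>x. g x + H s x) x0 v)}
      \<subseteq> F ` (sphere 0 1 \<inter> U)"
    proof
      fix s assume "s \<in> {s. metric_domain S (\<lambda>x. g x + H s x) \<and> (\<exists>v\<in>cball v0 \<epsilon>. norm v = 1 \<and> degenerate_at (\<lambda>x. g x + H s x) x0 v)}"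
      then obtain v where md': "metric_domain S (\<lambda>x. g x + H s x)" and v: "v \<in> cball v0 \<epsilon>" "norm v = 1"
        and dg: "degenerate_at (\<lambda>x. g x + H s x) x0 v" by blast
      have vU: "v \<in> U" using v eps by blast
      have op: "obstruction (\<lambda>x. g x + H s x) x0 X Y Z v = obstruction g x0 X Y Z v + leading_obstruction G (H s) x0 X Y Z v" for X Y Z v
        unfolding G[symmetric] by (rule obstruction_perturbed[OF md md' x0 H_sm HJ(1,2)]) (rule HJ(3))
      have "Mt v *v s = bv v"
      proof (rule vec_eq_iff[THEN iffD2], rule allI)
        fix a
        have "0 = gs_obstruction (\<lambda>x. g x + H s x) x0 (x a) (y a) (z a) v"
          using dg by (simp add: degenerate_at_def)
        also have "\<dots> = gs_obstruction g x0 (x a) (y a) (z a) v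
          + gs_leading G (H s) x0 (x a) (y a) (z a) v"
          using G HJ(1) by (simp add: gs_obstruction_def gs_leading_def op)
        also have "gs_leading G (H s) x0 (x a) (y a) (z a) v = (\<Sum>b\<in>UNIV. s $ b * m v a b)"
          unfolding H_def m_def gs_leading_def by (rule leading_obstruction_sum[OF h_sm])
        finally show "(Mt v *v s) $ a = bv v $ a"
          by (simp add: matrix_vector_mult_def Mt_def bv_def mult.commute)
      qed
      then have "s = F v"
        using cramer[of "Mt v" s "bv v"] vU by (simp add: F_def U_def)
      then show "s \<in> F ` (sphere 0 1 \<inter> U)" using v vU by auto
    qed
    moreover have "negligible (F ` (sphere 0 1 \<inter> U))"
    proof (rule negligible_differentiable_image_negligible)
      show "negligible (sphere 0 1 \<inter> U)" using negligible_sphere negligible_Int by blast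
      show "F differentiable_on sphere 0 1 \<inter> U"
        using smooth_on_differentiable_on[OF smooth_on_subset[OF F_sm]] by simp
    qed simp
    ultimately show "negligible {s :: real^'n. metric_domain S (\<lambda>x. g x + (\<Sum>b\<in>UNIV. (s $ b) *\<^sub>R h b x)) \<and>
        (\<exists>v\<in>cball v0 \<epsilon>. norm v = 1 \<and> degenerate_at (\<lambda>x. g x + (\<Sum>b\<in>UNIV. (s $ b) *\<^sub>R h b x)) x0 v)}"
      using negligible_subset by (simp add: H_def)
  qed
qed

section \<open>Charts and tensors supported in a chart\<close>

lemma bounded_bilinear_matrix_mult: "bounded_bilinear (\<lambda>(A::real^'n^'m) (B::real^'k^'n). A ** B)"
  unfolding bilinear_conv_bounded_bilinear[symmetric] bilinear_def
  by (auto intro!: linearI simp: vec_eq_iff matrix_matrix_mult_def algebra_simps sum.distrib sum_distrib_left)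

lemmas matrix_mult_bilinear_simps =
  bounded_bilinear.add_left[OF bounded_bilinear_matrix_mult] bounded_bilinear.add_right[OF bounded_bilinear_matrix_mult]
  bounded_bilinear.zero_left[OF bounded_bilinear_matrix_mult] bounded_bilinear.zero_right[OF bounded_bilinear_matrix_mult]

lemma bounded_linear_transpose: "bounded_linear (transpose :: real^'n^'m \<Rightarrow> real^'m^'n)"
  unfolding linear_conv_bounded_linear[symmetric] by (auto intro!: linearI simp: transpose_def vec_eq_iff)

lemma inner_congruence: "v \<bullet> ((transpose J ** A ** J) *v v) = (J *v v) \<bullet> (A *v (J *v (v :: real^'n)))"
  by (metis dot_lmul_matrix matrix_vector_mul_assoc transpose_matrix_vector inner_commute)

lemma jacobian_comp:
  fixes f :: "real^'n \<Rightarrow> real^'n" and g :: "real^'n \<Rightarrow> real^'n"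
  assumes "open S" "y \<in> S" "\<And>z. z \<in> S \<Longrightarrow> k z = g (f z)"
    and f: "f differentiable (at y)" and g: "g differentiable (at (f y))"
  shows "jacobian k (at y) = jacobian g (at (f y)) ** jacobian f (at y)"
proof -
  have "frechet_derivative k (at y) = frechet_derivative (g \<circ> f) (at y)"
    by (rule frechet_derivative_cong_open[OF assms(1,2)]) (simp add: assms(3))
  also have "\<dots> = frechet_derivative g (at (f y)) \<circ> frechet_derivative f (at y)"
    by (rule frechet_derivative_compose[OF f g])
  finally show ?thesis
    unfolding jacobian_def using matrix_compose[OF linear_frechet_derivative[OF f] linear_frechet_derivative[OF g]] by simp
qed

section \<open>Charts, transition maps and metrics on the manifold\<close>

locale smooth_atlas_manifold =
  fixes X :: "'a topology" and A :: "('a, 'n::finite) chart set"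
  assumes manifold: "smooth_manifold X A"
begin

lemma hausdorff: "Hausdorff_space X"
  using manifold by (simp add: smooth_manifold_def)

lemma chart: "c \<in> A \<Longrightarrow> is_chart X c"
  using manifold by (simp add: smooth_manifold_def smooth_atlas_def)

lemma chart_open: "c \<in> A \<Longrightarrow> openin X (fst c)"
  and chart_image_open: "c \<in> A \<Longrightarrow> open (snd c ` fst c)"
  and chart_homeo: "c \<in> A \<Longrightarrow> homeomorphic_map (subtopology X (fst c)) (top_of_set (snd c ` fst c)) (snd c)"
  using chart by (auto simp: is_chart_def)

lemma chart_subset: "c \<in> A \<Longrightarrow> fst c \<subseteq> topspace X"
  using chart_open openin_subset by blast

lemma chart_topspace: "c \<in> A \<Longrightarrow> topspace (subtopology X (fst c)) = fst c"
  using chart_subset[of c] by (simp add: Int_absorb1)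

lemma chart_inj: "c \<in> A \<Longrightarrow> inj_on (snd c) (fst c)"
  using chart_homeo chart_topspace homeomorphic_imp_injective_map by metis

lemma chart_inv_in: "y \<in> snd c ` fst c \<Longrightarrow> chart_inv c y \<in> fst c"
  unfolding chart_inv_def by (rule inv_into_into)

lemma chart_right_inv: "y \<in> snd c ` fst c \<Longrightarrow> snd c (chart_inv c y) = y"
  unfolding chart_inv_def by (rule f_inv_into_f)

lemma chart_left_inv: "c \<in> A \<Longrightarrow> p \<in> fst c \<Longrightarrow> chart_inv c (snd c p) = p"
  unfolding chart_inv_def by (rule inv_into_f_f[OF chart_inj])

lemma open_chart_image:
  assumes c: "c \<in> A" and W: "openin X W"
  shows "open (snd c ` (fst c \<inter> W))"
proof -
  have "openin (subtopology X (fst c)) (fst c \<inter> W)"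
    using W by (auto simp: openin_subtopology)
  then have "openin (top_of_set (snd c ` fst c)) (snd c ` (fst c \<inter> W))"
    using homeomorphic_imp_open_map[OF chart_homeo[OF c]] by (simp add: open_map_def)
  then show ?thesis using chart_image_open[OF c] openin_open_eq by blast
qed

lemma compact_chart_image:
  assumes c: "c \<in> A" and K: "compactin X K" "K \<subseteq> fst c"
  shows "compact (snd c ` K)"
proof -
  have "compactin (subtopology X (fst c)) K" using K by (simp add: compactin_subtopology)
  then have "compactin (top_of_set (snd c ` fst c)) (snd c ` K)"
    using homeomorphic_map_compactness[OF chart_homeo[OF c], of K] K(2) chart_topspace[OF c] by metis
  then show ?thesis by (simp add: compactin_subtopology)
qed

lemma compactin_chart_preimage:
  assumes c: "c \<in> A" and B: "compact B" "B \<subseteq> snd c ` fst c"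
  shows "compactin X (chart_inv c ` B)"
proof -
  have sub: "chart_inv c ` B \<subseteq> fst c" using B(2) chart_inv_in[of _ c] by blast
  have "snd c ` (chart_inv c ` B) = B" using B(2) chart_right_inv[of _ c] by (force simp: image_image)
  then have "compactin (top_of_set (snd c ` fst c)) (snd c ` (chart_inv c ` B))"
    using B by (simp add: compactin_subtopology)
  then have "compactin (subtopology X (fst c)) (chart_inv c ` B)"
    using homeomorphic_map_compactness[OF chart_homeo[OF c], of "chart_inv c ` B"] sub chart_topspace[OF c] by metis
  then show ?thesis by (simp add: compactin_subtopology)
qed

lemma transition_smooth: "c \<in> A \<Longrightarrow> d \<in> A \<Longrightarrow> smooth_on (snd c ` (fst c \<inter> fst d)) (transition c d)"
  using manifold by (simp add: smooth_manifold_def smooth_atlas_def)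

lemma overlap_open: "c \<in> A \<Longrightarrow> d \<in> A \<Longrightarrow> open (snd c ` (fst c \<inter> fst d))"
  using open_chart_image chart_open by blast

lemma transition_differentiable: "c \<in> A \<Longrightarrow> d \<in> A \<Longrightarrow> y \<in> snd c ` (fst c \<inter> fst d) \<Longrightarrow> transition c d differentiable (at y)"
  using smooth_on_differentiable[OF transition_smooth overlap_open] by blast

lemma overlap_iff:
  assumes "c \<in> A" "y \<in> snd c ` fst c"
  shows "y \<in> snd c ` (fst c \<inter> W) \<longleftrightarrow> chart_inv c y \<in> W"
proof
  assume "y \<in> snd c ` (fst c \<inter> W)"
  then show "chart_inv c y \<in> W" using chart_left_inv[OF assms(1)] by auto
next
  assume "chart_inv c y \<in> W"
  then show "y \<in> snd c ` (fst c \<inter> W)"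
    using chart_inv_in[OF assms(2)] chart_right_inv[OF assms(2)] by (metis IntI imageI)
qed

lemma metricD:
  assumes "g \<in> riemannian_metrics A"
  shows "c \<in> A \<Longrightarrow> smooth_on (snd c ` fst c) (g c)"
    and "c \<in> A \<Longrightarrow> x \<in> snd c ` fst c \<Longrightarrow> transpose (g c x) = g c x"
    and "c \<in> A \<Longrightarrow> x \<in> snd c ` fst c \<Longrightarrow> v \<noteq> 0 \<Longrightarrow> v \<bullet> (g c x *v v) > 0"
    and "c \<in> A \<Longrightarrow> d \<in> A \<Longrightarrow> x \<in> snd c ` (fst c \<inter> fst d) \<Longrightarrow>
      g c x = transpose (jacobian (transition c d) (at x)) ** g d (transition c d x) ** jacobian (transition c d) (at x)"
    and "c \<notin> A \<or> x \<notin> snd c ` fst c \<Longrightarrow> g c x = 0"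
  using assms unfolding riemannian_metrics_def Let_def by blast+

lemma metric_domain_chart:
  assumes "g \<in> riemannian_metrics A" "c \<in> A" "open S" "S \<subseteq> snd c ` fst c"
  shows "metric_domain S (g c)"
  by unfold_locales
    (use assms smooth_on_subset[OF metricD(1)[OF assms(1,2)]] metricD(2,3)[OF assms(1,2)] in auto)

text \<open>The whole local theory applied in one chart. The symbol is rewritten by means of the
  gradient, which is the raised differential, so that \<open>bracket_condition\<close> applies at
  every point of the chart image of U.\<close>

lemma weight_degenerate:
  assumes g: "g \<in> riemannian_metrics A" and c: "c \<in> A" and U: "openin X U" and p: "p \<in> fst c" "p \<in> U"
    and w: "limiting_carleman_weight A g U \<phi>"
  shows "\<exists>v. norm v = 1 \<and> degenerate_at (g c) (snd c p) v"
proof -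
  define S where "S = snd c ` (fst c \<inter> U)"
  define f where "f = \<phi> \<circ> chart_inv c"
  have S: "open S" "S \<subseteq> snd c ` fst c" using open_chart_image[OF c U] by (auto simp: S_def)
  interpret metric_domain S "g c" by (rule metric_domain_chart[OF g c S])
  have w': "smooth_on S f" "\<And>x. x \<in> S \<Longrightarrow> differential c \<phi> x \<noteq> 0"
    "\<And>x \<xi>. x \<in> S \<Longrightarrow> carleman_symbol g \<phi> c (x, \<xi>) = 0 \<Longrightarrow>
      poisson_bracket (cnj \<circ> carleman_symbol g \<phi> c) (carleman_symbol g \<phi> c) (x, \<xi>) = 0"
    using w c unfolding limiting_carleman_weight_def S_def f_def by blast+
  have gr: "grad f x = matrix_inv (g c x) *v differential c \<phi> x" for x
    by (simp add: grad_def raise_def differential_def f_def partial_deriv_ddir)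
  have dif: "g c x *v grad f x = differential c \<phi> x" if "x \<in> S" for x
    by (simp add: gr matrix_vector_mul_assoc matrix_inv_mult[OF invertible_g[OF that]])
  have nz: "grad f x \<noteq> 0" if "x \<in> S" for x
  proof
    assume "grad f x = 0"
    then have "differential c \<phi> x = 0" using dif[OF that] by simp
    then show False using w'(2)[OF that] by simp
  qed
  have sym: "carleman_symbol g \<phi> c (y, \<xi>) = of_real (\<xi> \<bullet> (matrix_inv (g c y) *v \<xi>) - ip (g c y) (grad f y) (grad f y))
      + 2 * \<i> * of_real (\<xi> \<bullet> grad f y)" if "y \<in> S" for y \<xi>
  proof -
    have "coinner (g c y) (differential c \<phi> y) (differential c \<phi> y) = ip (g c y) (grad f y) (grad f y)"
      by (simp add: coinner_def ip_def dif[OF that] gr[symmetric] inner_commute)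
    then show ?thesis
      by (simp add: carleman_symbol_def Let_def coinner_def gr)
  qed
  have "weight_domain S (g c) f (\<lambda>x. ln (ip (g c x) (grad f x) (grad f x)) / 2)"
    by (rule weight_domain_of_umbilic[OF w'(1) nz bracket_condition[OF w'(1) _ sym w'(3)]]) auto
  moreover have "snd c p \<in> S" using p by (auto simp: S_def)
  ultimately show ?thesis using degenerate_of_weight nz by blast
qed

text \<open>Pull-back to all charts of a tensor given in the chart c, extended by zero. The same
  default value makes it vanish at the irrelevant arguments where metrics must be 0.\<close>

definition lift :: "('a, 'n) chart \<Rightarrow> (real^'n \<Rightarrow> real^'n^'n) \<Rightarrow> ('a, 'n) metric"
  where "lift c \<eta> = (\<lambda>d y. if d \<in> A \<and> y \<in> snd d ` (fst d \<inter> fst c)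
    then transpose (jacobian (transition d c) (at y)) ** \<eta> (transition d c y) ** jacobian (transition d c) (at y) else 0)"

lemma transition_in:
  assumes "d \<in> A" "y \<in> snd d ` (fst d \<inter> fst c)"
  shows "transition d c y \<in> snd c ` fst c"
proof -
  obtain q where "q \<in> fst d" "q \<in> fst c" "y = snd d q" using assms(2) by blast
  then show ?thesis using chart_left_inv[OF assms(1)] by (simp add: transition_def)
qed

lemma transition_transition:
  assumes "d \<in> A" "e \<in> A" "y \<in> snd d ` (fst d \<inter> fst e)"
  shows "transition d c y = transition e c (transition d e y)"
proof -
  obtain q where "q \<in> fst d" "q \<in> fst e" "y = snd d q" using assms(3) by blast
  then show ?thesis using chart_left_inv[OF assms(1)] chart_left_inv[OF assms(2)] by (simp add: transition_def)
qed

lemma lift_self: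
  assumes c: "c \<in> A" and x: "x \<in> snd c ` fst c"
  shows "lift c \<eta> c x = \<eta> x"
proof -
  have id: "transition c c y = y" if "y \<in> snd c ` fst c" for y
    using chart_right_inv[OF that] by (simp add: transition_def)
  have "frechet_derivative (transition c c) (at x) = frechet_derivative (\<lambda>x. x) (at x)"
    by (rule frechet_derivative_cong_open[OF chart_image_open[OF c] x id])
  then have "jacobian (transition c c) (at x) = mat 1"
    by (simp add: jacobian_def matrix_id_mat_1 id_def[symmetric])
  then show ?thesis using c x id[OF x] by (simp add: lift_def transpose_mat)
qed

text \<open>Where the point lies in c this is the chain rule for Jacobians; elsewhere both sides are
  zero.\<close>

lemma lift_transform:
  assumes c: "c \<in> A" and d: "d \<in> A" and e: "e \<in> A" and y: "y \<in> snd d ` (fst d \<inter> fst e)"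
  shows "lift c \<eta> d y = transpose (jacobian (transition d e) (at y)) ** lift c \<eta> e (transition d e y) ** jacobian (transition d e) (at y)"
proof -
  have y': "y \<in> snd d ` fst d" using y by auto
  have inv: "chart_inv d y \<in> fst e" using overlap_iff[OF d y'] y by blast
  have ye: "transition d e y \<in> snd e ` fst e" using transition_in[OF d y] .
  have inve: "chart_inv e (transition d e y) = chart_inv d y"
    using chart_left_inv[OF e inv] by (simp add: transition_def)
  show ?thesis
  proof (cases "chart_inv d y \<in> fst c")
    case False
    then have "y \<notin> snd d ` (fst d \<inter> fst c)" "transition d e y \<notin> snd e ` (fst e \<inter> fst c)"
      using overlap_iff[OF d y'] overlap_iff[OF e ye] inve by auto
    then show ?thesis by (simp add: lift_def matrix_mult_bilinear_simps)
  next
    case True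
    then have yc: "y \<in> snd d ` (fst d \<inter> fst c)" "transition d e y \<in> snd e ` (fst e \<inter> fst c)"
      using overlap_iff[OF d y'] overlap_iff[OF e ye] inve by auto
    have J: "jacobian (transition d c) (at y) = jacobian (transition e c) (at (transition d e y)) ** jacobian (transition d e) (at y)"
      by (rule jacobian_comp[OF overlap_open[OF d e] y transition_transition[OF d e]
            transition_differentiable[OF d e y] transition_differentiable[OF e c yc(2)]])
    have t: "transition d c y = transition e c (transition d e y)" by (rule transition_transition[OF d e y])
    show ?thesis
      using yc d e by (simp add: lift_def J t matrix_transpose_mul matrix_mul_assoc)
  qed
qed

lemma lift_transpose:
  assumes "\<And>x. transpose (\<eta> x) = \<eta> x"
  shows "transpose (lift c \<eta> d y) = lift c \<eta> d y"
proof (cases "d \<in> A \<and> y \<in> snd d ` (fst d \<inter> fst c)")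
  case True
  then show ?thesis by (simp add: lift_def matrix_transpose_mul assms matrix_mul_assoc)
next
  case False
  have "lift c \<eta> d y = 0" unfolding lift_def by (rule if_not_P[OF False])
  then show ?thesis by (simp add: transpose_def vec_eq_iff)
qed

text \<open>Two local cases. Inside c the lift is a composition of smooth maps. Around a point
  outside c it vanishes, because its support is the image of the compact set B, closed in the
  Hausdorff space and contained in c.\<close>

lemma lift_smooth:
  assumes c: "c \<in> A" and d: "d \<in> A" and eta: "smooth_on UNIV \<eta>"
    and B: "compact B" "B \<subseteq> snd c ` fst c" and out: "\<And>x. x \<notin> B \<Longrightarrow> \<eta> x = 0"
  shows "smooth_on (snd d ` fst d) (lift c \<eta> d)"
proof (rule smooth_on_local[OF chart_image_open[OF d]])
  fix y assume y: "y \<in> snd d ` fst d"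
  show "\<exists>T. open T \<and> y \<in> T \<and> smooth_on T (lift c \<eta> d)"
  proof (cases "chart_inv d y \<in> fst c")
    case True
    let ?T = "snd d ` (fst d \<inter> fst c)"
    have T: "open ?T" by (rule overlap_open[OF d c])
    have psi: "smooth_on ?T (transition d c)" by (rule transition_smooth[OF d c])
    have J: "smooth_on ?T (\<lambda>y. jacobian (transition d c) (at y))"
    proof -
      have "smooth_on ?T (\<lambda>y. \<chi> i j. partial_deriv j (transition d c) y $ i)"
        by (rule smooth_on_vec_lambda[OF T], rule smooth_on_vec_lambda[OF T], rule smooth_on_vec_nth[OF T smooth_on_partial[OF psi]])
      then show ?thesis
        by (rule smooth_on_eqI[OF T]) (simp add: jacobian_def matrix_def partial_deriv_def)
    qed
    have "smooth_on ?T (\<lambda>y. transpose (jacobian (transition d c) (at y)) ** \<eta> (transition d c y) ** jacobian (transition d c) (at y))"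
      by (rule smooth_on_bilinear[OF T bounded_bilinear_matrix_mult smooth_on_bilinear[OF T bounded_bilinear_matrix_mult
            smooth_on_bounded_linear[OF T bounded_linear_transpose J] smooth_on_comp[OF T open_UNIV psi subset_UNIV eta]] J])
    then have "smooth_on ?T (lift c \<eta> d)"
      by (rule smooth_on_eqI[OF T]) (simp add: lift_def d)
    moreover have "y \<in> ?T" using overlap_iff[OF d y] True by blast
    ultimately show ?thesis using T by blast
  next
    case False
    define K0 where "K0 = chart_inv c ` B"
    have K0: "closedin X K0" unfolding K0_def
      by (rule compactin_imp_closedin[OF hausdorff compactin_chart_preimage[OF c B]])
    have K0c: "K0 \<subseteq> fst c" using B(2) chart_inv_in[of _ c] by (auto simp: K0_def)
    let ?T = "snd d ` (fst d \<inter> (topspace X - K0))"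
    have T: "open ?T" by (rule open_chart_image[OF d]) (use K0 in \<open>simp add: openin_diff\<close>)
    have "lift c \<eta> d z = 0" if z: "z \<in> ?T" for z
    proof (cases "z \<in> snd d ` (fst d \<inter> fst c)")
      case True
      have z': "z \<in> snd d ` fst d" using z by auto
      have "chart_inv d z \<notin> K0" using overlap_iff[OF d z', of "topspace X - K0"] z by blast
      moreover have "chart_inv d z \<in> fst c" using overlap_iff[OF d z'] True by blast
      ultimately have "transition d c z \<notin> B"
        using chart_left_inv[OF c] by (force simp: K0_def transition_def)
      then show ?thesis by (simp add: lift_def out matrix_mult_bilinear_simps)
    qed (simp add: lift_def)
    then have "smooth_on ?T (lift c \<eta> d)"
      by (intro smooth_on_eqI[OF T smooth_on_const[of _ 0]])
    moreover have "y \<in> ?T"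
      using overlap_iff[OF d y, of "topspace X - K0"] False K0c chart_inv_in[OF y] chart_subset[OF d] by blast
    ultimately show ?thesis using T by blast
  qed
qed

lemma lift_sum:
  "lift c (\<lambda>x. \<Sum>b\<in>I. s b *\<^sub>R h b x) d y = (\<Sum>b\<in>I. s b *\<^sub>R lift c (h b) d y)"
proof -
  have l: "linear (\<lambda>M. transpose J ** M ** J)" for J :: "real^'n^'n"
    by (rule linearI) (simp_all add: matrix_mult_bilinear_simps
      bounded_bilinear.scaleR_left[OF bounded_bilinear_matrix_mult] bounded_bilinear.scaleR_right[OF bounded_bilinear_matrix_mult])
  show ?thesis
    by (cases "d \<in> A \<and> y \<in> snd d ` (fst d \<inter> fst c)") (simp_all add: lift_def linear_sum[OF l] linear_scale[OF l] del: de_Morgan_conj)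
qed

lemma metric_add_lift:
  assumes g: "g \<in> riemannian_metrics A" and c: "c \<in> A" and eta: "smooth_on UNIV \<eta>"
    and B: "compact B" "B \<subseteq> snd c ` fst c" and out: "\<And>x. x \<notin> B \<Longrightarrow> \<eta> x = 0"
    and sym: "\<And>x. transpose (\<eta> x) = \<eta> x"
    and pos: "\<And>x v. x \<in> B \<Longrightarrow> v \<noteq> 0 \<Longrightarrow> v \<bullet> ((g c x + \<eta> x) *v v) > 0"
  shows "(\<lambda>d y. g d y + lift c \<eta> d y) \<in> riemannian_metrics A"
  unfolding riemannian_metrics_def Let_def
proof (intro CollectI conjI ballI allI impI)
  fix d assume d: "d \<in> A"
  show "smooth_on (snd d ` fst d) (\<lambda>y. g d y + lift c \<eta> d y)"
    by (rule smooth_on_add[OF chart_image_open[OF d] metricD(1)[OF g d] lift_smooth[OF c d eta B out]])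
  fix y assume y: "y \<in> snd d ` fst d"
  show "transpose (g d y + lift c \<eta> d y) = g d y + lift c \<eta> d y"
    using metricD(2)[OF g d y] lift_transpose[OF sym, where c = c and d = d and y = y] by (simp add: transpose_def vec_eq_iff)
  fix v :: "real^'n" assume v: "v \<noteq> 0"
  show "v \<bullet> ((g d y + lift c \<eta> d y) *v v) > 0"
  proof (cases "y \<in> snd d ` (fst d \<inter> fst c)")
    case False
    then show ?thesis using metricD(3)[OF g d y v] by (simp add: lift_def)
  next
    case True
    let ?J = "jacobian (transition d c) (at y)" and ?x = "transition d c y"
    have x: "?x \<in> snd c ` fst c" by (rule transition_in[OF d True])
    have gd: "g d y = transpose ?J ** g c ?x ** ?J" by (rule metricD(4)[OF g d c True])
    have "g d y + lift c \<eta> d y = transpose ?J ** (g c ?x + \<eta> ?x) ** ?J"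
      using gd d True by (simp add: lift_def matrix_mult_bilinear_simps)
    then have e: "v \<bullet> ((g d y + lift c \<eta> d y) *v v) = (?J *v v) \<bullet> ((g c ?x + \<eta> ?x) *v (?J *v v))"
      using inner_congruence by metis
    \<comment> \<open>Positivity of g in the chart d shows that the Jacobian kills no nonzero
      vector.\<close>
    have "(?J *v v) \<bullet> (g c ?x *v (?J *v v)) > 0"
      using metricD(3)[OF g d y v] unfolding gd inner_congruence .
    then have "?J *v v \<noteq> 0" by auto
    then show ?thesis
      unfolding e using pos[of ?x "?J *v v"] out[of ?x] metricD(3)[OF g c x] by (cases "?x \<in> B") auto
  qed
next
  fix d e y assume d: "d \<in> A" and e: "e \<in> A" and y: "y \<in> snd d ` (fst d \<inter> fst e)"
  show "g d y + lift c \<eta> d y = transpose (jacobian (transition d e) (at y)) **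
     (g e (transition d e y) + lift c \<eta> e (transition d e y)) ** jacobian (transition d e) (at y)"
    using metricD(4)[OF g d e y] lift_transform[OF c d e y, of \<eta>] by (simp add: matrix_mult_bilinear_simps)
next
  fix d y assume "d \<notin> A \<or> y \<notin> snd d ` fst d"
  then show "g d y + lift c \<eta> d y = 0"
    using metricD(5)[OF g] by (auto simp: lift_def)
qed

end

section \<open>Openness and density\<close>

lemma iter_partial_add_sum:
  fixes f :: "real^'n \<Rightarrow> 'b::real_normed_vector"
  assumes S: "open S" "x \<in> S" and f: "smooth_on S f" and h: "\<And>b. smooth_on S (h b)"
  shows "iter_partial js (\<lambda>x. f x + (\<Sum>b\<in>I. s b *\<^sub>R h b x)) x = iter_partial js f x + (\<Sum>b\<in>I. s b *\<^sub>R iter_partial js (h b) x)"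
  using S(2)
proof (induction js arbitrary: x)
  case Nil
  then show ?case by (simp add: iter_partial_def)
next
  case (Cons j js)
  have Cs: "iter_partial (j # js) F = partial_deriv j (iter_partial js F)" for F :: "real^'n \<Rightarrow> 'b"
    by (simp add: iter_partial_def)
  have df: "iter_partial js f differentiable (at x)"
    by (rule smooth_on_differentiable[OF smooth_on_iter_partial[OF f] S(1) Cons.prems])
  have dh: "iter_partial js (h b) differentiable (at x)" for b
    by (rule smooth_on_differentiable[OF smooth_on_iter_partial[OF h] S(1) Cons.prems])
  have dsh: "(\<lambda>x. s b *\<^sub>R iter_partial js (h b) x) differentiable (at x)" for b
    by (rule differentiable_bounded_linear[OF bounded_linear_scaleR_right dh])
  have dsum: "(\<lambda>x. \<Sum>b\<in>I. s b *\<^sub>R iter_partial js (h b) x) differentiable (at x)"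
    by (rule smooth_on_differentiable[OF smooth_on_sum[OF S(1) smooth_on_scaleR[OF S(1) smooth_on_const smooth_on_iter_partial[OF h]]] S(1) Cons.prems])
  have "partial_deriv j (iter_partial js (\<lambda>x. f x + (\<Sum>b\<in>I. s b *\<^sub>R h b x))) x
    = ddir (axis j 1) (\<lambda>x. iter_partial js f x + (\<Sum>b\<in>I. s b *\<^sub>R iter_partial js (h b) x)) x"
    unfolding partial_deriv_ddir by (rule ddir_cong_open[OF S(1) Cons.prems Cons.IH])
  also have "\<dots> = ddir (axis j 1) (iter_partial js f) x + (\<Sum>b\<in>I. s b *\<^sub>R ddir (axis j 1) (iter_partial js (h b)) x)"
    unfolding ddir_add[OF df dsum] ddir_sum[OF dsh] ddir_bounded_linear[OF bounded_linear_scaleR_right dh] ..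
  finally show ?case unfolding Cs partial_deriv_ddir .
qed

lemma small_combination:
  fixes B :: "'n::finite \<Rightarrow> real"
  assumes "m > 0"
  shows "eventually (\<lambda>s :: real^'n. (\<Sum>b\<in>UNIV. \<bar>s $ b\<bar> * B b) < m) (nhds 0)"
proof -
  have "((\<lambda>s :: real^'n. \<Sum>b\<in>UNIV. \<bar>s $ b\<bar> * B b) \<longlongrightarrow> (\<Sum>b\<in>UNIV. \<bar>(0 :: real^'n) $ b\<bar> * B b)) (nhds 0)"
    by (rule tendsto_sum, rule tendsto_mult[OF tendsto_rabs[OF tendsto_vec_nth[OF filterlim_ident]] tendsto_const])
  from order_tendstoD(2)[OF this, of m] assms show ?thesis by simp
qed

lemma continuous_on_quadratic:
  fixes M :: "real^'n \<Rightarrow> real^'n^'n"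
  assumes "continuous_on B M"
  shows "continuous_on (B \<times> C) (\<lambda>z. snd z \<bullet> (M (fst z) *v snd z))"
proof -
  have "continuous_on (B \<times> C) (\<lambda>z. M (fst z))"
    by (rule continuous_on_compose2[OF assms continuous_on_fst[OF continuous_on_id]]) auto
  then show ?thesis
    by (intro continuous_on_inner continuous_on_snd continuous_on_id bounded_bilinear.continuous_on[OF bounded_bilinear_matrix_vector_mult])
qed

context smooth_atlas_manifold
begin

text \<open>On the compact product of B with the unit sphere the quadratic form of g has a positive
  minimum m, and a small combination of the h stays below m in absolute value.\<close>

lemma eventually_metric:
  fixes h :: "'n \<Rightarrow> real^'n \<Rightarrow> real^'n^'n"
  assumes g: "g \<in> riemannian_metrics A" and c: "c \<in> A" and h: "\<And>b. smooth_on UNIV (h b)"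
    and B: "compact B" "B \<subseteq> snd c ` fst c" "B \<noteq> {}" and out: "\<And>b x. x \<notin> B \<Longrightarrow> h b x = 0"
    and sym: "\<And>b x. transpose (h b x) = h b x"
  shows "eventually (\<lambda>s :: real^'n. (\<lambda>d y. g d y + (\<Sum>b\<in>UNIV. (s $ b) *\<^sub>R lift c (h b) d y)) \<in> riemannian_metrics A) (nhds 0)"
proof -
  let ?D = "B \<times> sphere (0 :: real^'n) 1"
  have cD: "compact ?D" by (intro compact_Times B compact_sphere)
  have neD: "?D \<noteq> {}"
  proof -
    have "axis undefined 1 \<in> sphere (0 :: real^'n) 1" by (simp add: norm_axis_1)
    then show ?thesis using B(3) by blast
  qed
  have cg: "continuous_on ?D (\<lambda>z. snd z \<bullet> (g c (fst z) *v snd z))"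
    by (rule continuous_on_quadratic[OF continuous_on_subset[OF smooth_on_continuous_on[OF metricD(1)[OF g c]] B(2)]])
  obtain z where z: "z \<in> ?D" "\<And>y. y \<in> ?D \<Longrightarrow> snd z \<bullet> (g c (fst z) *v snd z) \<le> snd y \<bullet> (g c (fst y) *v snd y)"
    using continuous_attains_inf[OF cD neD cg] by blast
  define m where "m = snd z \<bullet> (g c (fst z) *v snd z)"
  have m: "m > 0"
  proof -
    have "snd z \<noteq> 0" "fst z \<in> snd c ` fst c" using z(1) B(2) by auto
    then show ?thesis unfolding m_def using metricD(3)[OF g c] by blast
  qed
  have "\<exists>C. \<forall>y\<in>?D. \<bar>snd y \<bullet> (h b (fst y) *v snd y)\<bar> \<le> C" for b
  proof -
    have "continuous_on ?D (\<lambda>z. snd z \<bullet> (h b (fst z) *v snd z))"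
      by (rule continuous_on_quadratic[OF continuous_on_subset[OF smooth_on_continuous_on[OF h] subset_UNIV]])
    then have "bounded ((\<lambda>z. snd z \<bullet> (h b (fst z) *v snd z)) ` ?D)"
      by (rule compact_imp_bounded[OF compact_continuous_image[OF _ cD]])
    then show ?thesis unfolding bounded_iff by auto
  qed
  then obtain C where C: "\<And>b y. y \<in> ?D \<Longrightarrow> \<bar>snd y \<bullet> (h b (fst y) *v snd y)\<bar> \<le> C b" by metis
  have lift: "(\<lambda>d y. g d y + (\<Sum>b\<in>UNIV. (s $ b) *\<^sub>R lift c (h b) d y)) \<in> riemannian_metrics A"
    if s: "(\<Sum>b\<in>UNIV. \<bar>s $ b\<bar> * C b) < m" for s :: "real^'n"
  proof -
    define \<eta> where "\<eta> = (\<lambda>x. \<Sum>b\<in>UNIV. (s $ b) *\<^sub>R h b x)"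
    have quad: "v \<bullet> (\<eta> x *v v) = (\<Sum>b\<in>UNIV. s $ b * (v \<bullet> (h b x *v v)))" for x v
      by (simp add: \<eta>_def linear_sum[OF linear_ip(3)] ip_simps flip: ip_def)
    have pos1: "v \<bullet> ((g c x + \<eta> x) *v v) > 0" if x: "x \<in> B" and v: "norm v = 1" for x v
    proof -
      have xv: "(x, v) \<in> ?D" using x v by simp
      have "\<bar>v \<bullet> (\<eta> x *v v)\<bar> \<le> (\<Sum>b\<in>UNIV. \<bar>s $ b\<bar> * C b)"
        unfolding quad using C[OF xv]
        by (intro order_trans[OF sum_abs] sum_mono) (auto simp: abs_mult intro!: mult_left_mono)
      moreover have "v \<bullet> (g c x *v v) \<ge> m" using z(2)[OF xv] by (simp add: m_def)
      ultimately show ?thesis using s by (simp add: matrix_vector_mult_add_rdistrib inner_add_right)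
    qed
    have pos: "v \<bullet> ((g c x + \<eta> x) *v v) > 0" if x: "x \<in> B" and v: "v \<noteq> 0" for x v
    proof -
      have "ip (g c x + \<eta> x) (inverse (norm v) *\<^sub>R v) (inverse (norm v) *\<^sub>R v) > 0"
        using pos1[OF x, of "inverse (norm v) *\<^sub>R v"] v by (simp add: ip_def)
      then have "inverse (norm v) * (inverse (norm v) * ip (g c x + \<eta> x) v v) > 0"
        unfolding ip_simps(5,10) .
      then show ?thesis using v by (simp add: ip_def zero_less_mult_iff)
    qed
    have symeta: "transpose (\<eta> x) = \<eta> x" for x
    proof -
      have l: "linear (transpose :: real^'n^'n \<Rightarrow> real^'n^'n)"
        using bounded_linear_transpose linear_conv_bounded_linear by blast
      show ?thesis unfolding \<eta>_def by (simp add: linear_sum[OF l] linear_scale[OF l] sym)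
    qed
    have "(\<lambda>d y. g d y + lift c \<eta> d y) \<in> riemannian_metrics A"
    proof (rule metric_add_lift[OF g c _ B(1,2) _ symeta pos])
      show "smooth_on UNIV \<eta>"
        unfolding \<eta>_def by (rule smooth_on_sum[OF open_UNIV smooth_on_scaleR[OF open_UNIV smooth_on_const h]])
      show "\<eta> x = 0" if "x \<notin> B" for x by (simp add: \<eta>_def out[OF that])
    qed
    then show ?thesis unfolding \<eta>_def lift_sum .
  qed
  show ?thesis
    by (rule eventually_mono[OF small_combination[OF m, of C] lift])
qed

text \<open>On a compact set the distance to the centre metric attains a maximum m < e for each
  derivative, which leaves the margin e - m to the perturbation. Only finitely many lists of
  derivatives are involved.\<close>

lemma eventually_metric_nbhd:
  fixes h :: "'n \<Rightarrow> ('a, 'n) metric"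
  assumes g: "g \<in> metric_nbhd X A k g0 d K e" and g0: "g0 \<in> riemannian_metrics A" and d: "d \<in> A"
    and K: "compactin X K" "K \<subseteq> fst d" and h: "\<And>b. smooth_on (snd d ` fst d) (h b d)"
    and ev: "eventually (\<lambda>s :: real^'n. (\<lambda>d y. g d y + (\<Sum>b\<in>UNIV. (s $ b) *\<^sub>R h b d y)) \<in> riemannian_metrics A) (nhds 0)"
  shows "eventually (\<lambda>s :: real^'n. (\<lambda>d y. g d y + (\<Sum>b\<in>UNIV. (s $ b) *\<^sub>R h b d y)) \<in> metric_nbhd X A k g0 d K e) (nhds 0)"
proof -
  let ?V = "snd d ` fst d" and ?K = "snd d ` K"
  let ?g = "\<lambda>s :: real^'n. \<lambda>y. g d y + (\<Sum>b\<in>UNIV. (s $ b) *\<^sub>R h b d y)"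
  have V: "open ?V" by (rule chart_image_open[OF d])
  have cK: "compact ?K" by (rule compact_chart_image[OF d K])
  have KV: "?K \<subseteq> ?V" using K(2) by blast
  have gR: "g \<in> riemannian_metrics A" using g by (simp add: metric_nbhd_def)
  have smg: "smooth_on ?V (g d)" and smg0: "smooth_on ?V (g0 d)"
    by (rule metricD(1)[OF gR d], rule metricD(1)[OF g0 d])
  have one: "eventually (\<lambda>s. \<forall>x\<in>?K. norm (iter_partial js (?g s) x - iter_partial js (g0 d) x) < e) (nhds 0)"
    if js: "length js \<le> k" for js
  proof (cases "?K = {}")
    case False
    have cont: "continuous_on ?K (iter_partial js F)" if "smooth_on ?V F" for F :: "real^'n \<Rightarrow> real^'n^'n"
      using continuous_on_subset[OF smooth_on_continuous_on[OF smooth_on_iter_partial[OF that]] KV] .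
    obtain z where z: "z \<in> ?K" "\<And>y. y \<in> ?K \<Longrightarrow> norm (iter_partial js (g d) y - iter_partial js (g0 d) y)
       \<le> norm (iter_partial js (g d) z - iter_partial js (g0 d) z)"
      using continuous_attains_sup[OF cK False continuous_on_norm[OF continuous_on_diff[OF cont[OF smg] cont[OF smg0]]]] by blast
    define m where "m = norm (iter_partial js (g d) z - iter_partial js (g0 d) z)"
    have m: "e - m > 0" using g js z(1) by (auto simp: metric_nbhd_def m_def)
    have "\<exists>C. \<forall>y\<in>?K. norm (iter_partial js (h b d) y) \<le> C" for b
      using compact_imp_bounded[OF compact_continuous_image[OF cont[OF h] cK]] unfolding bounded_iff by blast
    then obtain C where C: "\<And>b y. y \<in> ?K \<Longrightarrow> norm (iter_partial js (h b d) y) \<le> C b" by metis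
    have "norm (iter_partial js (?g s) x - iter_partial js (g0 d) x) < e"
      if s: "(\<Sum>b\<in>UNIV. \<bar>s $ b\<bar> * C b) < e - m" and x: "x \<in> ?K" for s x
    proof -
      have xV: "x \<in> ?V" using x KV by blast
      have eq: "iter_partial js (?g s) x - iter_partial js (g0 d) x
        = (iter_partial js (g d) x - iter_partial js (g0 d) x) + (\<Sum>b\<in>UNIV. (s $ b) *\<^sub>R iter_partial js (h b d) x)"
        using iter_partial_add_sum[where h = "\<lambda>b. h b d" and s = "\<lambda>b. s $ b" and I = UNIV, OF V xV smg h, of js] by simp
      have "norm (iter_partial js (?g s) x - iter_partial js (g0 d) x)
        \<le> norm (iter_partial js (g d) x - iter_partial js (g0 d) x) + norm (\<Sum>b\<in>UNIV. (s $ b) *\<^sub>R iter_partial js (h b d) x)"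
        unfolding eq by (rule norm_triangle_ineq)
      also have "\<dots> \<le> m + (\<Sum>b\<in>UNIV. \<bar>s $ b\<bar> * C b)"
      proof (rule add_mono)
        show "norm (iter_partial js (g d) x - iter_partial js (g0 d) x) \<le> m" unfolding m_def by (rule z(2)[OF x])
        show "norm (\<Sum>b\<in>UNIV. (s $ b) *\<^sub>R iter_partial js (h b d) x) \<le> (\<Sum>b\<in>UNIV. \<bar>s $ b\<bar> * C b)"
          by (rule order_trans[OF norm_sum sum_mono]) (simp add: mult_left_mono C[OF x])
      qed
      finally show ?thesis using s by simp
    qed
    then show ?thesis using eventually_mono[OF small_combination[OF m, of C]] by simp
  qed simp
  have fin: "finite {js :: 'n list. length js \<le> k}"
    using finite_lists_length_le[of "UNIV :: 'n set" k] by simp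
  have "eventually (\<lambda>s. \<forall>js\<in>{js :: 'n list. length js \<le> k}. \<forall>x\<in>?K. norm (iter_partial js (?g s) x - iter_partial js (g0 d) x) < e) (nhds 0)"
    by (rule eventually_ball_finite[OF fin]) (use one in blast)
  with ev show ?thesis
    by (rule eventually_elim2) (simp add: metric_nbhd_def)
qed

text \<open>Continuity at s = 0 of the affine family of metrics, by induction over the generation of
  the topology from its subbasis.\<close>

lemma eventually_open:
  fixes h :: "'n \<Rightarrow> ('a, 'n) metric"
  assumes O: "openin (Ck_metric_topology X A k) W" and g: "g \<in> W"
    and h: "\<And>b d. d \<in> A \<Longrightarrow> smooth_on (snd d ` fst d) (h b d)"
    and ev: "eventually (\<lambda>s :: real^'n. (\<lambda>d y. g d y + (\<Sum>b\<in>UNIV. (s $ b) *\<^sub>R h b d y)) \<in> riemannian_metrics A) (nhds 0)"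
  shows "eventually (\<lambda>s :: real^'n. (\<lambda>d y. g d y + (\<Sum>b\<in>UNIV. (s $ b) *\<^sub>R h b d y)) \<in> W) (nhds 0)"
  using O[unfolded Ck_metric_topology_def openin_topology_generated_by_iff] g
proof (induction rule: generate_topology_on.induct)
  case (Int a b)
  then have "eventually (\<lambda>s :: real^'n. (\<lambda>d y. g d y + (\<Sum>b\<in>UNIV. (s $ b) *\<^sub>R h b d y)) \<in> a \<and>
      (\<lambda>d y. g d y + (\<Sum>b\<in>UNIV. (s $ b) *\<^sub>R h b d y)) \<in> b) (nhds 0)"
    by (intro eventually_conj) auto
  then show ?case by simp
next
  case (UN K)
  then obtain w where w: "w \<in> K" "g \<in> w" by blast
  show ?case by (rule eventually_mono[OF UN.IH[OF w]]) (rule UnionI[OF w(1)])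
next
  case (Basis w)
  then consider "w = riemannian_metrics A" | g0 d K e where "w = metric_nbhd X A k g0 d K e" "g0 \<in> riemannian_metrics A"
    "d \<in> A" "compactin X K" "K \<subseteq> fst d" by blast
  then show ?case
  proof cases
    case 1
    then show ?thesis using ev by simp
  next
    case 2
    then show ?thesis using eventually_metric_nbhd[OF _ 2(2-5) h ev] Basis.prems by simp
  qed
qed simp

text \<open>The set C of directions is a parameter because density is reached cap by cap.\<close>

definition nondegenerate :: "('a, 'n) chart \<Rightarrow> real^'n \<Rightarrow> (real^'n) set \<Rightarrow> ('a, 'n) metric set"
  where "nondegenerate c x C = {g \<in> riemannian_metrics A. \<forall>v\<in>C. norm v = 1 \<longrightarrow> \<not> degenerate_at (g c) x v}"

text \<open>Neighbourhoods that control the k-jet at the single point p suffice. If none of the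
  countably many shrinking ones worked, metrics in them with degenerate unit vectors in C would,
  along a subsequence, converge to g and to a degenerate direction of g in C.\<close>

lemma open_nondegenerate:
  assumes c: "c \<in> A" and p: "p \<in> fst c" and C: "closed C" and k: "k \<ge> 2" "CARD('n) = 3 \<Longrightarrow> k \<ge> 3"
  shows "openin (Ck_metric_topology X A k) (nondegenerate c (snd c p) C)"
proof (subst openin_subopen, rule ballI)
  fix g assume g: "g \<in> nondegenerate c (snd c p) C"
  let ?V = "snd c ` fst c" and ?x = "snd c p"
  have gR: "g \<in> riemannian_metrics A" using g by (simp add: nondegenerate_def)
  define N where "N = (\<lambda>m :: nat. metric_nbhd X A k g c {p} (inverse (real (Suc m))))"
  have pX: "compactin X {p}" using chart_subset[OF c] p by auto
  have No: "openin (Ck_metric_topology X A k) (N m)" for m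
    unfolding Ck_metric_topology_def
  proof (rule topology_generated_by_Basis, rule insertI2, rule CollectI)
    have "inverse (real (Suc m)) > 0" by simp
    then show "\<exists>g' c' K e. N m = metric_nbhd X A k g' c' K e \<and> g' \<in> riemannian_metrics A \<and> c' \<in> A \<and> compactin X K \<and> K \<subseteq> fst c' \<and> e > 0"
      unfolding N_def using gR c p pX by blast
  qed
  have gN: "g \<in> N m" for m using gR by (simp add: N_def metric_nbhd_def)
  have "\<exists>m. N m \<subseteq> nondegenerate c ?x C"
  proof (rule ccontr)
    assume "\<not> (\<exists>m. N m \<subseteq> nondegenerate c ?x C)"
    then have "\<forall>m. \<exists>h v. h \<in> N m \<and> v \<in> C \<and> norm v = 1 \<and> degenerate_at (h c) ?x v"
      by (auto simp: nondegenerate_def N_def metric_nbhd_def subset_iff) metis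
    then obtain h v where hv: "\<And>m. h m \<in> N m" "\<And>m. v m \<in> C" "\<And>m. norm (v m) = 1" "\<And>m. degenerate_at (h m c) ?x (v m)"
      by metis
    have "compact (C \<inter> sphere 0 1)" using C by (intro closed_Int_compact compact_sphere)
    moreover have "\<forall>m. v m \<in> C \<inter> sphere 0 1" using hv by simp
    ultimately obtain l r where l: "l \<in> C \<inter> sphere 0 1" and r: "strict_mono r" and lim: "(v \<circ> r) \<longlonglongrightarrow> l"
      unfolding compact_def by meson
    have hR: "h m \<in> riemannian_metrics A" for m using hv(1)[of m] by (simp add: N_def metric_nbhd_def)
    have V: "open ?V" by (rule chart_image_open[OF c])
    have jets: "(\<lambda>m. iter_partial js (h m c) ?x) \<longlonglongrightarrow> iter_partial js (g c) ?x" if "length js \<le> k" for js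
    proof -
      have "norm (iter_partial js (h m c) ?x - iter_partial js (g c) ?x) \<le> inverse (real (Suc m))" for m
        using hv(1)[of m] that by (auto simp: N_def metric_nbhd_def intro: less_imp_le)
      then have "(\<lambda>m. iter_partial js (h m c) ?x - iter_partial js (g c) ?x) \<longlonglongrightarrow> 0"
        by (intro Lim_null_comparison[OF _ LIMSEQ_inverse_real_of_nat]) auto
      then show ?thesis using LIM_zero_iff by blast
    qed
    interpret converging_metrics ?V "g c" "\<lambda>m. h (r m) c" ?x k
    proof (rule converging_metrics.intro)
      show "metric_domain ?V (g c)" by (rule metric_domain_chart[OF gR c V subset_refl])
      show "metric_domain ?V (h (r m) c)" for m by (rule metric_domain_chart[OF hR c V subset_refl])
      show "?x \<in> ?V" using p by blast
      show "(\<lambda>m. iter_partial js (h (r m) c) ?x) \<longlonglongrightarrow> iter_partial js (g c) ?x" if "length js \<le> k" for js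
        using LIMSEQ_subseq_LIMSEQ[OF jets[OF that] r] by (simp add: o_def)
    qed (rule k(1))
    have "degenerate_at (g c) ?x l"
      by (rule degenerate_limit[OF k(2) lim]) (use hv in auto)
    then show False using g l by (simp add: nondegenerate_def)
  qed
  then show "\<exists>T. openin (Ck_metric_topology X A k) T \<and> g \<in> T \<and> T \<subseteq> nondegenerate c ?x C"
    using No gN by blast
qed

text \<open>A neighbourhood of 0 in the parameter space is not a null set, so it contains a
  parameter outside the bad set. That the new metric again has the value G is what allows the next
  cap.\<close>

lemma perturb_cap:
  assumes c: "c \<in> A" and p: "p \<in> fst c" and card: "CARD('n) \<ge> 3"
    and G: "\<And>X Y. ip G X Y = ip G Y X" "\<forall>X. X \<noteq> 0 \<longrightarrow> ip G X X > 0" and v0: "v0 \<noteq> 0"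
  shows "\<exists>\<epsilon>>0. \<forall>g W. g \<in> riemannian_metrics A \<longrightarrow> g c (snd c p) = G \<longrightarrow> openin (Ck_metric_topology X A k) W \<longrightarrow> g \<in> W \<longrightarrow>
    (\<exists>g'\<in>W \<inter> nondegenerate c (snd c p) (cball v0 \<epsilon>). g' c (snd c p) = G)"
proof -
  let ?V = "snd c ` fst c" and ?x = "snd c p"
  have V: "open ?V" by (rule chart_image_open[OF c])
  have xV: "?x \<in> ?V" using p by blast
  obtain r where r: "r > 0" "cball ?x r \<subseteq> ?V" using V xV open_contains_cball by blast
  obtain h :: "'n \<Rightarrow> real^'n \<Rightarrow> real^'n^'n" and \<epsilon> where P: "(\<forall>b. perturbation ?x r (h b)) \<and> \<epsilon> > 0 \<and>
    (\<forall>S g. metric_domain S g \<longrightarrow> ?x \<in> S \<longrightarrow> g ?x = G \<longrightarrow>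
      negligible {s :: real^'n. metric_domain S (\<lambda>x. g x + (\<Sum>b\<in>UNIV. (s $ b) *\<^sub>R h b x)) \<and>
        (\<exists>v\<in>cball v0 \<epsilon>. norm v = 1 \<and> degenerate_at (\<lambda>x. g x + (\<Sum>b\<in>UNIV. (s $ b) *\<^sub>R h b x)) ?x v)})"
    using degenerate_negligible[OF G card v0 r(1), of ?x] by (elim exE) (rule that)
  then have h: "\<And>b. perturbation ?x r (h b)" and eps: "\<epsilon> > 0" by blast+
  note neg = P[THEN conjunct2, THEN conjunct2, rule_format]
  note h_sm = perturbation_basic(1)[OF h] and h_sym = perturbation_basic(2)[OF h] and h_x = perturbation_jet(1)[OF h]
  have h_out: "h b x = 0" if "x \<notin> cball ?x r" for b x
    using perturbation_basic(3)[OF h r(1), of x] that by simp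
  have cb: "compact (cball ?x r)" "cball ?x r \<noteq> {}" using r(1) by auto
  show ?thesis
  proof (intro exI conjI allI impI)
    show "\<epsilon> > 0" by (rule eps)
    fix g W assume gR: "g \<in> riemannian_metrics A" and gG: "g c ?x = G" and W: "openin (Ck_metric_topology X A k) W" and gW: "g \<in> W"
    define gs where "gs = (\<lambda>s :: real^'n. \<lambda>d y. g d y + (\<Sum>b\<in>UNIV. (s $ b) *\<^sub>R lift c (h b) d y))"
    have evR: "eventually (\<lambda>s. gs s \<in> riemannian_metrics A) (nhds 0)"
      unfolding gs_def by (rule eventually_metric[OF gR c h_sm cb(1) r(2) cb(2) h_out h_sym])
    have "eventually (\<lambda>s. gs s \<in> W) (nhds 0)"
      unfolding gs_def
      by (rule eventually_open[OF W gW lift_smooth[OF c _ h_sm cb(1) r(2) h_out] evR[unfolded gs_def]])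
    with evR have "eventually (\<lambda>s. gs s \<in> riemannian_metrics A \<and> gs s \<in> W) (nhds 0)" by (rule eventually_conj)
    then obtain T where T: "open T" "0 \<in> T" "\<And>s. s \<in> T \<Longrightarrow> gs s \<in> riemannian_metrics A \<and> gs s \<in> W"
      unfolding eventually_nhds by blast
    \<comment> \<open>The equality holds as functions on the whole coordinate space: outside the
      chart image both corrections are zero, since the h are supported in the ball.\<close>
    have gsc: "gs s c = (\<lambda>x. g c x + (\<Sum>b\<in>UNIV. (s $ b) *\<^sub>R h b x))" for s
    proof
      fix x
      show "gs s c x = g c x + (\<Sum>b\<in>UNIV. (s $ b) *\<^sub>R h b x)"
      proof (cases "x \<in> ?V")
        case True
        then show ?thesis by (simp add: gs_def lift_self[OF c])
      next
        case False
        then have "x \<notin> cball ?x r" using r(2) by blast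
        moreover have "lift c (h b) c x = 0" for b using False by (simp add: lift_def)
        ultimately show ?thesis by (simp add: gs_def h_out)
      qed
    qed
    have md: "metric_domain ?V (g c)" by (rule metric_domain_chart[OF gR c V subset_refl])
    have "\<not> T \<subseteq> {s. metric_domain ?V (gs s c) \<and> (\<exists>v\<in>cball v0 \<epsilon>. norm v = 1 \<and> degenerate_at (gs s c) ?x v)}"
      using neg[OF md xV gG] open_not_negligible[OF T(1)] T(2) negligible_subset unfolding gsc by blast
    then obtain s where s: "s \<in> T" "\<not> (metric_domain ?V (gs s c) \<and> (\<exists>v\<in>cball v0 \<epsilon>. norm v = 1 \<and> degenerate_at (gs s c) ?x v))"
      by blast
    have sR: "gs s \<in> riemannian_metrics A" "gs s \<in> W" using T(3)[OF s(1)] by auto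
    have "metric_domain ?V (gs s c)" by (rule metric_domain_chart[OF sR(1) c V subset_refl])
    then have "gs s \<in> nondegenerate c ?x (cball v0 \<epsilon>)" using s(2) sR(1) by (auto simp: nondegenerate_def)
    moreover have "gs s c ?x = G" by (simp add: gsc gG h_x)
    ultimately show "\<exists>g'\<in>W \<inter> nondegenerate c ?x (cball v0 \<epsilon>). g' c ?x = G" using sR(2) by blast
  qed
qed

text \<open>Induction over finitely many caps covering the sphere. Nondegeneracy on the caps already
  treated is made part of the open set from which the next metric is taken.\<close>

lemma dense_nondegenerate:
  assumes c: "c \<in> A" and p: "p \<in> fst c" and card: "CARD('n) \<ge> 3" and k: "k \<ge> 2" "CARD('n) = 3 \<Longrightarrow> k \<ge> 3"
    and g: "g \<in> riemannian_metrics A" and W: "openin (Ck_metric_topology X A k) W" "g \<in> W"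
  shows "\<exists>g'\<in>W. g' \<in> nondegenerate c (snd c p) UNIV"
proof -
  let ?x = "snd c p"
  define G where "G = g c ?x"
  have xV: "?x \<in> snd c ` fst c" using p by blast
  interpret metric_domain "snd c ` fst c" "g c"
    by (rule metric_domain_chart[OF g c chart_image_open[OF c] subset_refl])
  have Gsym: "ip G X Y = ip G Y X" for X Y unfolding G_def by (rule ip_sym[OF xV])
  have Gpos: "\<forall>X. X \<noteq> 0 \<longrightarrow> ip G X X > 0" unfolding G_def using ip_pos[OF xV] by blast
  have "\<forall>v0. v0 \<noteq> 0 \<longrightarrow> (\<exists>\<epsilon>>0. \<forall>g W. g \<in> riemannian_metrics A \<longrightarrow> g c ?x = G \<longrightarrow> openin (Ck_metric_topology X A k) W \<longrightarrow> g \<in> W \<longrightarrow>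
    (\<exists>g'\<in>W \<inter> nondegenerate c ?x (cball v0 \<epsilon>). g' c ?x = G))"
    using perturb_cap[OF c p card Gsym Gpos] by blast
  then obtain \<epsilon> where eps: "\<And>v0. v0 \<noteq> 0 \<Longrightarrow> \<epsilon> v0 > 0"
    and cap: "\<And>v0 g W. v0 \<noteq> 0 \<Longrightarrow> g \<in> riemannian_metrics A \<Longrightarrow> g c ?x = G \<Longrightarrow> openin (Ck_metric_topology X A k) W \<Longrightarrow> g \<in> W \<Longrightarrow>
      (\<exists>g'\<in>W \<inter> nondegenerate c ?x (cball v0 (\<epsilon> v0)). g' c ?x = G)"
    by metis
  have step: "\<exists>g'\<in>W \<inter> nondegenerate c ?x (\<Union>v\<in>F. cball v (\<epsilon> v)). g' c ?x = G" if "finite F" "F \<subseteq> sphere 0 1" for F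
    using that
  proof (induction F rule: finite_induct)
    case empty
    show ?case by (rule bexI[of _ g]) (use g W in \<open>auto simp: nondegenerate_def G_def\<close>)
  next
    case (insert v F)
    let ?C = "\<Union>v\<in>F. cball v (\<epsilon> v)"
    obtain g1 where g1: "g1 \<in> W" "g1 \<in> nondegenerate c ?x ?C" "g1 c ?x = G" using insert by auto
    have "closed ?C" using insert.hyps(1) by (intro closed_UN) auto
    then have o: "openin (Ck_metric_topology X A k) (W \<inter> nondegenerate c ?x ?C)"
      by (intro openin_Int W(1) open_nondegenerate[OF c p _ k])
    have "v \<noteq> 0" using insert.prems by auto
    from cap[of v g1, OF this _ g1(3) o] g1 obtain g2 where "g2 \<in> W" "g2 \<in> nondegenerate c ?x ?C"
      "g2 \<in> nondegenerate c ?x (cball v (\<epsilon> v))" "g2 c ?x = G" by (auto simp: nondegenerate_def)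
    then show ?case by (intro bexI[of _ g2]) (auto simp: nondegenerate_def)
  qed
  have cover: "sphere (0::real^'n) 1 \<subseteq> (\<Union>v\<in>sphere 0 1. ball v (\<epsilon> v))"
  proof
    fix v :: "real^'n" assume v: "v \<in> sphere 0 1"
    then have "v \<noteq> 0" by auto
    then show "v \<in> (\<Union>v\<in>sphere 0 1. ball v (\<epsilon> v))" using v eps by (intro UN_I[of v]) auto
  qed
  obtain F where F: "F \<subseteq> sphere 0 1" "finite F" "sphere (0::real^'n) 1 \<subseteq> (\<Union>v\<in>F. ball v (\<epsilon> v))"
    using compactE_image[OF compact_sphere _ cover] by blast
  obtain g' where g': "g' \<in> W" "g' \<in> nondegenerate c ?x (\<Union>v\<in>F. cball v (\<epsilon> v))"
    using step[OF F(2,1)] by blast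
  have "g' \<in> nondegenerate c ?x UNIV"
    unfolding nondegenerate_def
  proof (intro CollectI conjI ballI impI)
    show "g' \<in> riemannian_metrics A" using g'(2) by (simp add: nondegenerate_def)
    fix v :: "real^'n" assume v: "norm v = 1"
    then have "v \<in> sphere 0 1" by simp
    then obtain w where "w \<in> F" "v \<in> ball w (\<epsilon> w)" using F(3) by blast
    then have "v \<in> (\<Union>v\<in>F. cball v (\<epsilon> v))" by (intro UN_I[of w]) auto
    with g'(2) v show "\<not> degenerate_at (g' c) ?x v" unfolding nondegenerate_def by blast
  qed
  then show ?thesis using g'(1) by blast
qed

end

theorem theorem1p9:
  fixes M :: "'a topology" and A :: "('a, 'n::finite) chart set" and U :: "'a set"
  assumes "smooth_manifold M A" and "compact_space M"
    and "CARD('n) \<ge> 3"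
    and "openin M U" and "U \<noteq> {}"
  defines "\<T> \<equiv> Ck_metric_topology M A (if CARD('n) = 3 then 3 else 2)"
  shows "\<exists>W. openin \<T> W \<and> \<T> closure_of W = riemannian_metrics A \<and>
    W \<subseteq> {g \<in> riemannian_metrics A. \<not> (\<exists>\<phi>. limiting_carleman_weight A g U \<phi>)}"
proof -
  interpret smooth_atlas_manifold M A by unfold_locales (rule assms(1))
  let ?k = "if CARD('n) = 3 then 3 else 2 :: nat"
  have k: "?k \<ge> 2" "CARD('n) = 3 \<Longrightarrow> ?k \<ge> 3" by auto
  have "U \<subseteq> (\<Union>c\<in>A. fst c)"
    using openin_subset[OF assms(4)] assms(1) by (simp add: smooth_manifold_def smooth_atlas_def)
  then obtain c p where c: "c \<in> A" and p: "p \<in> fst c" "p \<in> U" using assms(5) by blast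
  \<comment> \<open>One point p of U decides: a weight on U would produce a degenerate direction
    there.\<close>
  define W where "W = nondegenerate c (snd c p) UNIV"
  have "\<T> closure_of W = riemannian_metrics A"
  proof (rule set_eqI)
    fix g
    show "g \<in> \<T> closure_of W \<longleftrightarrow> g \<in> riemannian_metrics A"
      using dense_nondegenerate[OF c p(1) assms(3) k]
      unfolding in_closure_of \<T>_def topspace_Ck_metric_topology W_def by blast
  qed
  moreover have "openin \<T> W"
    unfolding \<T>_def W_def by (rule open_nondegenerate[OF c p(1) closed_UNIV k])
  moreover have "W \<subseteq> {g \<in> riemannian_metrics A. \<not> (\<exists>\<phi>. limiting_carleman_weight A g U \<phi>)}"
    using weight_degenerate[OF _ c assms(4) p] by (auto simp: W_def nondegenerate_def)
  ultimately show ?thesis by blast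
qed

end
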